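(* Let $\mathcal D$ be a $K$-linear, Krull-Schmidt, Hom-finite triangulated category with a basic silting object $S=\bigoplus_{i=1}^nS_i$. Let $U\in\mathrm{add}(S)$ and let $T\in S\ast S[1]$ be a basic silting object. Then $\mathcal T_U(T)$ is a basic silting object and $\mathcal T_U(T)\in S\ast S[1]$.
   Context: $K$ is a field and $[1]$ is the shift. $\mathrm{add}(X)$ is the full subcategory of direct summands of finite direct sums of copies of $X$; $X^\flat$ is the basic object (pairwise non-isomorphic indecomposable summands), unique up to isomorphism, with $\mathrm{add}(X^\flat)=\mathrm{add}(X)$. An object $U$ is presilting if $\mathrm{Hom}_{\mathcal D}(U,U[i])=0$ for all $i>0$; a presilting object $S$ is silting if $\mathcal D=\mathrm{thick}(S)$. $X\ast Y$ denotes the full subcategory of all $Z\in\mathcal D$ for which there is a triangle $X'\to Z\to Y'\to X'[1]$ with $X'\in\mathrm{add}(X)$, $Y'\in\mathrm{add}(Y)$. Co-Bongartz completion: for objects $U,W$ take a triangle $W[-1]\xrightarrow{f}U'\to X_U\to W$, where $f$ is a left minimal $\mathrm{add}(U)$-approximation of $W[-1]$ (i.e. $U'\in\mathrm{add}(U)$, every morphism from $W[-1]$ to an object of $\mathrm{add}(U)$ factors through $f$, and $f$ has no direct summand $0\to U_1$ with $U_1\neq0$). Then $\mathcal T_U(W):=(U\oplus X_U)^\flat$. *)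

theory Defs
  imports "HOL-Algebra.Module"
begin

text \<open>
  The data of a \<open>K\<close>-linear category with shift functors \<open>[n]\<close> for every integer \<open>n\<close> and a class of
  distinguished triangles \<open>X \<rightarrow> Y \<rightarrow> Z \<rightarrow> X[1]\<close>. The morphisms \<open>X \<rightarrow> Y\<close> are the elements of
  \<^term>\<open>carrier (Hom D X Y)\<close>; of the library record \<open>module\<close>, the multiplicative fields \<open>mult\<close> and
  \<open>one\<close> of \<open>Hom D X Y\<close> carry no meaning.
\<close>

record ('k, 'o, 'm) tri_cat =
  Obj :: "'o set"
  Hom :: "'o \<Rightarrow> 'o \<Rightarrow> ('k, 'm) module"
  ident :: "'o \<Rightarrow> 'm"
  comp :: "'m \<Rightarrow> 'm \<Rightarrow> 'm" (infixl "\<cdot>\<index>" 70)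
  shift :: "int \<Rightarrow> 'o \<Rightarrow> 'o"
  shift_mor :: "int \<Rightarrow> 'm \<Rightarrow> 'm"
  dist_tri :: "'o \<Rightarrow> 'o \<Rightarrow> 'o \<Rightarrow> 'm \<Rightarrow> 'm \<Rightarrow> 'm \<Rightarrow> bool"

abbreviation Mor :: "('k, 'o, 'm) tri_cat \<Rightarrow> 'o \<Rightarrow> 'o \<Rightarrow> 'm set" where
  "Mor D X Y \<equiv> carrier (Hom D X Y)"


section \<open>Linear categories\<close>

locale linear_category = K?: field K
  for K :: "('k, 'e) ring_scheme" and D :: "('k, 'o, 'm) tri_cat" (structure) +
  assumes Hom_module: "\<lbrakk>X \<in> Obj D; Y \<in> Obj D\<rbrakk> \<Longrightarrow> module K (Hom D X Y)"
    and ident_Mor: "X \<in> Obj D \<Longrightarrow> ident D X \<in> Mor D X X"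
    and comp_Mor: "\<lbrakk>X \<in> Obj D; Y \<in> Obj D; Z \<in> Obj D; f \<in> Mor D X Y; g \<in> Mor D Y Z\<rbrakk>
      \<Longrightarrow> g \<cdot> f \<in> Mor D X Z"
    and comp_ident: "\<lbrakk>X \<in> Obj D; Y \<in> Obj D; f \<in> Mor D X Y\<rbrakk> \<Longrightarrow> f \<cdot> ident D X = f"
    and ident_comp: "\<lbrakk>X \<in> Obj D; Y \<in> Obj D; f \<in> Mor D X Y\<rbrakk> \<Longrightarrow> ident D Y \<cdot> f = f"
    and comp_assoc: "\<lbrakk>W \<in> Obj D; X \<in> Obj D; Y \<in> Obj D; Z \<in> Obj D;
      f \<in> Mor D W X; g \<in> Mor D X Y; h \<in> Mor D Y Z\<rbrakk> \<Longrightarrow> h \<cdot> (g \<cdot> f) = (h \<cdot> g) \<cdot> f"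
    and comp_add_right: "\<lbrakk>X \<in> Obj D; Y \<in> Obj D; Z \<in> Obj D;
      f \<in> Mor D X Y; f' \<in> Mor D X Y; g \<in> Mor D Y Z\<rbrakk>
      \<Longrightarrow> g \<cdot> (f \<oplus>\<^bsub>Hom D X Y\<^esub> f') = g \<cdot> f \<oplus>\<^bsub>Hom D X Z\<^esub> g \<cdot> f'"
    and comp_add_left: "\<lbrakk>X \<in> Obj D; Y \<in> Obj D; Z \<in> Obj D;
      f \<in> Mor D X Y; g \<in> Mor D Y Z; g' \<in> Mor D Y Z\<rbrakk>
      \<Longrightarrow> (g \<oplus>\<^bsub>Hom D Y Z\<^esub> g') \<cdot> f = g \<cdot> f \<oplus>\<^bsub>Hom D X Z\<^esub> g' \<cdot> f"
    and comp_smult_right: "\<lbrakk>X \<in> Obj D; Y \<in> Obj D; Z \<in> Obj D;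
      a \<in> carrier K; f \<in> Mor D X Y; g \<in> Mor D Y Z\<rbrakk>
      \<Longrightarrow> g \<cdot> (a \<odot>\<^bsub>Hom D X Y\<^esub> f) = a \<odot>\<^bsub>Hom D X Z\<^esub> (g \<cdot> f)"
    and comp_smult_left: "\<lbrakk>X \<in> Obj D; Y \<in> Obj D; Z \<in> Obj D;
      a \<in> carrier K; f \<in> Mor D X Y; g \<in> Mor D Y Z\<rbrakk>
      \<Longrightarrow> (a \<odot>\<^bsub>Hom D Y Z\<^esub> g) \<cdot> f = a \<odot>\<^bsub>Hom D X Z\<^esub> (g \<cdot> f)"

definition iso_mor :: "('k, 'o, 'm) tri_cat \<Rightarrow> 'o \<Rightarrow> 'o \<Rightarrow> 'm \<Rightarrow> bool" where
  "iso_mor D X Y f \<longleftrightarrow> f \<in> Mor D X Y \<and>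
     (\<exists>g \<in> Mor D Y X. g \<cdot>\<^bsub>D\<^esub> f = ident D X \<and> f \<cdot>\<^bsub>D\<^esub> g = ident D Y)"

definition isomorphic :: "('k, 'o, 'm) tri_cat \<Rightarrow> 'o \<Rightarrow> 'o \<Rightarrow> bool" where
  "isomorphic D X Y \<longleftrightarrow> X \<in> Obj D \<and> Y \<in> Obj D \<and> (\<exists>f. iso_mor D X Y f)"

definition zero_obj :: "('k, 'o, 'm) tri_cat \<Rightarrow> 'o \<Rightarrow> bool" where
  "zero_obj D Z \<longleftrightarrow> Z \<in> Obj D \<and>
     (\<forall>X \<in> Obj D. Mor D Z X = {\<zero>\<^bsub>Hom D Z X\<^esub>} \<and> Mor D X Z = {\<zero>\<^bsub>Hom D X Z\<^esub>})"

definition biproduct ::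
  "('k, 'o, 'm) tri_cat \<Rightarrow> 'o \<Rightarrow> 'o list \<Rightarrow> (nat \<Rightarrow> 'm) \<Rightarrow> (nat \<Rightarrow> 'm) \<Rightarrow> bool" where
  "biproduct D X Ys \<iota> \<pi> \<longleftrightarrow> X \<in> Obj D \<and> set Ys \<subseteq> Obj D \<and>
     (\<forall>i < length Ys. \<iota> i \<in> Mor D (Ys ! i) X \<and> \<pi> i \<in> Mor D X (Ys ! i)) \<and>
     (\<forall>i < length Ys. \<forall>j < length Ys. \<pi> j \<cdot>\<^bsub>D\<^esub> \<iota> i =
        (if i = j then ident D (Ys ! i) else \<zero>\<^bsub>Hom D (Ys ! i) (Ys ! j)\<^esub>)) \<and>
     (\<Oplus>\<^bsub>Hom D X X\<^esub> i \<in> {..<length Ys}. \<iota> i \<cdot>\<^bsub>D\<^esub> \<pi> i) = ident D X"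

definition direct_sum :: "('k, 'o, 'm) tri_cat \<Rightarrow> 'o \<Rightarrow> 'o list \<Rightarrow> bool" where
  "direct_sum D X Ys \<longleftrightarrow> (\<exists>\<iota> \<pi>. biproduct D X Ys \<iota> \<pi>)"

locale additive_category = linear_category +
  assumes ex_zero_obj: "\<exists>Z. zero_obj D Z"
    and ex_direct_sum: "\<lbrakk>X \<in> Obj D; Y \<in> Obj D\<rbrakk> \<Longrightarrow> \<exists>Z. direct_sum D Z [X, Y]"


section \<open>Triangulated categories\<close>

text \<open>
  The shift is an automorphism of the category, presented by its integer powers:
  \<open>[m] \<circ> [n] = [m + n]\<close> and \<open>[0] = id\<close> hold strictly.
\<close>

locale shift_category = additive_category +
  assumes shift_Obj: "X \<in> Obj D \<Longrightarrow> shift D n X \<in> Obj D"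
    and shift_0: "X \<in> Obj D \<Longrightarrow> shift D 0 X = X"
    and shift_shift: "X \<in> Obj D \<Longrightarrow> shift D m (shift D n X) = shift D (m + n) X"
    and shift_Mor: "\<lbrakk>X \<in> Obj D; Y \<in> Obj D; f \<in> Mor D X Y\<rbrakk>
      \<Longrightarrow> shift_mor D n f \<in> Mor D (shift D n X) (shift D n Y)"
    and shift_mor_0: "\<lbrakk>X \<in> Obj D; Y \<in> Obj D; f \<in> Mor D X Y\<rbrakk> \<Longrightarrow> shift_mor D 0 f = f"
    and shift_mor_shift_mor: "\<lbrakk>X \<in> Obj D; Y \<in> Obj D; f \<in> Mor D X Y\<rbrakk>
      \<Longrightarrow> shift_mor D m (shift_mor D n f) = shift_mor D (m + n) f"
    and shift_mor_ident: "X \<in> Obj D \<Longrightarrow> shift_mor D n (ident D X) = ident D (shift D n X)"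
    and shift_mor_comp: "\<lbrakk>X \<in> Obj D; Y \<in> Obj D; Z \<in> Obj D; f \<in> Mor D X Y; g \<in> Mor D Y Z\<rbrakk>
      \<Longrightarrow> shift_mor D n (g \<cdot> f) = shift_mor D n g \<cdot> shift_mor D n f"
    and shift_mor_add: "\<lbrakk>X \<in> Obj D; Y \<in> Obj D; f \<in> Mor D X Y; g \<in> Mor D X Y\<rbrakk>
      \<Longrightarrow> shift_mor D n (f \<oplus>\<^bsub>Hom D X Y\<^esub> g) =
            shift_mor D n f \<oplus>\<^bsub>Hom D (shift D n X) (shift D n Y)\<^esub> shift_mor D n g"
    and shift_mor_smult: "\<lbrakk>X \<in> Obj D; Y \<in> Obj D; a \<in> carrier K; f \<in> Mor D X Y\<rbrakk>
      \<Longrightarrow> shift_mor D n (a \<odot>\<^bsub>Hom D X Y\<^esub> f) =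
            a \<odot>\<^bsub>Hom D (shift D n X) (shift D n Y)\<^esub> shift_mor D n f"

definition candidate_tri ::
  "('k, 'o, 'm) tri_cat \<Rightarrow> 'o \<Rightarrow> 'o \<Rightarrow> 'o \<Rightarrow> 'm \<Rightarrow> 'm \<Rightarrow> 'm \<Rightarrow> bool" where
  "candidate_tri D X Y Z f g h \<longleftrightarrow> X \<in> Obj D \<and> Y \<in> Obj D \<and> Z \<in> Obj D \<and>
     f \<in> Mor D X Y \<and> g \<in> Mor D Y Z \<and> h \<in> Mor D Z (shift D 1 X)"

locale triangulated_category = shift_category +
  assumes tri_candidate: "dist_tri D X Y Z f g h \<Longrightarrow> candidate_tri D X Y Z f g h"
    and tri_iso: "\<lbrakk>dist_tri D X Y Z f g h; candidate_tri D X' Y' Z' f' g' h';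
      iso_mor D X X' a; iso_mor D Y Y' b; iso_mor D Z Z' c;
      b \<cdot> f = f' \<cdot> a; c \<cdot> g = g' \<cdot> b; shift_mor D 1 a \<cdot> h = h' \<cdot> c\<rbrakk>
      \<Longrightarrow> dist_tri D X' Y' Z' f' g' h'"
    and tri_ident: "\<lbrakk>X \<in> Obj D; zero_obj D Z\<rbrakk>
      \<Longrightarrow> dist_tri D X X Z (ident D X) \<zero>\<^bsub>Hom D X Z\<^esub> \<zero>\<^bsub>Hom D Z (shift D 1 X)\<^esub>"
    and tri_cone: "\<lbrakk>X \<in> Obj D; Y \<in> Obj D; f \<in> Mor D X Y\<rbrakk> \<Longrightarrow> \<exists>Z g h. dist_tri D X Y Z f g h"
    and tri_rotate: "candidate_tri D X Y Z f g h \<Longrightarrow> dist_tri D X Y Z f g h \<longleftrightarrow>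
      dist_tri D Y Z (shift D 1 X) g h (\<ominus>\<^bsub>Hom D (shift D 1 X) (shift D 1 Y)\<^esub> shift_mor D 1 f)"
    and tri_complete: "\<lbrakk>dist_tri D X Y Z f g h; dist_tri D X' Y' Z' f' g' h';
      a \<in> Mor D X X'; b \<in> Mor D Y Y'; b \<cdot> f = f' \<cdot> a\<rbrakk>
      \<Longrightarrow> \<exists>c \<in> Mor D Z Z'. c \<cdot> g = g' \<cdot> b \<and> shift_mor D 1 a \<cdot> h = h' \<cdot> c"
    and octahedral: "\<lbrakk>dist_tri D X Y Z' f u v; dist_tri D Y Z X' g r s;
      dist_tri D X Z Y' (g \<cdot> f) p q\<rbrakk>
      \<Longrightarrow> \<exists>a b. dist_tri D Z' Y' X' a b (shift_mor D 1 u \<cdot> s) \<and>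
            a \<cdot> u = p \<cdot> g \<and> q \<cdot> a = v \<and> b \<cdot> p = r \<and> s \<cdot> b = shift_mor D 1 f \<cdot> q"


section \<open>Hom-finiteness and the Krull-Schmidt property\<close>

definition hom_finite :: "('k, 'e) ring_scheme \<Rightarrow> ('k, 'o, 'm) tri_cat \<Rightarrow> bool" where
  "hom_finite K D \<longleftrightarrow> (\<forall>X \<in> Obj D. \<forall>Y \<in> Obj D. \<exists>B. finite B \<and> B \<subseteq> Mor D X Y \<and>
     (\<forall>f \<in> Mor D X Y. \<exists>a \<in> B \<rightarrow> carrier K. f = (\<Oplus>\<^bsub>Hom D X Y\<^esub> b \<in> B. a b \<odot>\<^bsub>Hom D X Y\<^esub> b)))"

definition End_ring :: "('k, 'o, 'm) tri_cat \<Rightarrow> 'o \<Rightarrow> 'm ring" where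
  "End_ring D X = \<lparr>carrier = Mor D X X, mult = comp D, one = ident D X,
     zero = \<zero>\<^bsub>Hom D X X\<^esub>, add = add (Hom D X X)\<rparr>"

text \<open>Local in the sense of not necessarily commutative rings: the non-units form an ideal,
  equivalently they are closed under addition and \<open>1 \<noteq> 0\<close>.\<close>

definition local_ring :: "('a, 'b) ring_scheme \<Rightarrow> bool" where
  "local_ring R \<longleftrightarrow> ring R \<and> \<one>\<^bsub>R\<^esub> \<noteq> \<zero>\<^bsub>R\<^esub> \<and>
     (\<forall>a \<in> carrier R - Units R. \<forall>b \<in> carrier R - Units R. a \<oplus>\<^bsub>R\<^esub> b \<notin> Units R)"

definition krull_schmidt :: "('k, 'o, 'm) tri_cat \<Rightarrow> bool" where
  "krull_schmidt D \<longleftrightarrow>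
     (\<forall>X \<in> Obj D. \<exists>Ys. direct_sum D X Ys \<and> (\<forall>Y \<in> set Ys. local_ring (End_ring D Y)))"


section \<open>Basic and silting objects\<close>

definition indecomposable :: "('k, 'o, 'm) tri_cat \<Rightarrow> 'o \<Rightarrow> bool" where
  "indecomposable D X \<longleftrightarrow> X \<in> Obj D \<and> \<not> zero_obj D X \<and>
     (\<forall>A B. direct_sum D X [A, B] \<longrightarrow> zero_obj D A \<or> zero_obj D B)"

definition add_of :: "('k, 'o, 'm) tri_cat \<Rightarrow> 'o \<Rightarrow> 'o set" where
  "add_of D X = {Y. \<exists>Y' Z n. direct_sum D Z (replicate n X) \<and> direct_sum D Z [Y, Y']}"

definition basic_decomposition :: "('k, 'o, 'm) tri_cat \<Rightarrow> 'o \<Rightarrow> 'o list \<Rightarrow> bool" where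
  "basic_decomposition D X Ys \<longleftrightarrow> direct_sum D X Ys \<and> (\<forall>Y \<in> set Ys. indecomposable D Y) \<and>
     (\<forall>i < length Ys. \<forall>j < length Ys. i \<noteq> j \<longrightarrow> \<not> isomorphic D (Ys ! i) (Ys ! j))"

definition basic :: "('k, 'o, 'm) tri_cat \<Rightarrow> 'o \<Rightarrow> bool" where
  "basic D X \<longleftrightarrow> (\<exists>Ys. basic_decomposition D X Ys)"

text \<open>\<open>B = X\<^sup>\<flat>\<close>; as \<open>X\<^sup>\<flat>\<close> is only unique up to isomorphism, this is a relation.\<close>

definition is_flat :: "('k, 'o, 'm) tri_cat \<Rightarrow> 'o \<Rightarrow> 'o \<Rightarrow> bool" where
  "is_flat D X B \<longleftrightarrow> basic D B \<and> add_of D B = add_of D X"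

definition presilting :: "('k, 'o, 'm) tri_cat \<Rightarrow> 'o \<Rightarrow> bool" where
  "presilting D U \<longleftrightarrow> U \<in> Obj D \<and>
     (\<forall>i > 0. Mor D U (shift D i U) = {\<zero>\<^bsub>Hom D U (shift D i U)\<^esub>})"

definition thick_subcategory :: "('k, 'o, 'm) tri_cat \<Rightarrow> 'o set \<Rightarrow> bool" where
  "thick_subcategory D C \<longleftrightarrow> C \<subseteq> Obj D \<and> C \<noteq> {} \<and>
     (\<forall>X Y. X \<in> C \<and> isomorphic D X Y \<longrightarrow> Y \<in> C) \<and>
     (\<forall>X \<in> C. \<forall>n. shift D n X \<in> C) \<and>
     (\<forall>X Y Z f g h. dist_tri D X Y Z f g h \<and> X \<in> C \<and> Y \<in> C \<longrightarrow> Z \<in> C) \<and>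
     (\<forall>X A B. direct_sum D X [A, B] \<and> X \<in> C \<longrightarrow> A \<in> C \<and> B \<in> C)"

definition thick :: "('k, 'o, 'm) tri_cat \<Rightarrow> 'o \<Rightarrow> 'o set" where
  "thick D X = \<Inter> {C. thick_subcategory D C \<and> X \<in> C}"

definition silting :: "('k, 'o, 'm) tri_cat \<Rightarrow> 'o \<Rightarrow> bool" where
  "silting D S \<longleftrightarrow> presilting D S \<and> thick D S = Obj D"

definition star :: "('k, 'o, 'm) tri_cat \<Rightarrow> 'o \<Rightarrow> 'o \<Rightarrow> 'o set" where
  "star D X Y = {Z. \<exists>X' \<in> add_of D X. \<exists>Y' \<in> add_of D Y. \<exists>f g h. dist_tri D X' Z Y' f g h}"


section \<open>Co-Bongartz completion\<close>

definition left_approximation ::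
  "('k, 'o, 'm) tri_cat \<Rightarrow> 'o \<Rightarrow> 'o \<Rightarrow> 'o \<Rightarrow> 'm \<Rightarrow> bool" where
  "left_approximation D U V U' f \<longleftrightarrow> U' \<in> add_of D U \<and> f \<in> Mor D V U' \<and>
     (\<forall>U'' \<in> add_of D U. \<forall>g \<in> Mor D V U''. \<exists>k \<in> Mor D U' U''. g = k \<cdot>\<^bsub>D\<^esub> f)"

text \<open>
  \<open>f\<^sub>1 : V\<^sub>1 \<rightarrow> W\<^sub>1\<close> is a direct summand of \<open>f : V \<rightarrow> W\<close> in the category of morphisms: \<open>f\<close> is identified
  with \<open>f\<^sub>1 \<oplus> f\<^sub>2\<close> for some \<open>f\<^sub>2 : V\<^sub>2 \<rightarrow> W\<^sub>2\<close>.
\<close>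

definition mor_summand ::
  "('k, 'o, 'm) tri_cat \<Rightarrow> 'o \<Rightarrow> 'o \<Rightarrow> 'm \<Rightarrow> 'o \<Rightarrow> 'o \<Rightarrow> 'm \<Rightarrow> bool" where
  "mor_summand D V W f V\<^sub>1 W\<^sub>1 f\<^sub>1 \<longleftrightarrow> f \<in> Mor D V W \<and> f\<^sub>1 \<in> Mor D V\<^sub>1 W\<^sub>1 \<and>
     (\<exists>V\<^sub>2 W\<^sub>2 \<iota> \<pi> \<iota>' \<pi>'. \<exists>f\<^sub>2 \<in> Mor D V\<^sub>2 W\<^sub>2.
        biproduct D V [V\<^sub>1, V\<^sub>2] \<iota> \<pi> \<and> biproduct D W [W\<^sub>1, W\<^sub>2] \<iota>' \<pi>' \<and>
        f \<cdot>\<^bsub>D\<^esub> \<iota> 0 = \<iota>' 0 \<cdot>\<^bsub>D\<^esub> f\<^sub>1 \<and> f \<cdot>\<^bsub>D\<^esub> \<iota> 1 = \<iota>' 1 \<cdot>\<^bsub>D\<^esub> f\<^sub>2)"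

definition left_minimal :: "('k, 'o, 'm) tri_cat \<Rightarrow> 'o \<Rightarrow> 'o \<Rightarrow> 'm \<Rightarrow> bool" where
  "left_minimal D V W f \<longleftrightarrow>
     \<not> (\<exists>Z U\<^sub>1. zero_obj D Z \<and> U\<^sub>1 \<in> Obj D \<and> \<not> zero_obj D U\<^sub>1 \<and>
          mor_summand D V W f Z U\<^sub>1 \<zero>\<^bsub>Hom D Z U\<^sub>1\<^esub>)"

text \<open>
  \<open>B\<close> is a co-Bongartz completion \<open>\<T>\<^sub>U(W)\<close>; like \<^const>\<open>is_flat\<close> a relation, since the triangle, the
  direct sum \<open>P = U \<oplus> X\<close> and its basic object are only determined up to isomorphism. The last
  morphism \<open>h\<close> goes from \<open>X\<close> to \<open>W[-1][1] = W\<close>.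
\<close>

definition is_co_bongartz :: "('k, 'o, 'm) tri_cat \<Rightarrow> 'o \<Rightarrow> 'o \<Rightarrow> 'o \<Rightarrow> bool" where
  "is_co_bongartz D U W B \<longleftrightarrow> U \<in> Obj D \<and> W \<in> Obj D \<and>
     (\<exists>U' X f g h P.
        left_approximation D U (shift D (-1) W) U' f \<and>
        left_minimal D (shift D (-1) W) U' f \<and>
        dist_tri D (shift D (-1) W) U' X f g h \<and>
        direct_sum D P [U, X] \<and> is_flat D P B)"

end

theory Submission
  imports Defs
begin

text \<open>
  Let \<open>T[-1] \<rightarrow> U' \<rightarrow> X \<rightarrow> T\<close> be the triangle of a left minimal \<open>add(U)\<close>-approximation and let
  \<open>B = (U \<oplus> X)\<^sup>\<flat>\<close>, so that \<open>add(B) = add(U \<oplus> X)\<close>.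

  \<^bold>\<open>Silting.\<close> As \<open>T \<in> S \<ast> S[1]\<close> and \<open>S\<close> is presilting, \<open>Hom(U, T[i]) = 0\<close> for \<open>i > 0\<close> and
  \<open>Hom(T, U[i]) = 0\<close> for \<open>i > 1\<close>. The long exact sequences of the triangle give \<open>Hom(U, X[i]) = 0\<close> for
  \<open>i > 0\<close> and \<open>Hom(X, U[i]) = 0\<close> for \<open>i > 1\<close>; for \<open>i = 1\<close> the latter holds because every morphism
  \<open>T \<rightarrow> U[1]\<close> factors through \<open>T \<rightarrow> U'[1]\<close> by the approximation property (\<open>approximation_vanish\<close>).
  Together with \<open>Hom(T, T[i]) = 0\<close> this yields \<open>Hom(X, X[i]) = 0\<close>. So \<open>U \<oplus> X\<close> is presilting, and
  the thick subcategory that it generates contains the cone \<open>T\<close> of \<open>U' \<rightarrow> X\<close>, hence everything.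

  \<^bold>\<open>Two-term.\<close> \<open>X\<close> is an extension of \<open>T \<in> S \<ast> S[1]\<close> by \<open>U' \<in> add(S)\<close>. By the octahedral axiom, and
  because extensions within \<open>add(S)\<close> split, it lies in \<open>S \<ast> S[1]\<close> (\<open>star_extension\<close>). This class is closed
  under direct sums and summands (\<open>star_summands\<close>), so it contains \<open>B\<close>.

  \<^bold>\<open>Existence.\<close> Finite-dimensional morphism spaces provide an approximation; a minimal one is obtained by
  taking the fewest local summands (\<open>ex_minimal_left_approximation\<close>). A basic object with the same additive
  closure is obtained by discarding repeated local summands (\<open>ex_flat\<close>).

  Membership in \<open>add\<close> is handled throughout by one device: \<open>Y \<in> add(X)\<close> exactly if the identity of \<open>Y\<close> is
  a finite sum of morphisms \<open>Y \<rightarrow> X \<rightarrow> Y\<close> (\<open>add_of_eq_summands\<close>). This rests on the fact that a split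
  monomorphism in a triangulated category has a complement (\<open>tri_split\<close>).
\<close>

section \<open>Arrows of a linear category\<close>

context linear_category
begin

text \<open>Hom-sets need not be disjoint, so a morphism does not determine its source and target; this
  predicate carries them along, together with the membership of both objects.\<close>

definition arrow :: "'m \<Rightarrow> 'o \<Rightarrow> 'o \<Rightarrow> bool" ("\<guillemotleft>_ : _ \<rightarrow> _\<guillemotright>") where
  "\<guillemotleft>f : X \<rightarrow> Y\<guillemotright> \<longleftrightarrow> X \<in> Obj D \<and> Y \<in> Obj D \<and> f \<in> Mor D X Y"

lemma arrowI: "\<lbrakk>X \<in> Obj D; Y \<in> Obj D; f \<in> Mor D X Y\<rbrakk> \<Longrightarrow> \<guillemotleft>f : X \<rightarrow> Y\<guillemotright>"
  by (simp add: arrow_def)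

lemma arrowD: "\<guillemotleft>f : X \<rightarrow> Y\<guillemotright> \<Longrightarrow> X \<in> Obj D" "\<guillemotleft>f : X \<rightarrow> Y\<guillemotright> \<Longrightarrow> Y \<in> Obj D" "\<guillemotleft>f : X \<rightarrow> Y\<guillemotright> \<Longrightarrow> f \<in> Mor D X Y"
  by (simp_all add: arrow_def)

lemma Hom_group: "\<lbrakk>X \<in> Obj D; Y \<in> Obj D\<rbrakk> \<Longrightarrow> abelian_group (Hom D X Y)"
  by (rule module.axioms(2)[OF Hom_module])

lemma Hom_monoid: "\<lbrakk>X \<in> Obj D; Y \<in> Obj D\<rbrakk> \<Longrightarrow> abelian_monoid (Hom D X Y)"
  by (rule abelian_group.axioms(1)[OF Hom_group])

lemma arrow_ident [intro]: "X \<in> Obj D \<Longrightarrow> \<guillemotleft>ident D X : X \<rightarrow> X\<guillemotright>"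
  by (simp add: arrow_def ident_Mor)

lemma arrow_comp [intro]: "\<lbrakk>\<guillemotleft>f : X \<rightarrow> Y\<guillemotright>; \<guillemotleft>g : Y \<rightarrow> Z\<guillemotright>\<rbrakk> \<Longrightarrow> \<guillemotleft>g \<cdot> f : X \<rightarrow> Z\<guillemotright>"
  unfolding arrow_def using comp_Mor by blast

lemma arrow_zero [intro]: "\<lbrakk>X \<in> Obj D; Y \<in> Obj D\<rbrakk> \<Longrightarrow> \<guillemotleft>\<zero>\<^bsub>Hom D X Y\<^esub> : X \<rightarrow> Y\<guillemotright>"
  by (simp add: arrow_def abelian_monoid.zero_closed Hom_monoid)

lemma arrow_add [intro]: "\<lbrakk>\<guillemotleft>f : X \<rightarrow> Y\<guillemotright>; \<guillemotleft>g : X \<rightarrow> Y\<guillemotright>\<rbrakk> \<Longrightarrow> \<guillemotleft>f \<oplus>\<^bsub>Hom D X Y\<^esub> g : X \<rightarrow> Y\<guillemotright>"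
  by (simp add: arrow_def abelian_monoid.a_closed Hom_monoid)

lemma arrow_neg [intro]: "\<guillemotleft>f : X \<rightarrow> Y\<guillemotright> \<Longrightarrow> \<guillemotleft>\<ominus>\<^bsub>Hom D X Y\<^esub> f : X \<rightarrow> Y\<guillemotright>"
  by (simp add: arrow_def abelian_group.a_inv_closed Hom_group)

lemma arrow_minus [intro]: "\<lbrakk>\<guillemotleft>f : X \<rightarrow> Y\<guillemotright>; \<guillemotleft>g : X \<rightarrow> Y\<guillemotright>\<rbrakk> \<Longrightarrow> \<guillemotleft>f \<ominus>\<^bsub>Hom D X Y\<^esub> g : X \<rightarrow> Y\<guillemotright>"
  by (simp add: arrow_def abelian_group.minus_closed Hom_group)

lemma arrow_smult [intro]: "\<lbrakk>a \<in> carrier K; \<guillemotleft>f : X \<rightarrow> Y\<guillemotright>\<rbrakk> \<Longrightarrow> \<guillemotleft>a \<odot>\<^bsub>Hom D X Y\<^esub> f : X \<rightarrow> Y\<guillemotright>"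
  by (simp add: arrow_def module.smult_closed[OF Hom_module])

lemma assoc: "\<lbrakk>\<guillemotleft>f : W \<rightarrow> X\<guillemotright>; \<guillemotleft>g : X \<rightarrow> Y\<guillemotright>; \<guillemotleft>h : Y \<rightarrow> Z\<guillemotright>\<rbrakk> \<Longrightarrow> h \<cdot> (g \<cdot> f) = h \<cdot> g \<cdot> f"
  unfolding arrow_def using comp_assoc by blast

lemma comp_id: "\<guillemotleft>f : X \<rightarrow> Y\<guillemotright> \<Longrightarrow> f \<cdot> ident D X = f"
  unfolding arrow_def using comp_ident by blast

lemma id_comp: "\<guillemotleft>f : X \<rightarrow> Y\<guillemotright> \<Longrightarrow> ident D Y \<cdot> f = f"
  unfolding arrow_def using ident_comp by blast

lemma comp_add: "\<lbrakk>\<guillemotleft>f : X \<rightarrow> Y\<guillemotright>; \<guillemotleft>f' : X \<rightarrow> Y\<guillemotright>; \<guillemotleft>g : Y \<rightarrow> Z\<guillemotright>\<rbrakk>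
    \<Longrightarrow> g \<cdot> (f \<oplus>\<^bsub>Hom D X Y\<^esub> f') = g \<cdot> f \<oplus>\<^bsub>Hom D X Z\<^esub> g \<cdot> f'"
  unfolding arrow_def using comp_add_right by blast

lemma add_comp: "\<lbrakk>\<guillemotleft>f : X \<rightarrow> Y\<guillemotright>; \<guillemotleft>g : Y \<rightarrow> Z\<guillemotright>; \<guillemotleft>g' : Y \<rightarrow> Z\<guillemotright>\<rbrakk>
    \<Longrightarrow> (g \<oplus>\<^bsub>Hom D Y Z\<^esub> g') \<cdot> f = g \<cdot> f \<oplus>\<^bsub>Hom D X Z\<^esub> g' \<cdot> f"
  unfolding arrow_def using comp_add_left by blast

lemma smult_right: "\<lbrakk>\<guillemotleft>f : X \<rightarrow> Y\<guillemotright>; \<guillemotleft>g : Y \<rightarrow> Z\<guillemotright>; a \<in> carrier K\<rbrakk>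
    \<Longrightarrow> a \<odot>\<^bsub>Hom D X Z\<^esub> (g \<cdot> f) = g \<cdot> (a \<odot>\<^bsub>Hom D X Y\<^esub> f)"
  unfolding arrow_def using comp_smult_right[of X Y Z a f g] by simp

lemma smult_left: "\<lbrakk>\<guillemotleft>f : X \<rightarrow> Y\<guillemotright>; \<guillemotleft>g : Y \<rightarrow> Z\<guillemotright>; a \<in> carrier K\<rbrakk>
    \<Longrightarrow> a \<odot>\<^bsub>Hom D X Z\<^esub> (g \<cdot> f) = (a \<odot>\<^bsub>Hom D Y Z\<^esub> g) \<cdot> f"
  unfolding arrow_def using comp_smult_left[of X Y Z a f g] by simp

lemma add_zero: "\<guillemotleft>f : X \<rightarrow> Y\<guillemotright> \<Longrightarrow> f \<oplus>\<^bsub>Hom D X Y\<^esub> \<zero>\<^bsub>Hom D X Y\<^esub> = f"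
  "\<guillemotleft>f : X \<rightarrow> Y\<guillemotright> \<Longrightarrow> \<zero>\<^bsub>Hom D X Y\<^esub> \<oplus>\<^bsub>Hom D X Y\<^esub> f = f"
  by (simp_all add: arrow_def abelian_monoid.l_zero abelian_monoid.r_zero Hom_monoid)

lemma add_commute: "\<lbrakk>\<guillemotleft>f : X \<rightarrow> Y\<guillemotright>; \<guillemotleft>g : X \<rightarrow> Y\<guillemotright>\<rbrakk> \<Longrightarrow> f \<oplus>\<^bsub>Hom D X Y\<^esub> g = g \<oplus>\<^bsub>Hom D X Y\<^esub> f"
  by (simp add: arrow_def abelian_monoid.a_comm Hom_monoid)

lemma add_assoc: "\<lbrakk>\<guillemotleft>f : X \<rightarrow> Y\<guillemotright>; \<guillemotleft>g : X \<rightarrow> Y\<guillemotright>; \<guillemotleft>h : X \<rightarrow> Y\<guillemotright>\<rbrakk>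
    \<Longrightarrow> f \<oplus>\<^bsub>Hom D X Y\<^esub> g \<oplus>\<^bsub>Hom D X Y\<^esub> h = f \<oplus>\<^bsub>Hom D X Y\<^esub> (g \<oplus>\<^bsub>Hom D X Y\<^esub> h)"
  by (simp add: arrow_def abelian_monoid.a_assoc Hom_monoid)

lemma add_idem_zero: "\<lbrakk>\<guillemotleft>f : X \<rightarrow> Y\<guillemotright>; f \<oplus>\<^bsub>Hom D X Y\<^esub> f = f\<rbrakk> \<Longrightarrow> f = \<zero>\<^bsub>Hom D X Y\<^esub>"
proof -
  assume f: "\<guillemotleft>f : X \<rightarrow> Y\<guillemotright>" and ff: "f \<oplus>\<^bsub>Hom D X Y\<^esub> f = f"
  interpret H: abelian_group "Hom D X Y" by (rule Hom_group[OF arrowD(1,2)[OF f]])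
  show ?thesis using ff arrowD(3)[OF f] H.add.l_cancel_one by simp
qed

lemma comp_zero: "\<lbrakk>\<guillemotleft>g : Y \<rightarrow> Z\<guillemotright>; X \<in> Obj D\<rbrakk> \<Longrightarrow> g \<cdot> \<zero>\<^bsub>Hom D X Y\<^esub> = \<zero>\<^bsub>Hom D X Z\<^esub>"
proof -
  assume g: "\<guillemotleft>g : Y \<rightarrow> Z\<guillemotright>" and X: "X \<in> Obj D"
  have z: "\<guillemotleft>\<zero>\<^bsub>Hom D X Y\<^esub> : X \<rightarrow> Y\<guillemotright>" by (intro arrow_zero X arrowD(1)[OF g])
  show ?thesis
    by (rule add_idem_zero[OF arrow_comp[OF z g]])
       (simp add: comp_add[OF z z g, symmetric] add_zero(1)[OF z])
qed

lemma zero_comp: "\<lbrakk>\<guillemotleft>f : X \<rightarrow> Y\<guillemotright>; Z \<in> Obj D\<rbrakk> \<Longrightarrow> \<zero>\<^bsub>Hom D Y Z\<^esub> \<cdot> f = \<zero>\<^bsub>Hom D X Z\<^esub>"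
proof -
  assume f: "\<guillemotleft>f : X \<rightarrow> Y\<guillemotright>" and Z: "Z \<in> Obj D"
  have z: "\<guillemotleft>\<zero>\<^bsub>Hom D Y Z\<^esub> : Y \<rightarrow> Z\<guillemotright>" by (intro arrow_zero Z arrowD(2)[OF f])
  show ?thesis
    by (rule add_idem_zero[OF arrow_comp[OF f z]])
       (simp add: add_comp[OF f z z, symmetric] add_zero(1)[OF z])
qed

lemma add_neg: "\<guillemotleft>f : X \<rightarrow> Y\<guillemotright> \<Longrightarrow> f \<oplus>\<^bsub>Hom D X Y\<^esub> (\<ominus>\<^bsub>Hom D X Y\<^esub> f) = \<zero>\<^bsub>Hom D X Y\<^esub>"
  by (simp add: arrow_def abelian_group.r_neg Hom_group)

lemma neg_neg: "\<guillemotleft>f : X \<rightarrow> Y\<guillemotright> \<Longrightarrow> \<ominus>\<^bsub>Hom D X Y\<^esub> (\<ominus>\<^bsub>Hom D X Y\<^esub> f) = f"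
  by (simp add: arrow_def abelian_group.minus_minus Hom_group)

lemma neg_zero: "\<lbrakk>X \<in> Obj D; Y \<in> Obj D\<rbrakk> \<Longrightarrow> \<ominus>\<^bsub>Hom D X Y\<^esub> \<zero>\<^bsub>Hom D X Y\<^esub> = \<zero>\<^bsub>Hom D X Y\<^esub>"
proof -
  assume "X \<in> Obj D" "Y \<in> Obj D"
  then interpret H: abelian_group "Hom D X Y" by (rule Hom_group)
  show ?thesis by simp
qed

lemma neg_unique: "\<lbrakk>\<guillemotleft>f : X \<rightarrow> Y\<guillemotright>; \<guillemotleft>g : X \<rightarrow> Y\<guillemotright>; f \<oplus>\<^bsub>Hom D X Y\<^esub> g = \<zero>\<^bsub>Hom D X Y\<^esub>\<rbrakk>
    \<Longrightarrow> g = \<ominus>\<^bsub>Hom D X Y\<^esub> f"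
  using abelian_group.minus_equality[OF Hom_group, of X Y g f] add_commute[of f X Y g]
  by (simp add: arrow_def)

lemma comp_neg: "\<lbrakk>\<guillemotleft>f : X \<rightarrow> Y\<guillemotright>; \<guillemotleft>g : Y \<rightarrow> Z\<guillemotright>\<rbrakk> \<Longrightarrow> g \<cdot> (\<ominus>\<^bsub>Hom D X Y\<^esub> f) = \<ominus>\<^bsub>Hom D X Z\<^esub> (g \<cdot> f)"
  by (rule neg_unique)
     (auto simp: comp_add[symmetric] arrow_neg add_neg comp_zero dest: arrowD)

lemma neg_comp: "\<lbrakk>\<guillemotleft>f : X \<rightarrow> Y\<guillemotright>; \<guillemotleft>g : Y \<rightarrow> Z\<guillemotright>\<rbrakk> \<Longrightarrow> (\<ominus>\<^bsub>Hom D Y Z\<^esub> g) \<cdot> f = \<ominus>\<^bsub>Hom D X Z\<^esub> (g \<cdot> f)"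
  by (rule neg_unique)
     (auto simp: add_comp[symmetric] arrow_neg add_neg zero_comp dest: arrowD)

lemma comp_minus: "\<lbrakk>\<guillemotleft>f : X \<rightarrow> Y\<guillemotright>; \<guillemotleft>f' : X \<rightarrow> Y\<guillemotright>; \<guillemotleft>g : Y \<rightarrow> Z\<guillemotright>\<rbrakk>
    \<Longrightarrow> g \<cdot> (f \<ominus>\<^bsub>Hom D X Y\<^esub> f') = g \<cdot> f \<ominus>\<^bsub>Hom D X Z\<^esub> g \<cdot> f'"
  by (simp add: a_minus_def comp_add[OF _ arrow_neg] comp_neg)

lemma minus_comp: "\<lbrakk>\<guillemotleft>f : X \<rightarrow> Y\<guillemotright>; \<guillemotleft>g : Y \<rightarrow> Z\<guillemotright>; \<guillemotleft>g' : Y \<rightarrow> Z\<guillemotright>\<rbrakk>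
    \<Longrightarrow> (g \<ominus>\<^bsub>Hom D Y Z\<^esub> g') \<cdot> f = g \<cdot> f \<ominus>\<^bsub>Hom D X Z\<^esub> g' \<cdot> f"
  by (simp add: a_minus_def add_comp[OF _ _ arrow_neg] neg_comp)

lemma minus_self: "\<guillemotleft>f : X \<rightarrow> Y\<guillemotright> \<Longrightarrow> f \<ominus>\<^bsub>Hom D X Y\<^esub> f = \<zero>\<^bsub>Hom D X Y\<^esub>"
  by (simp add: a_minus_def add_neg)

lemma minus_zero: "\<guillemotleft>f : X \<rightarrow> Y\<guillemotright> \<Longrightarrow> f \<ominus>\<^bsub>Hom D X Y\<^esub> \<zero>\<^bsub>Hom D X Y\<^esub> = f"
  by (simp add: a_minus_def neg_zero add_zero arrowD)

lemma add_minus: "\<lbrakk>\<guillemotleft>f : X \<rightarrow> Y\<guillemotright>; \<guillemotleft>g : X \<rightarrow> Y\<guillemotright>\<rbrakk> \<Longrightarrow> f \<oplus>\<^bsub>Hom D X Y\<^esub> (g \<ominus>\<^bsub>Hom D X Y\<^esub> f) = g"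
proof -
  assume f: "\<guillemotleft>f : X \<rightarrow> Y\<guillemotright>" and g: "\<guillemotleft>g : X \<rightarrow> Y\<guillemotright>"
  interpret H: abelian_group "Hom D X Y" by (rule Hom_group[OF arrowD(1,2)[OF f]])
  show ?thesis using arrowD(3)[OF f] arrowD(3)[OF g]
    by (metis H.a_comm H.a_lcomm H.r_neg H.r_zero a_minus_def H.a_inv_closed)
qed

lemma eq_if_minus_zero: "\<lbrakk>\<guillemotleft>f : X \<rightarrow> Y\<guillemotright>; \<guillemotleft>g : X \<rightarrow> Y\<guillemotright>; g \<ominus>\<^bsub>Hom D X Y\<^esub> f = \<zero>\<^bsub>Hom D X Y\<^esub>\<rbrakk> \<Longrightarrow> g = f"
  using add_minus[of f X Y g] add_zero(1)[of f X Y] by simp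

lemma finsum_induct:
  assumes XY: "X \<in> Obj D" "Y \<in> Obj D" and "finite J"
    and "P \<zero>\<^bsub>Hom D X Y\<^esub>"
    and "\<And>f g. \<lbrakk>\<guillemotleft>f : X \<rightarrow> Y\<guillemotright>; \<guillemotleft>g : X \<rightarrow> Y\<guillemotright>; P f; P g\<rbrakk> \<Longrightarrow> P (f \<oplus>\<^bsub>Hom D X Y\<^esub> g)"
    and "\<And>j. j \<in> J \<Longrightarrow> \<guillemotleft>F j : X \<rightarrow> Y\<guillemotright>" and "\<And>j. j \<in> J \<Longrightarrow> P (F j)"
  shows "P (\<Oplus>\<^bsub>Hom D X Y\<^esub> j \<in> J. F j)"
proof -
  interpret H: abelian_group "Hom D X Y" by (rule Hom_group[OF XY])
  have "P (\<Oplus>\<^bsub>Hom D X Y\<^esub> j \<in> J. F j)" using assms(3,6,7)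
  proof (induction J rule: finite_induct)
    case empty
    then show ?case using assms(4) by simp
  next
    case (insert j J)
    have F: "F \<in> J \<rightarrow> Mor D X Y" "F j \<in> Mor D X Y" using insert.prems(1) arrowD(3) by auto
    show ?case
      using insert F by (simp add: assms(5) XY arrowI H.finsum_closed)
  qed
  then show ?thesis .
qed

lemma arrow_finsum [intro]:
  assumes "X \<in> Obj D" "Y \<in> Obj D" "\<And>j. j \<in> J \<Longrightarrow> \<guillemotleft>F j : X \<rightarrow> Y\<guillemotright>"
  shows "\<guillemotleft>\<Oplus>\<^bsub>Hom D X Y\<^esub> j \<in> J. F j : X \<rightarrow> Y\<guillemotright>"
  using abelian_monoid.finsum_closed[OF Hom_monoid[OF assms(1,2)], of F J] assms
  by (auto simp: arrow_def)

lemma comp_finsum: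
  assumes "finite J" "X \<in> Obj D" "\<And>j. j \<in> J \<Longrightarrow> \<guillemotleft>F j : X \<rightarrow> Y\<guillemotright>" "\<guillemotleft>g : Y \<rightarrow> Z\<guillemotright>"
  shows "g \<cdot> (\<Oplus>\<^bsub>Hom D X Y\<^esub> j \<in> J. F j) = (\<Oplus>\<^bsub>Hom D X Z\<^esub> j \<in> J. g \<cdot> F j)"
proof -
  note O = assms(2) arrowD(1,2)[OF assms(4)]
  interpret H: abelian_group "Hom D X Y" by (rule Hom_group[OF O(1,2)])
  interpret H': abelian_group "Hom D X Z" by (rule Hom_group[OF O(1,3)])
  show ?thesis using assms(1,3)
  proof (induction J rule: finite_induct)
    case empty
    then show ?case using comp_zero[OF assms(4) O(1)] by simp
  next
    case (insert j J)
    have F: "\<guillemotleft>F j : X \<rightarrow> Y\<guillemotright>" "F \<in> J \<rightarrow> Mor D X Y" "F j \<in> Mor D X Y"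
      using insert.prems(1) arrowD(3) by auto
    have G: "(\<lambda>j. g \<cdot> F j) \<in> J \<rightarrow> Mor D X Z" "g \<cdot> F j \<in> Mor D X Z"
      using insert.prems(1) arrow_comp[OF _ assms(4)] arrowD(3) by auto
    have S: "\<guillemotleft>\<Oplus>\<^bsub>Hom D X Y\<^esub> j \<in> J. F j : X \<rightarrow> Y\<guillemotright>"
      using insert.prems O by (intro arrow_finsum) auto
    show ?case using insert F(2,3) G comp_add[OF F(1) S assms(4)] by simp
  qed
qed

lemma finsum_comp:
  assumes "finite J" "Z \<in> Obj D" "\<And>j. j \<in> J \<Longrightarrow> \<guillemotleft>F j : Y \<rightarrow> Z\<guillemotright>" "\<guillemotleft>f : X \<rightarrow> Y\<guillemotright>"
  shows "(\<Oplus>\<^bsub>Hom D Y Z\<^esub> j \<in> J. F j) \<cdot> f = (\<Oplus>\<^bsub>Hom D X Z\<^esub> j \<in> J. F j \<cdot> f)"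
proof -
  note O = assms(2) arrowD(1,2)[OF assms(4)]
  interpret H: abelian_group "Hom D Y Z" by (rule Hom_group[OF O(3,1)])
  interpret H': abelian_group "Hom D X Z" by (rule Hom_group[OF O(2,1)])
  show ?thesis using assms(1,3)
  proof (induction J rule: finite_induct)
    case empty
    then show ?case using zero_comp[OF assms(4) O(1)] by simp
  next
    case (insert j J)
    have F: "\<guillemotleft>F j : Y \<rightarrow> Z\<guillemotright>" "F \<in> J \<rightarrow> Mor D Y Z" "F j \<in> Mor D Y Z"
      using insert.prems(1) arrowD(3) by auto
    have G: "(\<lambda>j. F j \<cdot> f) \<in> J \<rightarrow> Mor D X Z" "F j \<cdot> f \<in> Mor D X Z"
      using insert.prems(1) arrow_comp[OF assms(4)] arrowD(3) by auto
    have S: "\<guillemotleft>\<Oplus>\<^bsub>Hom D Y Z\<^esub> j \<in> J. F j : Y \<rightarrow> Z\<guillemotright>"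
      using insert.prems O by (intro arrow_finsum) auto
    show ?case using insert F(2,3) G add_comp[OF assms(4) F(1) S] by simp
  qed
qed

end

section \<open>Direct sums and the ideals of objects\<close>

context linear_category
begin

lemma comp4: "\<lbrakk>\<guillemotleft>f : V \<rightarrow> W\<guillemotright>; \<guillemotleft>g : W \<rightarrow> X\<guillemotright>; \<guillemotleft>h : X \<rightarrow> Y\<guillemotright>; \<guillemotleft>k : Y \<rightarrow> Z\<guillemotright>\<rbrakk>
    \<Longrightarrow> k \<cdot> h \<cdot> (g \<cdot> f) = k \<cdot> (h \<cdot> g) \<cdot> f"
  by (simp add: assoc[of f V W g X "k \<cdot> h" Z] assoc[of g W X h Y k Z] arrow_comp)

lemma zero_obj_iff: "zero_obj D Z \<longleftrightarrow> Z \<in> Obj D \<and> ident D Z = \<zero>\<^bsub>Hom D Z Z\<^esub>"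
proof
  assume Z: "zero_obj D Z"
  then show "Z \<in> Obj D \<and> ident D Z = \<zero>\<^bsub>Hom D Z Z\<^esub>"
    using ident_Mor[of Z] unfolding zero_obj_def by blast
next
  assume Z: "Z \<in> Obj D \<and> ident D Z = \<zero>\<^bsub>Hom D Z Z\<^esub>"
  then have O: "Z \<in> Obj D" and e: "ident D Z = \<zero>\<^bsub>Hom D Z Z\<^esub>" by blast+
  have l: "f = \<zero>\<^bsub>Hom D X Z\<^esub>" if f: "\<guillemotleft>f : X \<rightarrow> Z\<guillemotright>" for f X
    using id_comp[OF f] zero_comp[OF f O] unfolding e by (rule trans[OF sym])
  have r: "f = \<zero>\<^bsub>Hom D Z X\<^esub>" if f: "\<guillemotleft>f : Z \<rightarrow> X\<guillemotright>" for f X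
    using comp_id[OF f] comp_zero[OF f O] unfolding e by (rule trans[OF sym])
  show "zero_obj D Z"
    unfolding zero_obj_def
  proof (intro conjI ballI O)
    fix X assume X: "X \<in> Obj D"
    show "Mor D Z X = {\<zero>\<^bsub>Hom D Z X\<^esub>}" "Mor D X Z = {\<zero>\<^bsub>Hom D X Z\<^esub>}"
      using r[OF arrowI[OF O X]] l[OF arrowI[OF X O]]
        arrowD(3)[OF arrow_zero[OF O X]] arrowD(3)[OF arrow_zero[OF X O]] by blast+
  qed
qed

lemma zero_obj_arrow:
  "\<lbrakk>zero_obj D Z; \<guillemotleft>f : X \<rightarrow> Z\<guillemotright>\<rbrakk> \<Longrightarrow> f = \<zero>\<^bsub>Hom D X Z\<^esub>"
  "\<lbrakk>zero_obj D Z; \<guillemotleft>f : Z \<rightarrow> X\<guillemotright>\<rbrakk> \<Longrightarrow> f = \<zero>\<^bsub>Hom D Z X\<^esub>"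
  unfolding zero_obj_def arrow_def by auto

lemma biproductD:
  assumes "biproduct D X Ys \<iota> \<pi>"
  shows "X \<in> Obj D" "set Ys \<subseteq> Obj D"
    and "i < length Ys \<Longrightarrow> \<guillemotleft>\<iota> i : Ys ! i \<rightarrow> X\<guillemotright>"
    and "i < length Ys \<Longrightarrow> \<guillemotleft>\<pi> i : X \<rightarrow> Ys ! i\<guillemotright>"
    and "i < length Ys \<Longrightarrow> \<pi> i \<cdot> \<iota> i = ident D (Ys ! i)"
    and "\<lbrakk>i < length Ys; j < length Ys; i \<noteq> j\<rbrakk> \<Longrightarrow> \<pi> j \<cdot> \<iota> i = \<zero>\<^bsub>Hom D (Ys ! i) (Ys ! j)\<^esub>"
    and "(\<Oplus>\<^bsub>Hom D X X\<^esub> i \<in> {..<length Ys}. \<iota> i \<cdot> \<pi> i) = ident D X"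
  using assms unfolding biproduct_def arrow_def by (auto dest: nth_mem)

lemma biproduct2D:
  assumes "biproduct D X [A, B] \<iota> \<pi>"
  shows "X \<in> Obj D" "A \<in> Obj D" "B \<in> Obj D"
    and "\<guillemotleft>\<iota> 0 : A \<rightarrow> X\<guillemotright>" "\<guillemotleft>\<iota> 1 : B \<rightarrow> X\<guillemotright>" "\<guillemotleft>\<pi> 0 : X \<rightarrow> A\<guillemotright>" "\<guillemotleft>\<pi> 1 : X \<rightarrow> B\<guillemotright>"
    and "\<pi> 0 \<cdot> \<iota> 0 = ident D A" "\<pi> 1 \<cdot> \<iota> 1 = ident D B"
    and "\<pi> 1 \<cdot> \<iota> 0 = \<zero>\<^bsub>Hom D A B\<^esub>" "\<pi> 0 \<cdot> \<iota> 1 = \<zero>\<^bsub>Hom D B A\<^esub>"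
    and "\<iota> 0 \<cdot> \<pi> 0 \<oplus>\<^bsub>Hom D X X\<^esub> \<iota> 1 \<cdot> \<pi> 1 = ident D X"
proof -
  note bp = biproductD[OF assms]
  show X: "X \<in> Obj D" and "A \<in> Obj D" "B \<in> Obj D" using bp(1,2) by auto
  show i: "\<guillemotleft>\<iota> 0 : A \<rightarrow> X\<guillemotright>" "\<guillemotleft>\<iota> 1 : B \<rightarrow> X\<guillemotright>" using bp(3)[of 0] bp(3)[of 1] by auto
  show p: "\<guillemotleft>\<pi> 0 : X \<rightarrow> A\<guillemotright>" "\<guillemotleft>\<pi> 1 : X \<rightarrow> B\<guillemotright>" using bp(4)[of 0] bp(4)[of 1] by auto
  show "\<pi> 0 \<cdot> \<iota> 0 = ident D A" "\<pi> 1 \<cdot> \<iota> 1 = ident D B" using bp(5)[of 0] bp(5)[of 1] by auto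
  show "\<pi> 1 \<cdot> \<iota> 0 = \<zero>\<^bsub>Hom D A B\<^esub>" "\<pi> 0 \<cdot> \<iota> 1 = \<zero>\<^bsub>Hom D B A\<^esub>"
    using bp(6)[of 0 1] bp(6)[of 1 0] by auto
  interpret H: abelian_group "Hom D X X" by (rule Hom_group[OF X X])
  have e: "\<guillemotleft>\<iota> 0 \<cdot> \<pi> 0 : X \<rightarrow> X\<guillemotright>" "\<guillemotleft>\<iota> 1 \<cdot> \<pi> 1 : X \<rightarrow> X\<guillemotright>" using i p by auto
  have "{..<length [A, B]} = insert 0 {1}" by auto
  then show "\<iota> 0 \<cdot> \<pi> 0 \<oplus>\<^bsub>Hom D X X\<^esub> \<iota> 1 \<cdot> \<pi> 1 = ident D X"
    using bp(7) arrowD(3)[OF e(1)] arrowD(3)[OF e(2)] by (simp add: H.finsum_insert)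
qed

lemma biproduct2I:
  assumes "\<guillemotleft>i : A \<rightarrow> X\<guillemotright>" "\<guillemotleft>i' : B \<rightarrow> X\<guillemotright>" "\<guillemotleft>p : X \<rightarrow> A\<guillemotright>" "\<guillemotleft>p' : X \<rightarrow> B\<guillemotright>"
    and "p \<cdot> i = ident D A" "p' \<cdot> i' = ident D B"
    and "p' \<cdot> i = \<zero>\<^bsub>Hom D A B\<^esub>" "p \<cdot> i' = \<zero>\<^bsub>Hom D B A\<^esub>"
    and "i \<cdot> p \<oplus>\<^bsub>Hom D X X\<^esub> i' \<cdot> p' = ident D X"
  shows "biproduct D X [A, B] (\<lambda>n. if n = 0 then i else i') (\<lambda>n. if n = 0 then p else p')"
proof -
  have O: "X \<in> Obj D" "A \<in> Obj D" "B \<in> Obj D" using assms(1,2) by (auto dest: arrowD)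
  interpret H: abelian_group "Hom D X X" by (rule Hom_group[OF O(1,1)])
  have e: "\<guillemotleft>i \<cdot> p : X \<rightarrow> X\<guillemotright>" "\<guillemotleft>i' \<cdot> p' : X \<rightarrow> X\<guillemotright>" using assms(1-4) by auto
  have 2: "{..<length [A, B]} = insert 0 {1}" by auto
  show ?thesis
    unfolding biproduct_def 2
    using assms O arrowD(3)[OF e(1)] arrowD(3)[OF e(2)]
    by (auto simp: H.finsum_insert less_Suc_eq dest: arrowD)
qed

lemma direct_sum2E:
  assumes "direct_sum D X [A, B]"
  obtains i i' p p' where "\<guillemotleft>i : A \<rightarrow> X\<guillemotright>" "\<guillemotleft>i' : B \<rightarrow> X\<guillemotright>" "\<guillemotleft>p : X \<rightarrow> A\<guillemotright>" "\<guillemotleft>p' : X \<rightarrow> B\<guillemotright>"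
    "p \<cdot> i = ident D A" "p' \<cdot> i' = ident D B"
    "p' \<cdot> i = \<zero>\<^bsub>Hom D A B\<^esub>" "p \<cdot> i' = \<zero>\<^bsub>Hom D B A\<^esub>"
    "i \<cdot> p \<oplus>\<^bsub>Hom D X X\<^esub> i' \<cdot> p' = ident D X"
proof -
  obtain \<iota> \<pi> where "biproduct D X [A, B] \<iota> \<pi>" using assms unfolding direct_sum_def by blast
  from biproduct2D[OF this] show thesis by (intro that)
qed

lemma direct_sum_Nil: "zero_obj D Z \<Longrightarrow> direct_sum D Z []"
proof -
  assume Z: "zero_obj D Z"
  then have O: "Z \<in> Obj D" and e: "ident D Z = \<zero>\<^bsub>Hom D Z Z\<^esub>" by (simp_all add: zero_obj_iff)
  interpret H: abelian_group "Hom D Z Z" by (rule Hom_group[OF O O])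
  show ?thesis unfolding direct_sum_def biproduct_def using O e by auto
qed

lemma direct_sum_snoc:
  assumes Z: "direct_sum D Z Ys" and W: "direct_sum D W [Z, Y]"
  shows "direct_sum D W (Ys @ [Y])"
proof -
  obtain \<iota> \<pi> where z: "biproduct D Z Ys \<iota> \<pi>" using Z unfolding direct_sum_def by blast
  obtain \<iota>' \<pi>' where w: "biproduct D W [Z, Y] \<iota>' \<pi>'" using W unfolding direct_sum_def by blast
  note bz = biproductD[OF z] and bw = biproduct2D[OF w]
  let ?n = "length Ys" and ?Zs = "Ys @ [Y]"
  define j where "j i = (if i < ?n then \<iota>' 0 \<cdot> \<iota> i else \<iota>' 1)" for i
  define p where "p i = (if i < ?n then \<pi> i \<cdot> \<pi>' 0 else \<pi>' 1)" for i
  have nth: "?Zs ! i = (if i < ?n then Ys ! i else Y)" if "i < length ?Zs" for i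
    using that by (auto simp: nth_append)
  have jp: "\<guillemotleft>j i : ?Zs ! i \<rightarrow> W\<guillemotright>" "\<guillemotleft>p i : W \<rightarrow> ?Zs ! i\<guillemotright>" if "i < length ?Zs" for i
    using nth[OF that] bw(4-7) bz(3,4)[of i] by (auto simp: j_def p_def)
  have e: "\<guillemotleft>j i \<cdot> p i : W \<rightarrow> W\<guillemotright>" if "i \<le> ?n" for i
    by (rule arrow_comp) (use jp[of i] that in auto)
  have in_old: "p k \<cdot> j i = \<pi> k \<cdot> \<iota> i" if ik: "i < ?n" "k < ?n" for i k
  proof -
    have "p k \<cdot> j i = \<pi> k \<cdot> (\<pi>' 0 \<cdot> \<iota>' 0) \<cdot> \<iota> i"
      using comp4[OF bz(3)[OF ik(1)] bw(4,6) bz(4)[OF ik(2)]] ik by (simp add: p_def j_def)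
    then show ?thesis using bw(8) comp_id[OF bz(4)[OF ik(2)]] by simp
  qed
  have mixed: "\<pi>' 1 \<cdot> (\<iota>' 0 \<cdot> \<iota> i) = \<zero>\<^bsub>Hom D (Ys ! i) Y\<^esub>" "(\<pi> i \<cdot> \<pi>' 0) \<cdot> \<iota>' 1 = \<zero>\<^bsub>Hom D Y (Ys ! i)\<^esub>"
    if i: "i < ?n" for i
  proof -
    show "\<pi>' 1 \<cdot> (\<iota>' 0 \<cdot> \<iota> i) = \<zero>\<^bsub>Hom D (Ys ! i) Y\<^esub>"
      using assoc[OF bz(3)[OF i] bw(4,7)] bw(10) zero_comp[OF bz(3)[OF i] bw(3)] by simp
    show "(\<pi> i \<cdot> \<pi>' 0) \<cdot> \<iota>' 1 = \<zero>\<^bsub>Hom D Y (Ys ! i)\<^esub>"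
      using assoc[OF bw(5,6) bz(4)[OF i]] bw(11) comp_zero[OF bz(4)[OF i] bw(3)] by simp
  qed
  have orth: "p k \<cdot> j i = (if i = k then ident D (?Zs ! i) else \<zero>\<^bsub>Hom D (?Zs ! i) (?Zs ! k)\<^esub>)"
    if ik: "i < length ?Zs" "k < length ?Zs" for i k
  proof (cases "i < ?n"; cases "k < ?n")
    assume "i < ?n" "k < ?n"
    then show ?thesis using in_old[of i k] bz(5)[of i] bz(6)[of i k] nth ik by auto
  next
    assume "i < ?n" "\<not> k < ?n"
    then show ?thesis using mixed(1)[of i] nth ik by (auto simp: p_def j_def)
  next
    assume "\<not> i < ?n" "k < ?n"
    then show ?thesis using mixed(2)[of k] nth ik by (auto simp: p_def j_def)
  next
    assume "\<not> i < ?n" "\<not> k < ?n"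
    then show ?thesis using bw(9) nth ik by (auto simp: p_def j_def)
  qed
  interpret H: abelian_group "Hom D W W" by (rule Hom_group[OF bw(1,1)])
  have sum0: "(\<Oplus>\<^bsub>Hom D W W\<^esub> i \<in> {..<?n}. j i \<cdot> p i) = \<iota>' 0 \<cdot> \<pi>' 0"
  proof -
    have zz: "\<guillemotleft>\<iota> i \<cdot> \<pi> i : Z \<rightarrow> Z\<guillemotright>" if "i \<in> {..<?n}" for i using that bz(3,4) by blast
    then have zw: "\<guillemotleft>\<iota> i \<cdot> \<pi> i \<cdot> \<pi>' 0 : W \<rightarrow> Z\<guillemotright>" if "i \<in> {..<?n}" for i
      using that bw(6) by blast
    have "\<iota>' 0 \<cdot> \<pi>' 0 = \<iota>' 0 \<cdot> (ident D Z \<cdot> \<pi>' 0)" using id_comp[OF bw(6)] by simp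
    also have "\<dots> = (\<Oplus>\<^bsub>Hom D W W\<^esub> i \<in> {..<?n}. \<iota>' 0 \<cdot> (\<iota> i \<cdot> \<pi> i \<cdot> \<pi>' 0))"
      by (simp only: bz(7)[symmetric] finsum_comp[OF finite_lessThan bz(1) zz bw(6)]
          comp_finsum[OF finite_lessThan bw(1) zw bw(4)])
    also have "\<dots> = (\<Oplus>\<^bsub>Hom D W W\<^esub> i \<in> {..<?n}. j i \<cdot> p i)"
    proof (rule H.finsum_cong'[OF refl])
      show "(\<lambda>i. j i \<cdot> p i) \<in> {..<?n} \<rightarrow> Mor D W W" using e[THEN arrowD(3)] by auto
      show "\<iota>' 0 \<cdot> (\<iota> i \<cdot> \<pi> i \<cdot> \<pi>' 0) = j i \<cdot> p i" if "i \<in> {..<?n}" for i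
      proof -
        have i: "i < ?n" using that by simp
        note ai = bz(3)[OF i] bz(4)[OF i]
        have "\<iota>' 0 \<cdot> (\<iota> i \<cdot> \<pi> i \<cdot> \<pi>' 0) = \<iota>' 0 \<cdot> (\<iota> i \<cdot> (\<pi> i \<cdot> \<pi>' 0))"
          using assoc[OF bw(6) ai(2,1)] by simp
        also have "\<dots> = \<iota>' 0 \<cdot> \<iota> i \<cdot> (\<pi> i \<cdot> \<pi>' 0)"
          by (rule assoc[OF arrow_comp[OF bw(6) ai(2)] ai(1) bw(4)])
        finally show ?thesis using i by (simp add: j_def p_def)
      qed
    qed
    finally show ?thesis by simp
  qed
  have "(\<Oplus>\<^bsub>Hom D W W\<^esub> i \<in> {..<length ?Zs}. j i \<cdot> p i) = ident D W"
  proof -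
    have m: "(\<lambda>i. j i \<cdot> p i) \<in> {..<?n} \<rightarrow> Mor D W W" "j ?n \<cdot> p ?n \<in> Mor D W W"
      using e[THEN arrowD(3)] by auto
    have s: "\<guillemotleft>\<iota>' 0 \<cdot> \<pi>' 0 : W \<rightarrow> W\<guillemotright>" "\<guillemotleft>\<iota>' 1 \<cdot> \<pi>' 1 : W \<rightarrow> W\<guillemotright>" using bw(4-7) by blast+
    have "{..<length ?Zs} = insert ?n {..<?n}" by auto
    then have "(\<Oplus>\<^bsub>Hom D W W\<^esub> i \<in> {..<length ?Zs}. j i \<cdot> p i)
        = \<iota>' 1 \<cdot> \<pi>' 1 \<oplus>\<^bsub>Hom D W W\<^esub> \<iota>' 0 \<cdot> \<pi>' 0"
      using m sum0 by (simp add: H.finsum_insert) (simp add: j_def p_def)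
    then show ?thesis using bw(12) add_commute[OF s] by simp
  qed
  then have "biproduct D W ?Zs j p"
    unfolding biproduct_def using orth jp[THEN arrowD(3)] bw(1,3) bz(2) by auto
  then show ?thesis unfolding direct_sum_def by blast
qed

text \<open>The ideal of morphisms generated by a class of objects. With it, statements on direct summands of
  finite direct sums become statements on sums of morphisms, which are proved by induction on the
  number of terms and need no choice of a direct sum.\<close>

inductive_set through :: "'o set \<Rightarrow> 'o \<Rightarrow> 'o \<Rightarrow> 'm set" for \<X> A B where
  zero: "\<zero>\<^bsub>Hom D A B\<^esub> \<in> through \<X> A B"
| step: "\<lbrakk>\<phi> \<in> through \<X> A B; X \<in> \<X>; \<guillemotleft>a : A \<rightarrow> X\<guillemotright>; \<guillemotleft>b : X \<rightarrow> B\<guillemotright>\<rbrakk>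
    \<Longrightarrow> \<phi> \<oplus>\<^bsub>Hom D A B\<^esub> b \<cdot> a \<in> through \<X> A B"

lemma through_arrow: "\<lbrakk>\<phi> \<in> through \<X> A B; A \<in> Obj D; B \<in> Obj D\<rbrakk> \<Longrightarrow> \<guillemotleft>\<phi> : A \<rightarrow> B\<guillemotright>"
  by (induction rule: through.induct) auto

lemma through_single: "\<lbrakk>X \<in> \<X>; \<guillemotleft>a : A \<rightarrow> X\<guillemotright>; \<guillemotleft>b : X \<rightarrow> B\<guillemotright>\<rbrakk> \<Longrightarrow> b \<cdot> a \<in> through \<X> A B"
  using through.step[OF through.zero] add_zero(2)[OF arrow_comp] by metis

lemma through_add:
  assumes \<phi>: "\<phi> \<in> through \<X> A B" and "\<psi> \<in> through \<X> A B" and O: "A \<in> Obj D" "B \<in> Obj D"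
  shows "\<phi> \<oplus>\<^bsub>Hom D A B\<^esub> \<psi> \<in> through \<X> A B"
  using assms(2)
proof (induction rule: through.induct)
  case zero
  then show ?case using add_zero(1)[OF through_arrow[OF \<phi> O]] \<phi> by simp
next
  case (step \<psi> X a b)
  then show ?case
    using through.step[OF step.IH step.hyps(2-4)] add_assoc[OF through_arrow[OF \<phi> O]
        through_arrow[OF step.hyps(1) O] arrow_comp[OF step.hyps(3,4)]] by simp
qed

lemma through_comp:
  assumes \<phi>: "\<phi> \<in> through \<X> A B" and A: "A \<in> Obj D" and g: "\<guillemotleft>g : B \<rightarrow> C\<guillemotright>"
  shows "g \<cdot> \<phi> \<in> through \<X> A C"
  using \<phi>
proof (induction rule: through.induct)
  case zero
  then show ?case using comp_zero[OF g A] through.zero by simp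
next
  case (step \<phi> X a b)
  then show ?case
    using through.step[OF step.IH step.hyps(2,3) arrow_comp[OF step.hyps(4) g]]
      comp_add[OF through_arrow[OF step.hyps(1) A arrowD(1)[OF g]] arrow_comp[OF step.hyps(3,4)] g]
      assoc[OF step.hyps(3,4) g] by simp
qed

lemma comp_through:
  assumes \<phi>: "\<phi> \<in> through \<X> B C" and C: "C \<in> Obj D" and f: "\<guillemotleft>f : A \<rightarrow> B\<guillemotright>"
  shows "\<phi> \<cdot> f \<in> through \<X> A C"
  using \<phi>
proof (induction rule: through.induct)
  case zero
  then show ?case using zero_comp[OF f C] through.zero by simp
next
  case (step \<phi> X a b)
  then show ?case
    using through.step[OF step.IH step.hyps(2) arrow_comp[OF f step.hyps(3)] step.hyps(4)]
      add_comp[OF f through_arrow[OF step.hyps(1) arrowD(2)[OF f] C] arrow_comp[OF step.hyps(3,4)]]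
      assoc[OF f step.hyps(3,4)] by simp
qed

lemma through_closed_under:
  assumes "\<phi> \<in> through \<X> A B" "A \<in> Obj D" "B \<in> Obj D"
    and "P \<zero>\<^bsub>Hom D A B\<^esub>"
    and "\<And>f g. \<lbrakk>\<guillemotleft>f : A \<rightarrow> B\<guillemotright>; \<guillemotleft>g : A \<rightarrow> B\<guillemotright>; P f; P g\<rbrakk> \<Longrightarrow> P (f \<oplus>\<^bsub>Hom D A B\<^esub> g)"
    and "\<And>X a b. \<lbrakk>X \<in> \<X>; \<guillemotleft>a : A \<rightarrow> X\<guillemotright>; \<guillemotleft>b : X \<rightarrow> B\<guillemotright>\<rbrakk> \<Longrightarrow> P (b \<cdot> a)"
  shows "P \<phi>"
  using assms(1)
proof (induction rule: through.induct)
  case (step \<phi> X a b)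
  then show ?case using assms(5,6) through_arrow[OF step.hyps(1) assms(2,3)] by blast
qed (rule assms(4))

text \<open>An object is a retract of a finite direct sum of objects of \<open>\<X>\<close> exactly if its identity lies in the
  ideal of \<open>\<X>\<close>. Retracts are direct summands as soon as split monomorphisms have complements,
  which triangles provide.\<close>

definition summands :: "'o set \<Rightarrow> 'o set" where
  "summands \<X> = {Y \<in> Obj D. ident D Y \<in> through \<X> Y Y}"

lemma summandsD: "Y \<in> summands \<X> \<Longrightarrow> Y \<in> Obj D" "Y \<in> summands \<X> \<Longrightarrow> ident D Y \<in> through \<X> Y Y"
  by (simp_all add: summands_def)

lemma summands_refl: "\<lbrakk>Y \<in> \<X>; Y \<in> Obj D\<rbrakk> \<Longrightarrow> Y \<in> summands \<X>"
  using through_single[OF _ arrow_ident arrow_ident, of Y \<X>] comp_id[OF arrow_ident, of Y]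
  by (simp add: summands_def)

lemma through_trans:
  assumes \<phi>: "\<phi> \<in> through \<X> A B" and O: "A \<in> Obj D" "B \<in> Obj D" and \<X>: "\<X> \<subseteq> summands \<Y>"
  shows "\<phi> \<in> through \<Y> A B"
proof (rule through_closed_under[OF \<phi> O])
  fix X a b
  assume X: "X \<in> \<X>" and a: "\<guillemotleft>a : A \<rightarrow> X\<guillemotright>" and b: "\<guillemotleft>b : X \<rightarrow> B\<guillemotright>"
  have "b \<cdot> (ident D X \<cdot> a) \<in> through \<Y> A B"
    by (rule through_comp[OF comp_through[OF summandsD(2) arrowD(2)[OF a] a] arrowD(1)[OF a] b])
      (use X \<X> in blast)
  then show "b \<cdot> a \<in> through \<Y> A B" using id_comp[OF a] by simp
qed (auto intro: through.zero through_add O)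

lemma summands_trans: "\<lbrakk>Y \<in> summands \<X>; \<X> \<subseteq> summands \<Y>\<rbrakk> \<Longrightarrow> Y \<in> summands \<Y>"
  using through_trans by (auto simp: summands_def)

lemma summands_eq:
  assumes "X \<in> summands {Y}" "Y \<in> summands {X}" shows "summands {X} = summands {Y}"
proof (intro equalityI subsetI)
  show "Z \<in> summands {Y}" if "Z \<in> summands {X}" for Z by (rule summands_trans[OF that]) (simp add: assms(1))
  show "Z \<in> summands {X}" if "Z \<in> summands {Y}" for Z by (rule summands_trans[OF that]) (simp add: assms(2))
qed

lemma through_zero:
  assumes \<phi>: "\<phi> \<in> through \<X> A B" and O: "A \<in> Obj D" "B \<in> Obj D"
    and 0: "\<And>X b. \<lbrakk>X \<in> \<X>; \<guillemotleft>b : X \<rightarrow> B\<guillemotright>\<rbrakk> \<Longrightarrow> b = \<zero>\<^bsub>Hom D X B\<^esub>"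
  shows "\<phi> = \<zero>\<^bsub>Hom D A B\<^esub>"
  by (rule through_closed_under[OF \<phi> O])
    (use O in \<open>auto simp: add_zero(1)[OF arrow_zero] dest!: 0 intro: zero_comp\<close>)

lemma biproduct_summands:
  assumes "biproduct D X Ys \<iota> \<pi>"
  shows "X \<in> summands (set Ys)" and "set Ys \<subseteq> summands {X}"
proof -
  note bp = biproductD[OF assms]
  have "(\<Oplus>\<^bsub>Hom D X X\<^esub> i \<in> {..<length Ys}. \<iota> i \<cdot> \<pi> i) \<in> through (set Ys) X X"
    by (rule finsum_induct[OF bp(1,1) finite_lessThan])
      (use bp(1-4) in \<open>auto intro: through.zero through_add through_single[OF nth_mem]\<close>)
  then show "X \<in> summands (set Ys)" using bp(1,7) by (simp add: summands_def)
  have "ident D (Ys ! i) \<in> through {X} (Ys ! i) (Ys ! i)" if "i < length Ys" for i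
    using through_single[OF _ bp(3,4)[OF that], of "{X}"] bp(5)[OF that] by simp
  then show "set Ys \<subseteq> summands {X}" using bp(2) by (auto simp: summands_def in_set_conv_nth)
qed

lemma direct_sum_summands:
  assumes "direct_sum D X Ys" shows "X \<in> summands (set Ys)" and "set Ys \<subseteq> summands {X}"
  using assms biproduct_summands unfolding direct_sum_def by blast+

end

context additive_category
begin

lemma factor_add:
  assumes "\<guillemotleft>d : A \<rightarrow> Z\<guillemotright>" "\<guillemotleft>c : Z \<rightarrow> B\<guillemotright>" "\<guillemotleft>a : A \<rightarrow> Y\<guillemotright>" "\<guillemotleft>b : Y \<rightarrow> B\<guillemotright>"
  obtains W d' c' where "direct_sum D W [Z, Y]" "\<guillemotleft>d' : A \<rightarrow> W\<guillemotright>" "\<guillemotleft>c' : W \<rightarrow> B\<guillemotright>"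
    "c' \<cdot> d' = c \<cdot> d \<oplus>\<^bsub>Hom D A B\<^esub> b \<cdot> a"
proof -
  have O: "Z \<in> Obj D" "Y \<in> Obj D" "A \<in> Obj D" "B \<in> Obj D" using assms by (auto dest: arrowD)
  obtain W \<iota> \<pi> where w: "biproduct D W [Z, Y] \<iota> \<pi>"
    using ex_direct_sum[OF O(1,2)] unfolding direct_sum_def by blast
  note bw = biproduct2D[OF w]
  let ?d = "\<iota> 0 \<cdot> d \<oplus>\<^bsub>Hom D A W\<^esub> \<iota> 1 \<cdot> a" and ?c = "c \<cdot> \<pi> 0 \<oplus>\<^bsub>Hom D W B\<^esub> b \<cdot> \<pi> 1"
  have ar: "\<guillemotleft>\<iota> 0 \<cdot> d : A \<rightarrow> W\<guillemotright>" "\<guillemotleft>\<iota> 1 \<cdot> a : A \<rightarrow> W\<guillemotright>" "\<guillemotleft>c \<cdot> \<pi> 0 : W \<rightarrow> B\<guillemotright>" "\<guillemotleft>b \<cdot> \<pi> 1 : W \<rightarrow> B\<guillemotright>"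
    using bw(4-7) assms by blast+
  have ar': "\<guillemotleft>?d : A \<rightarrow> W\<guillemotright>" "\<guillemotleft>?c : W \<rightarrow> B\<guillemotright>" using ar by blast+
  have 1: "c \<cdot> \<pi> 0 \<cdot> (\<iota> 0 \<cdot> d) = c \<cdot> d"
    using comp4[OF assms(1) bw(4,6) assms(2)] bw(8) comp_id[OF assms(2)] by simp
  have 2: "c \<cdot> \<pi> 0 \<cdot> (\<iota> 1 \<cdot> a) = \<zero>\<^bsub>Hom D A B\<^esub>"
    using comp4[OF assms(3) bw(5,6) assms(2)] bw(11) comp_zero[OF assms(2) O(2)] zero_comp[OF assms(3) O(4)] by simp
  have 3: "b \<cdot> \<pi> 1 \<cdot> (\<iota> 0 \<cdot> d) = \<zero>\<^bsub>Hom D A B\<^esub>"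
    using comp4[OF assms(1) bw(4,7) assms(4)] bw(10) comp_zero[OF assms(4) O(1)] zero_comp[OF assms(1) O(4)] by simp
  have 4: "b \<cdot> \<pi> 1 \<cdot> (\<iota> 1 \<cdot> a) = b \<cdot> a"
    using comp4[OF assms(3) bw(5,7) assms(4)] bw(9) comp_id[OF assms(4)] by simp
  have "?c \<cdot> ?d = c \<cdot> d \<oplus>\<^bsub>Hom D A B\<^esub> b \<cdot> a"
    by (simp only: comp_add[OF ar(1,2) ar'(2)] add_comp[OF ar(1) ar(3,4)] add_comp[OF ar(2) ar(3,4)]
        1 2 3 4 add_zero[OF arrow_comp[OF assms(1,2)]] add_zero[OF arrow_comp[OF assms(3,4)]])
  moreover have "direct_sum D W [Z, Y]" using w unfolding direct_sum_def by blast
  ultimately show thesis using that ar' by blast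
qed

lemma factor_zero:
  assumes "A \<in> Obj D" "B \<in> Obj D"
  obtains Z d c where "zero_obj D Z" "\<guillemotleft>d : A \<rightarrow> Z\<guillemotright>" "\<guillemotleft>c : Z \<rightarrow> B\<guillemotright>" "c \<cdot> d = \<zero>\<^bsub>Hom D A B\<^esub>"
proof -
  obtain Z where Z: "zero_obj D Z" using ex_zero_obj by blast
  then have O: "Z \<in> Obj D" by (simp add: zero_obj_iff)
  show thesis
    by (rule that[OF Z arrow_zero[OF assms(1) O] arrow_zero[OF O assms(2)]])
      (rule comp_zero[OF arrow_zero[OF O assms(2)] assms(1)])
qed

text \<open>The direct sum is built by adding one object at a time. The predicate \<open>P\<close> records what is needed
  about it: its list of summands, or its membership in a thick subcategory.\<close>

lemma through_factor:
  assumes \<phi>: "\<phi> \<in> through \<X> A B" and O: "A \<in> Obj D" "B \<in> Obj D"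
    and P0: "\<And>Z. zero_obj D Z \<Longrightarrow> P [] Z"
    and PS: "\<And>Ys Z Y W. \<lbrakk>P Ys Z; Y \<in> \<X>; direct_sum D W [Z, Y]\<rbrakk> \<Longrightarrow> P (Ys @ [Y]) W"
  obtains Ys Z d c where "P Ys Z" "set Ys \<subseteq> \<X>" "\<guillemotleft>d : A \<rightarrow> Z\<guillemotright>" "\<guillemotleft>c : Z \<rightarrow> B\<guillemotright>" "\<phi> = c \<cdot> d"
proof -
  have "\<exists>Ys Z d c. P Ys Z \<and> set Ys \<subseteq> \<X> \<and> \<guillemotleft>d : A \<rightarrow> Z\<guillemotright> \<and> \<guillemotleft>c : Z \<rightarrow> B\<guillemotright> \<and> \<phi> = c \<cdot> d"
    using \<phi>
  proof (induction rule: through.induct)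
    case zero
    obtain Z d c where "zero_obj D Z" "\<guillemotleft>d : A \<rightarrow> Z\<guillemotright>" "\<guillemotleft>c : Z \<rightarrow> B\<guillemotright>" "c \<cdot> d = \<zero>\<^bsub>Hom D A B\<^esub>"
      by (rule factor_zero[OF O])
    then show ?case using P0 by (metis empty_iff empty_set subsetI)
  next
    case (step \<phi> X a b)
    then obtain Ys Z d c where h: "P Ys Z" "set Ys \<subseteq> \<X>" "\<guillemotleft>d : A \<rightarrow> Z\<guillemotright>" "\<guillemotleft>c : Z \<rightarrow> B\<guillemotright>" "\<phi> = c \<cdot> d"
      by blast
    obtain W d' c' where w: "direct_sum D W [Z, X]" "\<guillemotleft>d' : A \<rightarrow> W\<guillemotright>" "\<guillemotleft>c' : W \<rightarrow> B\<guillemotright>"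
      "c' \<cdot> d' = c \<cdot> d \<oplus>\<^bsub>Hom D A B\<^esub> b \<cdot> a"
      by (rule factor_add[OF h(3,4) step.hyps(3,4)])
    show ?case
      using PS[OF h(1) step.hyps(2) w(1)] h(2,5) step.hyps(2) w(2-4)
      by (intro exI[of _ "Ys @ [X]"] exI[of _ W] exI[of _ d'] exI[of _ c']) auto
  qed
  then show thesis using that by blast
qed

text \<open>In contrast to \<open>through_factor\<close>, the number of terms is kept: it is what decreases when a
  superfluous term of a decomposition is dropped.\<close>

lemma finsum_factor:
  assumes J: "finite J" and O: "A \<in> Obj D" "B \<in> Obj D"
    and ab: "\<And>j. j \<in> J \<Longrightarrow> \<guillemotleft>a j : A \<rightarrow> Y j\<guillemotright>" "\<And>j. j \<in> J \<Longrightarrow> \<guillemotleft>b j : Y j \<rightarrow> B\<guillemotright>"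
  obtains Ys Z d c where "direct_sum D Z Ys" "length Ys = card J" "set Ys \<subseteq> Y ` J"
    "\<guillemotleft>d : A \<rightarrow> Z\<guillemotright>" "\<guillemotleft>c : Z \<rightarrow> B\<guillemotright>" "(\<Oplus>\<^bsub>Hom D A B\<^esub> j \<in> J. b j \<cdot> a j) = c \<cdot> d"
proof -
  interpret H: abelian_group "Hom D A B" by (rule Hom_group[OF O])
  have "\<exists>Ys Z d c. direct_sum D Z Ys \<and> length Ys = card J \<and> set Ys \<subseteq> Y ` J \<and>
    \<guillemotleft>d : A \<rightarrow> Z\<guillemotright> \<and> \<guillemotleft>c : Z \<rightarrow> B\<guillemotright> \<and> (\<Oplus>\<^bsub>Hom D A B\<^esub> j \<in> J. b j \<cdot> a j) = c \<cdot> d"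
    using J ab
  proof (induction J rule: finite_induct)
    case empty
    obtain Z d c where "zero_obj D Z" "\<guillemotleft>d : A \<rightarrow> Z\<guillemotright>" "\<guillemotleft>c : Z \<rightarrow> B\<guillemotright>" "c \<cdot> d = \<zero>\<^bsub>Hom D A B\<^esub>"
      by (rule factor_zero[OF O])
    then show ?case using direct_sum_Nil
      by (intro exI[of _ "[]"] exI[of _ Z] exI[of _ d] exI[of _ c]) auto
  next
    case (insert j J)
    have "\<exists>Ys Z d c. direct_sum D Z Ys \<and> length Ys = card J \<and> set Ys \<subseteq> Y ` J \<and>
      \<guillemotleft>d : A \<rightarrow> Z\<guillemotright> \<and> \<guillemotleft>c : Z \<rightarrow> B\<guillemotright> \<and> (\<Oplus>\<^bsub>Hom D A B\<^esub> j \<in> J. b j \<cdot> a j) = c \<cdot> d"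
      by (rule insert.IH) (use insert.prems in auto)
    then obtain Ys Z d c where h: "direct_sum D Z Ys" "length Ys = card J" "set Ys \<subseteq> Y ` J"
      "\<guillemotleft>d : A \<rightarrow> Z\<guillemotright>" "\<guillemotleft>c : Z \<rightarrow> B\<guillemotright>" "(\<Oplus>\<^bsub>Hom D A B\<^esub> j \<in> J. b j \<cdot> a j) = c \<cdot> d"
      by blast
    have j: "\<guillemotleft>a j : A \<rightarrow> Y j\<guillemotright>" "\<guillemotleft>b j : Y j \<rightarrow> B\<guillemotright>" using insert.prems by auto
    obtain W d' c' where w: "direct_sum D W [Z, Y j]" "\<guillemotleft>d' : A \<rightarrow> W\<guillemotright>" "\<guillemotleft>c' : W \<rightarrow> B\<guillemotright>"
      "c' \<cdot> d' = c \<cdot> d \<oplus>\<^bsub>Hom D A B\<^esub> b j \<cdot> a j"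
      by (rule factor_add[OF h(4,5) j])
    have m: "(\<lambda>j. b j \<cdot> a j) \<in> J \<rightarrow> Mor D A B" "b j \<cdot> a j \<in> Mor D A B"
      using arrow_comp[OF insert.prems(1,2), THEN arrowD(3)] by auto
    have "(\<Oplus>\<^bsub>Hom D A B\<^esub> j \<in> insert j J. b j \<cdot> a j) = c' \<cdot> d'"
      using insert.hyps m h(6) w(4) add_commute[OF arrow_comp[OF h(4,5)] arrow_comp[OF j]]
      by (simp add: H.finsum_insert)
    then show ?case
      using direct_sum_snoc[OF h(1) w(1)] h(2,3) w(2,3) insert.hyps
      by (intro exI[of _ "Ys @ [Y j]"] exI[of _ W] exI[of _ d'] exI[of _ c']) auto
  qed
  then show thesis using that by blast
qed

lemma ex_direct_sum_list: "set Ys \<subseteq> Obj D \<Longrightarrow> \<exists>Z. direct_sum D Z Ys"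
proof (induction Ys rule: rev_induct)
  case Nil
  then show ?case using ex_zero_obj direct_sum_Nil by blast
next
  case (snoc Y Ys)
  then obtain Z where Z: "direct_sum D Z Ys" by auto
  then have "Z \<in> Obj D" using direct_sum_summands(1) summandsD(1) by blast
  then obtain W where "direct_sum D W [Z, Y]" using ex_direct_sum snoc.prems by fastforce
  then show ?case using direct_sum_snoc[OF Z] by blast
qed

end

section \<open>Exactness of triangles\<close>

context shift_category
begin

lemma shift_arrow: "\<guillemotleft>f : X \<rightarrow> Y\<guillemotright> \<Longrightarrow> \<guillemotleft>shift_mor D n f : shift D n X \<rightarrow> shift D n Y\<guillemotright>"
  unfolding arrow_def using shift_Obj shift_Mor by blast

lemma shift_comp: "\<lbrakk>\<guillemotleft>f : X \<rightarrow> Y\<guillemotright>; \<guillemotleft>g : Y \<rightarrow> Z\<guillemotright>\<rbrakk> \<Longrightarrow> shift_mor D n (g \<cdot> f) = shift_mor D n g \<cdot> shift_mor D n f"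
  unfolding arrow_def using shift_mor_comp by blast

lemma shift_add: "\<lbrakk>\<guillemotleft>f : X \<rightarrow> Y\<guillemotright>; \<guillemotleft>g : X \<rightarrow> Y\<guillemotright>\<rbrakk> \<Longrightarrow>
    shift_mor D n (f \<oplus>\<^bsub>Hom D X Y\<^esub> g) = shift_mor D n f \<oplus>\<^bsub>Hom D (shift D n X) (shift D n Y)\<^esub> shift_mor D n g"
  unfolding arrow_def using shift_mor_add by blast

lemma shift_back: "\<lbrakk>\<guillemotleft>f : X \<rightarrow> Y\<guillemotright>; m + n = 0\<rbrakk> \<Longrightarrow> shift_mor D m (shift_mor D n f) = f"
  unfolding arrow_def using shift_mor_shift_mor[of X Y f m n] shift_mor_0[of X Y f] by simp

lemma shift_shift_0: "\<lbrakk>X \<in> Obj D; m + n = 0\<rbrakk> \<Longrightarrow> shift D m (shift D n X) = X"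
  using shift_shift shift_0 by simp

lemma shift_zero_mor:
  "\<lbrakk>X \<in> Obj D; Y \<in> Obj D\<rbrakk> \<Longrightarrow> shift_mor D n \<zero>\<^bsub>Hom D X Y\<^esub> = \<zero>\<^bsub>Hom D (shift D n X) (shift D n Y)\<^esub>"
proof -
  assume "X \<in> Obj D" "Y \<in> Obj D"
  then have z: "\<guillemotleft>\<zero>\<^bsub>Hom D X Y\<^esub> : X \<rightarrow> Y\<guillemotright>" by blast
  show ?thesis
    by (rule add_idem_zero[OF shift_arrow[OF z]]) (simp add: shift_add[OF z z, symmetric] add_zero(1)[OF z])
qed

lemma shift_neg: "\<guillemotleft>f : X \<rightarrow> Y\<guillemotright> \<Longrightarrow>
    shift_mor D n (\<ominus>\<^bsub>Hom D X Y\<^esub> f) = \<ominus>\<^bsub>Hom D (shift D n X) (shift D n Y)\<^esub> shift_mor D n f"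
proof -
  assume f: "\<guillemotleft>f : X \<rightarrow> Y\<guillemotright>"
  show ?thesis
    by (rule neg_unique[OF shift_arrow[OF f] shift_arrow[OF arrow_neg[OF f]]])
      (simp add: shift_add[OF f arrow_neg[OF f], symmetric] add_neg[OF f] shift_zero_mor arrowD[OF f])
qed

lemma zero_obj_shift: "zero_obj D Z \<Longrightarrow> zero_obj D (shift D n Z)"
  using shift_mor_ident[of Z n] shift_zero_mor[of Z Z n] shift_Obj by (auto simp: zero_obj_iff)

lemma through_shift:
  assumes "\<phi> \<in> through {X} A B" and O: "A \<in> Obj D" "B \<in> Obj D"
  shows "shift_mor D n \<phi> \<in> through {shift D n X} (shift D n A) (shift D n B)"
  using assms(1)
proof (induction rule: through.induct)
  case zero
  then show ?case using shift_zero_mor O through.zero by simp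
next
  case (step \<phi> X' a b)
  then show ?case
    using through.step[OF step.IH _ shift_arrow[OF step.hyps(3)] shift_arrow[OF step.hyps(4)]]
      shift_add[OF through_arrow[OF step.hyps(1) O] arrow_comp[OF step.hyps(3,4)]]
      shift_comp[OF step.hyps(3,4)] by simp
qed

lemma summands_shift: "Y \<in> summands {X} \<Longrightarrow> shift D n Y \<in> summands {shift D n X}"
  using through_shift[of "ident D Y" X Y Y n] by (simp add: summands_def shift_Obj shift_mor_ident)

end

context triangulated_category
begin

lemma triD:
  assumes "dist_tri D X Y Z f g h"
  shows "\<guillemotleft>f : X \<rightarrow> Y\<guillemotright>" "\<guillemotleft>g : Y \<rightarrow> Z\<guillemotright>" "\<guillemotleft>h : Z \<rightarrow> shift D 1 X\<guillemotright>"
  using tri_candidate[OF assms] unfolding candidate_tri_def arrow_def by (auto intro: shift_Obj)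

lemma rotate: "dist_tri D X Y Z f g h \<Longrightarrow>
    dist_tri D Y Z (shift D 1 X) g h (\<ominus>\<^bsub>Hom D (shift D 1 X) (shift D 1 Y)\<^esub> shift_mor D 1 f)"
  using tri_rotate tri_candidate by blast

text \<open>The new first morphism is \<open>-h[-1]\<close>, the sign cancelling that of the rotation axiom.\<close>

lemma rotate_back:
  assumes t: "dist_tri D X Y Z f g h"
  obtains h' where "dist_tri D (shift D (-1) Z) X Y h' f g"
proof -
  note a = triD[OF t]
  have O: "X \<in> Obj D" "Y \<in> Obj D" "Z \<in> Obj D" using a by (auto dest: arrowD)
  let ?k = "shift_mor D (-1) h" and ?ZX = "Hom D (shift D (-1) Z) X"
  have k: "\<guillemotleft>?k : shift D (-1) Z \<rightarrow> X\<guillemotright>"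
    using shift_arrow[OF a(3), of "-1"] shift_shift_0[OF O(1), of "-1" 1] by simp
  have Z: "shift D 1 (shift D (-1) Z) = Z" by (rule shift_shift_0[OF O(3)]) simp
  have "shift_mor D 1 (\<ominus>\<^bsub>?ZX\<^esub> ?k) = \<ominus>\<^bsub>Hom D Z (shift D 1 X)\<^esub> h"
    using shift_neg[OF k, of 1] shift_back[OF a(3), of 1 "-1"] Z by simp
  then have "\<ominus>\<^bsub>Hom D Z (shift D 1 X)\<^esub> shift_mor D 1 (\<ominus>\<^bsub>?ZX\<^esub> ?k) = h"
    using neg_neg[OF a(3)] by simp
  moreover have "candidate_tri D (shift D (-1) Z) X Y (\<ominus>\<^bsub>?ZX\<^esub> ?k) f g"
    unfolding candidate_tri_def Z using a arrow_neg[OF k] by (auto dest: arrowD)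
  ultimately have "dist_tri D (shift D (-1) Z) X Y (\<ominus>\<^bsub>?ZX\<^esub> ?k) f g"
    using tri_rotate[of "shift D (-1) Z" X Y "\<ominus>\<^bsub>?ZX\<^esub> ?k" f g] t Z by simp
  then show thesis by (rule that)
qed

lemma tri_ident_right:
  assumes A: "A \<in> Obj D" and Z: "zero_obj D Z"
  shows "dist_tri D Z A A \<zero>\<^bsub>Hom D Z A\<^esub> (ident D A) \<zero>\<^bsub>Hom D A (shift D 1 Z)\<^esub>"
proof -
  have O: "Z \<in> Obj D" using Z by (simp add: zero_obj_iff)
  have "candidate_tri D Z A A \<zero>\<^bsub>Hom D Z A\<^esub> (ident D A) \<zero>\<^bsub>Hom D A (shift D 1 Z)\<^esub>"
    unfolding candidate_tri_def
    using A O arrowD(3)[OF arrow_zero[OF O A]] arrowD(3)[OF arrow_zero[OF A shift_Obj[OF O]]] ident_Mor by blast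
  from tri_rotate[OF this] show ?thesis
    using tri_ident[OF A zero_obj_shift[OF Z, of 1]] neg_zero shift_zero_mor[OF O A] shift_Obj A O by simp
qed

text \<open>The morphism \<open>f\<close> extends to a map from the triangle on the identity of \<open>X\<close>, whose third term is zero.\<close>

lemma tri_comp_zero:
  assumes t: "dist_tri D X Y Z f g h" shows "g \<cdot> f = \<zero>\<^bsub>Hom D X Z\<^esub>"
proof -
  note a = triD[OF t]
  have O: "X \<in> Obj D" "Z \<in> Obj D" using a by (auto dest: arrowD)
  obtain N where N: "zero_obj D N" using ex_zero_obj by blast
  have eq: "f \<cdot> ident D X = f \<cdot> ident D X" ..
  obtain c where c: "c \<in> Mor D N Z" "c \<cdot> \<zero>\<^bsub>Hom D X N\<^esub> = g \<cdot> f"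
    using tri_complete[OF tri_ident[OF O(1) N] t ident_Mor[OF O(1)] arrowD(3)[OF a(1)] eq] by blast
  have "\<guillemotleft>c : N \<rightarrow> Z\<guillemotright>" using c N O by (simp add: arrow_def zero_obj_iff)
  from comp_zero[OF this O(1)] show ?thesis using c by simp
qed

text \<open>Exactness of \<open>Hom(-, A)\<close>: the pair \<open>(0, k)\<close> extends to a map to the triangle \<open>0 \<rightarrow> A \<rightarrow> A\<close>.\<close>

lemma tri_factor_right:
  assumes t: "dist_tri D X Y Z f g h" and k: "\<guillemotleft>k : Y \<rightarrow> A\<guillemotright>" and kf: "k \<cdot> f = \<zero>\<^bsub>Hom D X A\<^esub>"
  obtains l where "\<guillemotleft>l : Z \<rightarrow> A\<guillemotright>" "k = l \<cdot> g"
proof -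
  note a = triD[OF t]
  have O: "X \<in> Obj D" "Z \<in> Obj D" "A \<in> Obj D" using a k by (auto dest: arrowD)
  obtain N where N: "zero_obj D N" using ex_zero_obj by blast
  have NO: "N \<in> Obj D" using N by (simp add: zero_obj_iff)
  have eq: "k \<cdot> f = \<zero>\<^bsub>Hom D N A\<^esub> \<cdot> \<zero>\<^bsub>Hom D X N\<^esub>"
    using kf comp_zero[OF arrow_zero[OF NO O(3)] O(1)] by simp
  obtain c where c: "c \<in> Mor D Z A" "c \<cdot> g = ident D A \<cdot> k"
    using tri_complete[OF t tri_ident_right[OF O(3) N] arrowD(3)[OF arrow_zero[OF O(1) NO]] arrowD(3)[OF k] eq] by blast
  show thesis by (rule that[of c]) (use c O id_comp[OF k] in \<open>auto simp: arrow_def\<close>)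
qed

text \<open>Exactness of \<open>Hom(A, -)\<close>: after one rotation, the pair \<open>(k, 0)\<close> extends to a map from the triangle
  \<open>A \<rightarrow> 0 \<rightarrow> A[1]\<close>, and its third component is the shift of the required factor.\<close>

lemma tri_factor_left:
  assumes t: "dist_tri D X Y Z f g h" and k: "\<guillemotleft>k : A \<rightarrow> Y\<guillemotright>" and gk: "g \<cdot> k = \<zero>\<^bsub>Hom D A Z\<^esub>"
  obtains l where "\<guillemotleft>l : A \<rightarrow> X\<guillemotright>" "k = f \<cdot> l"
proof -
  note a = triD[OF t]
  have O: "X \<in> Obj D" "Y \<in> Obj D" "Z \<in> Obj D" "A \<in> Obj D" using a k by (auto dest: arrowD)
  obtain N where N: "zero_obj D N" using ex_zero_obj by blast
  have NO: "N \<in> Obj D" using N by (simp add: zero_obj_iff)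
  let ?A = "shift D 1 A" and ?X = "shift D 1 X" and ?Y = "shift D 1 Y"
  have AO: "?A \<in> Obj D" and YO: "?Y \<in> Obj D" using O shift_Obj by auto
  have eq: "\<zero>\<^bsub>Hom D N Z\<^esub> \<cdot> \<zero>\<^bsub>Hom D A N\<^esub> = g \<cdot> k"
    using gk comp_zero[OF arrow_zero[OF NO O(3)] O(4)] by simp
  obtain c where c: "c \<in> Mor D ?A ?X"
    "shift_mor D 1 k \<cdot> (\<ominus>\<^bsub>Hom D ?A ?A\<^esub> shift_mor D 1 (ident D A)) = (\<ominus>\<^bsub>Hom D ?X ?Y\<^esub> shift_mor D 1 f) \<cdot> c"
    using tri_complete[OF rotate[OF tri_ident[OF O(4) N]] rotate[OF t] arrowD(3)[OF k] arrowD(3)[OF arrow_zero[OF NO O(3)]] eq]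
    by blast
  have ca: "\<guillemotleft>c : ?A \<rightarrow> ?X\<guillemotright>" using c(1) O shift_Obj by (simp add: arrow_def)
  note k1 = shift_arrow[OF k, of 1] and f1 = shift_arrow[OF a(1), of 1]
  have "\<ominus>\<^bsub>Hom D ?A ?Y\<^esub> shift_mor D 1 k = \<ominus>\<^bsub>Hom D ?A ?Y\<^esub> (shift_mor D 1 f \<cdot> c)"
    using c(2) comp_neg[OF arrow_ident[OF AO] k1] comp_id[OF k1] neg_comp[OF ca f1]
      shift_mor_ident[OF O(4), of 1] by simp
  then have "shift_mor D 1 k = shift_mor D 1 f \<cdot> c"
    using neg_neg[OF k1] neg_neg[OF arrow_comp[OF ca f1]] by metis
  then have "shift_mor D (-1) (shift_mor D 1 k) = shift_mor D (-1) (shift_mor D 1 f) \<cdot> shift_mor D (-1) c"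
    using shift_comp[OF ca f1] by simp
  then have "k = f \<cdot> shift_mor D (-1) c"
    using shift_back[OF k, of "-1" 1] shift_back[OF a(1), of "-1" 1] by simp
  moreover have "\<guillemotleft>shift_mor D (-1) c : A \<rightarrow> X\<guillemotright>"
    using shift_arrow[OF ca, of "-1"] shift_shift_0[OF O(4), of "-1" 1] shift_shift_0[OF O(1), of "-1" 1] by simp
  ultimately show thesis using that by blast
qed

text \<open>The composite of \<open>h\<close> with the split monomorphism \<open>i[1]\<close> is zero, so \<open>h = 0\<close> and \<open>g\<close> is an
  epimorphism. The idempotent \<open>1 - ip\<close> annihilates \<open>i\<close>, so it factors as \<open>sg\<close>, and cancelling \<open>g\<close>
  turns \<open>gsg = g\<close> and \<open>psg = 0\<close> into the relations of a direct sum.\<close>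

lemma tri_split:
  assumes t: "dist_tri D Y Z C i g h" and p: "\<guillemotleft>p : Z \<rightarrow> Y\<guillemotright>" and pi: "p \<cdot> i = ident D Y"
  obtains s where "\<guillemotleft>s : C \<rightarrow> Z\<guillemotright>" "g \<cdot> s = ident D C" "p \<cdot> s = \<zero>\<^bsub>Hom D C Y\<^esub>"
    "i \<cdot> p \<oplus>\<^bsub>Hom D Z Z\<^esub> s \<cdot> g = ident D Z" "direct_sum D Z [Y, C]"
proof -
  note a = triD[OF t]
  have O: "Y \<in> Obj D" "Z \<in> Obj D" "C \<in> Obj D" using a by (auto dest: arrowD)
  let ?Y = "shift D 1 Y" and ?Z = "shift D 1 Z"
  note i1 = shift_arrow[OF a(1), of 1] and p1 = shift_arrow[OF p, of 1]
  have h0: "h = \<zero>\<^bsub>Hom D C ?Y\<^esub>"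
  proof -
    have "(\<ominus>\<^bsub>Hom D ?Y ?Z\<^esub> shift_mor D 1 i) \<cdot> h = \<zero>\<^bsub>Hom D C ?Z\<^esub>"
      by (rule tri_comp_zero[OF rotate[OF rotate[OF t]]])
    then have "shift_mor D 1 i \<cdot> h = \<zero>\<^bsub>Hom D C ?Z\<^esub>"
      using neg_comp[OF a(3) i1] neg_neg[OF arrow_comp[OF a(3) i1]] neg_zero O shift_Obj by metis
    then have "shift_mor D 1 p \<cdot> shift_mor D 1 i \<cdot> h = \<zero>\<^bsub>Hom D C ?Y\<^esub>"
      using assoc[OF a(3) i1 p1] comp_zero[OF p1 O(3)] by simp
    then show ?thesis
      using shift_comp[OF a(1) p, of 1] pi shift_mor_ident[OF O(1), of 1] id_comp[OF a(3)] by simp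
  qed
  have g_epi: "k = \<zero>\<^bsub>Hom D C A\<^esub>" if k: "\<guillemotleft>k : C \<rightarrow> A\<guillemotright>" and kg: "k \<cdot> g = \<zero>\<^bsub>Hom D Z A\<^esub>" for k A
  proof -
    obtain l where "\<guillemotleft>l : ?Y \<rightarrow> A\<guillemotright>" "k = l \<cdot> h" by (rule tri_factor_right[OF rotate[OF t] k kg])
    then show ?thesis using h0 comp_zero[of l ?Y A C] O by simp
  qed
  let ?e = "ident D Z \<ominus>\<^bsub>Hom D Z Z\<^esub> i \<cdot> p"
  note idZ = arrow_ident[OF O(2)] and ip = arrow_comp[OF p a(1)]
  have e: "\<guillemotleft>?e : Z \<rightarrow> Z\<guillemotright>" using idZ ip by blast
  have "?e \<cdot> i = \<zero>\<^bsub>Hom D Y Z\<^esub>"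
    using minus_comp[OF a(1) idZ ip] id_comp[OF a(1)] assoc[OF a(1) p a(1)] pi comp_id[OF a(1)] minus_self[OF a(1)]
    by simp
  then obtain s where s: "\<guillemotleft>s : C \<rightarrow> Z\<guillemotright>" and es: "?e = s \<cdot> g" by (rule tri_factor_right[OF t e])
  have gi: "g \<cdot> i = \<zero>\<^bsub>Hom D Y C\<^esub>" by (rule tri_comp_zero[OF t])
  have "g \<cdot> s \<cdot> g = g"
    using assoc[OF a(2) s a(2)] es[symmetric] comp_minus[OF idZ ip a(2)] comp_id[OF a(2)]
      assoc[OF p a(1,2)] gi zero_comp[OF p O(3)] minus_zero[OF a(2)] by simp
  then have "(g \<cdot> s \<ominus>\<^bsub>Hom D C C\<^esub> ident D C) \<cdot> g = \<zero>\<^bsub>Hom D Z C\<^esub>"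
    using minus_comp[OF a(2) arrow_comp[OF s a(2)] arrow_ident[OF O(3)]] id_comp[OF a(2)] minus_self[OF a(2)] by simp
  from g_epi[OF arrow_minus[OF arrow_comp[OF s a(2)] arrow_ident[OF O(3)]] this]
  have gs: "g \<cdot> s = ident D C"
    by (rule eq_if_minus_zero[OF arrow_ident[OF O(3)] arrow_comp[OF s a(2)]])
  have "p \<cdot> s \<cdot> g = \<zero>\<^bsub>Hom D Z Y\<^esub>"
    using assoc[OF a(2) s p] es[symmetric] comp_minus[OF idZ ip p] comp_id[OF p]
      assoc[OF p a(1) p] pi id_comp[OF p] minus_self[OF p] by simp
  from g_epi[OF arrow_comp[OF s p] this] have ps: "p \<cdot> s = \<zero>\<^bsub>Hom D C Y\<^esub>" .
  have sum: "i \<cdot> p \<oplus>\<^bsub>Hom D Z Z\<^esub> s \<cdot> g = ident D Z"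
    using add_minus[OF ip idZ] es by simp
  have "direct_sum D Z [Y, C]"
    using biproduct2I[OF a(1) s p a(2) pi gs gi ps sum] unfolding direct_sum_def by blast
  with s gs ps sum show thesis by (rule that)
qed

lemma retract_direct_sum:
  assumes i: "\<guillemotleft>i : Y \<rightarrow> Z\<guillemotright>" and p: "\<guillemotleft>p : Z \<rightarrow> Y\<guillemotright>" and pi: "p \<cdot> i = ident D Y"
  shows "\<exists>C. direct_sum D Z [Y, C]"
proof -
  obtain C g h where t: "dist_tri D Y Z C i g h" using tri_cone arrowD[OF i] by blast
  show ?thesis by (rule tri_split[OF t p pi]) blast
qed

lemma add_of_eq_summands:
  assumes X: "X \<in> Obj D" shows "add_of D X = summands {X}"
proof (intro equalityI subsetI)
  fix Y assume "Y \<in> add_of D X"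
  then obtain Y' Z n where Z: "direct_sum D Z (replicate n X)" "direct_sum D Z [Y, Y']"
    unfolding add_of_def by blast
  have "set (replicate n X) \<subseteq> summands {X}" using summands_refl X by auto
  then have "Z \<in> summands {X}" using direct_sum_summands(1)[OF Z(1)] summands_trans by blast
  then show "Y \<in> summands {X}" using direct_sum_summands(2)[OF Z(2)] summands_trans[of Y "{Z}" "{X}"] by auto
next
  fix Y assume Y: "Y \<in> summands {X}"
  show "Y \<in> add_of D X"
  proof (rule through_factor[OF summandsD(2)[OF Y] summandsD(1)[OF Y] summandsD(1)[OF Y], of "\<lambda>Ys Z. direct_sum D Z Ys"])
    fix Ys Z d c
    assume Z: "direct_sum D Z Ys" "set Ys \<subseteq> {X}" and dc: "\<guillemotleft>d : Y \<rightarrow> Z\<guillemotright>" "\<guillemotleft>c : Z \<rightarrow> Y\<guillemotright>" "ident D Y = c \<cdot> d"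
    have "replicate (length Ys) X = Ys" using Z(2) by (intro replicate_length_same) auto
    moreover obtain C where "direct_sum D Z [Y, C]" using retract_direct_sum[OF dc(1,2)] dc(3) by auto
    ultimately have "direct_sum D Z (replicate (length Ys) X) \<and> direct_sum D Z [Y, C]" using Z(1) by simp
    then show "Y \<in> add_of D X" unfolding add_of_def by blast
  qed (auto intro: direct_sum_Nil direct_sum_snoc)
qed

text \<open>As \<open>h\<close> vanishes, the identity of \<open>Z\<close> lifts to a section \<open>s\<close> of \<open>g\<close>, and \<open>1 - sg\<close> factors through
  \<open>X\<close>.\<close>

lemma tri_zero_summands:
  assumes t: "dist_tri D X Y Z f g h" and h: "h = \<zero>\<^bsub>Hom D Z (shift D 1 X)\<^esub>"
  shows "Y \<in> summands {X, Z}"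
proof -
  note a = triD[OF t]
  have O: "Y \<in> Obj D" "Z \<in> Obj D" using a by (auto dest: arrowD)
  note idY = arrow_ident[OF O(1)] and idZ = arrow_ident[OF O(2)]
  have "h \<cdot> ident D Z = \<zero>\<^bsub>Hom D Z (shift D 1 X)\<^esub>" using comp_id[OF a(3)] h by simp
  then obtain s where s: "\<guillemotleft>s : Z \<rightarrow> Y\<guillemotright>" and gs: "ident D Z = g \<cdot> s"
    by (rule tri_factor_left[OF rotate[OF t] idZ])
  note sg = arrow_comp[OF a(2) s]
  have "g \<cdot> (ident D Y \<ominus>\<^bsub>Hom D Y Y\<^esub> s \<cdot> g) = \<zero>\<^bsub>Hom D Y Z\<^esub>"
    using comp_minus[OF idY sg a(2)] comp_id[OF a(2)] assoc[OF a(2) s a(2)] gs[symmetric] id_comp[OF a(2)]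
      minus_self[OF a(2)] by simp
  then obtain l where l: "\<guillemotleft>l : Y \<rightarrow> X\<guillemotright>" and fl: "ident D Y \<ominus>\<^bsub>Hom D Y Y\<^esub> s \<cdot> g = f \<cdot> l"
    by (rule tri_factor_left[OF t arrow_minus[OF idY sg]])
  have "s \<cdot> g \<oplus>\<^bsub>Hom D Y Y\<^esub> f \<cdot> l \<in> through {X, Z} Y Y"
    by (intro through_add through_single[OF _ a(2) s] through_single[OF _ l a(1)] O) auto
  then show ?thesis using add_minus[OF sg idY] fl O by (simp add: summands_def)
qed

end

section \<open>Vanishing of morphisms\<close>

context linear_category
begin

definition vanish :: "'o \<Rightarrow> 'o \<Rightarrow> bool" where
  "vanish A B \<longleftrightarrow> (\<forall>f. \<guillemotleft>f : A \<rightarrow> B\<guillemotright> \<longrightarrow> f = \<zero>\<^bsub>Hom D A B\<^esub>)"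

lemma vanishD: "\<lbrakk>vanish A B; \<guillemotleft>f : A \<rightarrow> B\<guillemotright>\<rbrakk> \<Longrightarrow> f = \<zero>\<^bsub>Hom D A B\<^esub>"
  by (simp add: vanish_def)

lemma vanish_iff: "\<lbrakk>A \<in> Obj D; B \<in> Obj D\<rbrakk> \<Longrightarrow> vanish A B \<longleftrightarrow> Mor D A B = {\<zero>\<^bsub>Hom D A B\<^esub>}"
  using arrowD(3)[OF arrow_zero] unfolding vanish_def arrow_def by blast

lemma vanish_summands_left:
  assumes Y: "Y \<in> summands \<X>" and 0: "\<And>X. X \<in> \<X> \<Longrightarrow> vanish X B"
  shows "vanish Y B"
  unfolding vanish_def
proof (intro allI impI)
  fix f assume f: "\<guillemotleft>f : Y \<rightarrow> B\<guillemotright>"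
  have "f \<cdot> ident D Y \<in> through \<X> Y B" by (rule through_comp[OF summandsD(2)[OF Y] arrowD(1)[OF f] f])
  then have "f \<in> through \<X> Y B" using comp_id[OF f] by simp
  from through_zero[OF this arrowD(1,2)[OF f]] show "f = \<zero>\<^bsub>Hom D Y B\<^esub>" using vanishD[OF 0] by blast
qed

lemma vanish_summands_right:
  assumes Y: "Y \<in> summands \<X>" and 0: "\<And>X. X \<in> \<X> \<Longrightarrow> vanish A X"
  shows "vanish A Y"
  unfolding vanish_def
proof (intro allI impI)
  fix f assume f: "\<guillemotleft>f : A \<rightarrow> Y\<guillemotright>"
  note O = arrowD(1,2)[OF f]
  have "ident D Y \<cdot> f \<in> through \<X> A Y" by (rule comp_through[OF summandsD(2)[OF Y] O(2) f])
  then have "f \<in> through \<X> A Y" using id_comp[OF f] by simp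
  then show "f = \<zero>\<^bsub>Hom D A Y\<^esub>"
  proof (rule through_closed_under[OF _ O])
    fix X a b assume X: "X \<in> \<X>" and a: "\<guillemotleft>a : A \<rightarrow> X\<guillemotright>" and b: "\<guillemotleft>b : X \<rightarrow> Y\<guillemotright>"
    show "b \<cdot> a = \<zero>\<^bsub>Hom D A Y\<^esub>" using vanishD[OF 0[OF X] a] comp_zero[OF b O(1)] by simp
  qed (use O in \<open>auto simp: add_zero(1)[OF arrow_zero]\<close>)
qed

end

context shift_category
begin

lemma vanish_shift_both: 
  assumes v: "vanish A B" and O: "A \<in> Obj D" "B \<in> Obj D"
  shows "vanish (shift D n A) (shift D n B)"
  unfolding vanish_def
proof (intro allI impI)
  fix f assume f: "\<guillemotleft>f : shift D n A \<rightarrow> shift D n B\<guillemotright>"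
  have "\<guillemotleft>shift_mor D (-n) f : A \<rightarrow> B\<guillemotright>"
    using shift_arrow[OF f, of "-n"] shift_shift_0[OF O(1), of "-n" n] shift_shift_0[OF O(2), of "-n" n] by simp
  then have "shift_mor D (-n) f = \<zero>\<^bsub>Hom D A B\<^esub>" by (rule vanishD[OF v])
  then have "shift_mor D n (shift_mor D (-n) f) = \<zero>\<^bsub>Hom D (shift D n A) (shift D n B)\<^esub>"
    using shift_zero_mor[OF O] by simp
  then show "f = \<zero>\<^bsub>Hom D (shift D n A) (shift D n B)\<^esub>" using shift_back[OF f, of n "-n"] by simp
qed

lemma vanish_shift_iff:
  assumes O: "A \<in> Obj D" "B \<in> Obj D"
  shows "vanish (shift D m A) (shift D n B) \<longleftrightarrow> vanish A (shift D (n - m) B)"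
proof
  assume "vanish (shift D m A) (shift D n B)"
  from vanish_shift_both[OF this shift_Obj[OF O(1)] shift_Obj[OF O(2)], of "-m"]
  show "vanish A (shift D (n - m) B)"
    using shift_shift[OF O(2), of "-m" n] shift_shift_0[OF O(1), of "-m" m] by simp
next
  assume "vanish A (shift D (n - m) B)"
  from vanish_shift_both[OF this O(1) shift_Obj[OF O(2)], of m]
  show "vanish (shift D m A) (shift D n B)" using shift_shift[OF O(2), of m "n - m"] by simp
qed

lemma presilting_iff: "presilting D U \<longleftrightarrow> U \<in> Obj D \<and> (\<forall>i > 0. vanish U (shift D i U))"
  unfolding presilting_def using vanish_iff shift_Obj by blast

lemma presilting_summands:
  assumes S: "presilting D S" and X: "X \<in> summands {S}" and Y: "Y \<in> summands {S}" and i: "i > 0"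
  shows "vanish X (shift D i Y)"
  by (rule vanish_summands_left[OF X], rule vanish_summands_right[OF summands_shift[OF Y]])
    (use S i in \<open>auto simp: presilting_iff\<close>)

end

context triangulated_category
begin

lemma vanish_tri_left:
  assumes t: "dist_tri D X Y Z f g h" and X: "vanish X A" and Z: "vanish Z A"
  shows "vanish Y A"
  unfolding vanish_def
proof (intro allI impI)
  fix k assume k: "\<guillemotleft>k : Y \<rightarrow> A\<guillemotright>"
  have "k \<cdot> f = \<zero>\<^bsub>Hom D X A\<^esub>" by (rule vanishD[OF X arrow_comp[OF triD(1)[OF t] k]])
  then obtain l where l: "\<guillemotleft>l : Z \<rightarrow> A\<guillemotright>" "k = l \<cdot> g" by (rule tri_factor_right[OF t k])
  then show "k = \<zero>\<^bsub>Hom D Y A\<^esub>"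
    using vanishD[OF Z l(1)] zero_comp[OF triD(2)[OF t] arrowD(2)[OF k]] by simp
qed

lemma vanish_tri_right:
  assumes t: "dist_tri D X Y Z f g h" and X: "vanish A X" and Z: "vanish A Z"
  shows "vanish A Y"
  unfolding vanish_def
proof (intro allI impI)
  fix k assume k: "\<guillemotleft>k : A \<rightarrow> Y\<guillemotright>"
  have "g \<cdot> k = \<zero>\<^bsub>Hom D A Z\<^esub>" by (rule vanishD[OF Z arrow_comp[OF k triD(2)[OF t]]])
  then obtain l where l: "\<guillemotleft>l : A \<rightarrow> X\<guillemotright>" "k = f \<cdot> l" by (rule tri_factor_left[OF t k])
  then show "k = \<zero>\<^bsub>Hom D A Y\<^esub>"
    using vanishD[OF X l(1)] comp_zero[OF triD(1)[OF t] arrowD(1)[OF k]] by simp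
qed

lemma vanish_tri_right_shift:
  assumes t: "dist_tri D X Y Z f g h" and A: "A \<in> Obj D"
    and X: "vanish A (shift D n X)" and Z: "vanish A (shift D n Z)"
  shows "vanish A (shift D n Y)"
proof -
  note a = triD[OF t]
  have eq: "vanish A (shift D n B) \<longleftrightarrow> vanish (shift D (-n) A) B" if "B \<in> Obj D" for B
    using vanish_shift_iff[OF A that, of "-n" 0] shift_0[OF that] by simp
  have "vanish (shift D (-n) A) Y"
    by (rule vanish_tri_right[OF t]) (use X Z eq arrowD[OF a(1)] arrowD[OF a(2)] in auto)
  then show ?thesis using eq arrowD[OF a(1)] by simp
qed

end

section \<open>Approximations\<close>

context additive_category
begin

lemma copair:
  assumes c: "\<guillemotleft>c : Z \<rightarrow> B\<guillemotright>" and b: "\<guillemotleft>b : Y \<rightarrow> B\<guillemotright>"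
  obtains W s i i' where "direct_sum D W [Z, Y]" "\<guillemotleft>s : W \<rightarrow> B\<guillemotright>" "\<guillemotleft>i : Z \<rightarrow> W\<guillemotright>" "\<guillemotleft>i' : Y \<rightarrow> W\<guillemotright>"
    "s \<cdot> i = c" "s \<cdot> i' = b"
proof -
  have O: "Z \<in> Obj D" "Y \<in> Obj D" "B \<in> Obj D" using b c by (auto dest: arrowD)
  obtain W where W: "direct_sum D W [Z, Y]" using ex_direct_sum O by blast
  then obtain i i' p p' where w: "\<guillemotleft>i : Z \<rightarrow> W\<guillemotright>" "\<guillemotleft>i' : Y \<rightarrow> W\<guillemotright>" "\<guillemotleft>p : W \<rightarrow> Z\<guillemotright>" "\<guillemotleft>p' : W \<rightarrow> Y\<guillemotright>"
    "p \<cdot> i = ident D Z" "p' \<cdot> i' = ident D Y" "p' \<cdot> i = \<zero>\<^bsub>Hom D Z Y\<^esub>" "p \<cdot> i' = \<zero>\<^bsub>Hom D Y Z\<^esub>"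
    by (rule direct_sum2E)
  note cp = arrow_comp[OF w(3) c] and bp = arrow_comp[OF w(4) b]
  have "(c \<cdot> p \<oplus>\<^bsub>Hom D W B\<^esub> b \<cdot> p') \<cdot> i = c"
    by (simp only: add_comp[OF w(1) cp bp] assoc[OF w(1,3) c, symmetric] assoc[OF w(1,4) b, symmetric]
        w(5,7) comp_id[OF c] comp_zero[OF b O(1)] add_zero(1)[OF c])
  moreover have "(c \<cdot> p \<oplus>\<^bsub>Hom D W B\<^esub> b \<cdot> p') \<cdot> i' = b"
    by (simp only: add_comp[OF w(2) cp bp] assoc[OF w(2,3) c, symmetric] assoc[OF w(2,4) b, symmetric]
        w(6,8) comp_id[OF b] comp_zero[OF c O(2)] add_zero(2)[OF b])
  ultimately show thesis using that[OF W arrow_add[OF cp bp] w(1,2)] by blast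
qed

lemma pair:
  assumes c: "\<guillemotleft>c : A \<rightarrow> Z\<guillemotright>" and b: "\<guillemotleft>b : A \<rightarrow> Y\<guillemotright>"
  obtains W s p p' where "direct_sum D W [Z, Y]" "\<guillemotleft>s : A \<rightarrow> W\<guillemotright>" "\<guillemotleft>p : W \<rightarrow> Z\<guillemotright>" "\<guillemotleft>p' : W \<rightarrow> Y\<guillemotright>"
    "p \<cdot> s = c" "p' \<cdot> s = b"
proof -
  have O: "Z \<in> Obj D" "Y \<in> Obj D" "A \<in> Obj D" using b c by (auto dest: arrowD)
  obtain W where W: "direct_sum D W [Z, Y]" using ex_direct_sum O by blast
  then obtain i i' p p' where w: "\<guillemotleft>i : Z \<rightarrow> W\<guillemotright>" "\<guillemotleft>i' : Y \<rightarrow> W\<guillemotright>" "\<guillemotleft>p : W \<rightarrow> Z\<guillemotright>" "\<guillemotleft>p' : W \<rightarrow> Y\<guillemotright>"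
    "p \<cdot> i = ident D Z" "p' \<cdot> i' = ident D Y" "p' \<cdot> i = \<zero>\<^bsub>Hom D Z Y\<^esub>" "p \<cdot> i' = \<zero>\<^bsub>Hom D Y Z\<^esub>"
    by (rule direct_sum2E)
  note ic = arrow_comp[OF c w(1)] and ib = arrow_comp[OF b w(2)]
  have "p \<cdot> (i \<cdot> c \<oplus>\<^bsub>Hom D A W\<^esub> i' \<cdot> b) = c"
    by (simp only: comp_add[OF ic ib w(3)] assoc[OF c w(1,3)] assoc[OF b w(2,3)]
        w(5,8) id_comp[OF c] zero_comp[OF b O(1)] add_zero(1)[OF c])
  moreover have "p' \<cdot> (i \<cdot> c \<oplus>\<^bsub>Hom D A W\<^esub> i' \<cdot> b) = b"
    by (simp only: comp_add[OF ic ib w(4)] assoc[OF c w(1,4)] assoc[OF b w(2,4)]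
        w(6,7) id_comp[OF b] zero_comp[OF c O(2)] add_zero(2)[OF b])
  ultimately show thesis using that[OF W arrow_add[OF ic ib] w(3,4)] by blast
qed

lemma zero_obj_summands: "zero_obj D Z \<Longrightarrow> Z \<in> summands \<X>"
  using through.zero[of Z Z \<X>] by (simp add: zero_obj_iff summands_def)

lemma direct_sum2_summands:
  assumes "direct_sum D W [Z, Y]" "Z \<in> summands \<X>" "Y \<in> summands \<X>"
  shows "W \<in> summands \<X>"
proof (rule summands_trans)
  show "W \<in> summands {Z, Y}" using direct_sum_summands(1)[OF assms(1)] by simp
  show "{Z, Y} \<subseteq> summands \<X>" using assms(2,3) by blast
qed

lemma hom_finiteE:
  assumes "hom_finite K D" "X \<in> Obj D" "B \<in> Obj D"
  obtains G where "finite G" "G \<subseteq> Mor D X B" "\<forall>f \<in> Mor D X B.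
      \<exists>a \<in> G \<rightarrow> carrier K. f = (\<Oplus>\<^bsub>Hom D X B\<^esub> b \<in> G. a b \<odot>\<^bsub>Hom D X B\<^esub> b)"
proof -
  have "\<exists>G. finite G \<and> G \<subseteq> Mor D X B \<and> (\<forall>f \<in> Mor D X B. \<exists>a \<in> G \<rightarrow> carrier K.
      f = (\<Oplus>\<^bsub>Hom D X B\<^esub> b \<in> G. a b \<odot>\<^bsub>Hom D X B\<^esub> b))"
    by (rule bspec[OF bspec[OF assms(1)[unfolded hom_finite_def] assms(2)] assms(3)])
  then show thesis by (elim exE conjE) (rule that)
qed

lemma combination_induct:
  assumes O: "X \<in> Obj D" "B \<in> Obj D" and G: "finite G" "G \<subseteq> Mor D X B" and a: "a \<in> G \<rightarrow> carrier K"
    and P: "P \<zero>\<^bsub>Hom D X B\<^esub>"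
      "\<And>g h. \<lbrakk>\<guillemotleft>g : X \<rightarrow> B\<guillemotright>; \<guillemotleft>h : X \<rightarrow> B\<guillemotright>; P g; P h\<rbrakk> \<Longrightarrow> P (g \<oplus>\<^bsub>Hom D X B\<^esub> h)"
      "\<And>a g. \<lbrakk>a \<in> carrier K; \<guillemotleft>g : X \<rightarrow> B\<guillemotright>; P g\<rbrakk> \<Longrightarrow> P (a \<odot>\<^bsub>Hom D X B\<^esub> g)"
      "\<And>g. g \<in> G \<Longrightarrow> P g"
  shows "P (\<Oplus>\<^bsub>Hom D X B\<^esub> b \<in> G. a b \<odot>\<^bsub>Hom D X B\<^esub> b)"
proof (rule finsum_induct[OF O G(1), of P, OF P(1,2)])
  fix g assume g: "g \<in> G"
  then have "\<guillemotleft>g : X \<rightarrow> B\<guillemotright>" "a g \<in> carrier K" using G(2) a O by (auto simp: arrow_def)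
  then show "\<guillemotleft>a g \<odot>\<^bsub>Hom D X B\<^esub> g : X \<rightarrow> B\<guillemotright>" "P (a g \<odot>\<^bsub>Hom D X B\<^esub> g)" using P(3) P(4)[OF g] by blast+
qed

text \<open>The members of a finite spanning set of \<open>Hom(X, B)\<close> are assembled into one morphism
  \<open>X\<^sup>n \<rightarrow> B\<close>; linear combinations of them then factor through it as well.\<close>

lemma ex_right_approximation:
  assumes hf: "hom_finite K D" and O: "X \<in> Obj D" "B \<in> Obj D"
  obtains Z \<sigma> where "Z \<in> summands {X}" "\<guillemotleft>\<sigma> : Z \<rightarrow> B\<guillemotright>"
    "\<And>Y g. \<lbrakk>Y \<in> summands {X}; \<guillemotleft>g : Y \<rightarrow> B\<guillemotright>\<rbrakk> \<Longrightarrow> \<exists>k. \<guillemotleft>k : Y \<rightarrow> Z\<guillemotright> \<and> g = \<sigma> \<cdot> k"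
proof -
  obtain G where G: "finite G" "G \<subseteq> Mor D X B" and span: "\<forall>f \<in> Mor D X B.
      \<exists>a \<in> G \<rightarrow> carrier K. f = (\<Oplus>\<^bsub>Hom D X B\<^esub> b \<in> G. a b \<odot>\<^bsub>Hom D X B\<^esub> b)"
    by (rule hom_finiteE[OF hf O])
  have "\<exists>Z \<sigma>. Z \<in> summands {X} \<and> \<guillemotleft>\<sigma> : Z \<rightarrow> B\<guillemotright> \<and> (\<forall>b \<in> G. \<exists>k. \<guillemotleft>k : X \<rightarrow> Z\<guillemotright> \<and> b = \<sigma> \<cdot> k)"
    using G
  proof (induction G rule: finite_induct)
    case empty
    obtain Z where Z: "zero_obj D Z" using ex_zero_obj by blast
    then have "\<guillemotleft>\<zero>\<^bsub>Hom D Z B\<^esub> : Z \<rightarrow> B\<guillemotright>" using O by (auto simp: zero_obj_iff)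
    then show ?case using zero_obj_summands[OF Z] by blast
  next
    case (insert b G)
    then obtain Z \<sigma> where Z: "Z \<in> summands {X}" and \<sigma>: "\<guillemotleft>\<sigma> : Z \<rightarrow> B\<guillemotright>"
      and k: "\<And>b. b \<in> G \<Longrightarrow> \<exists>k. \<guillemotleft>k : X \<rightarrow> Z\<guillemotright> \<and> b = \<sigma> \<cdot> k" by auto
    have b: "\<guillemotleft>b : X \<rightarrow> B\<guillemotright>" using insert.prems O by (simp add: arrow_def)
    obtain W s i i' where w: "direct_sum D W [Z, X]" "\<guillemotleft>s : W \<rightarrow> B\<guillemotright>" "\<guillemotleft>i : Z \<rightarrow> W\<guillemotright>" "\<guillemotleft>i' : X \<rightarrow> W\<guillemotright>"
      "s \<cdot> i = \<sigma>" "s \<cdot> i' = b" by (rule copair[OF \<sigma> b])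
    have "\<exists>k. \<guillemotleft>k : X \<rightarrow> W\<guillemotright> \<and> b' = s \<cdot> k" if "b' \<in> insert b G" for b'
    proof (cases "b' = b")
      case True
      then show ?thesis using w(4,6) by auto
    next
      case False
      then obtain k where "\<guillemotleft>k : X \<rightarrow> Z\<guillemotright>" "b' = \<sigma> \<cdot> k" using k \<open>b' \<in> insert b G\<close> by auto
      then show ?thesis using assoc[of k X Z i W s B] w(2,3,5) by (intro exI[of _ "i \<cdot> k"]) auto
    qed
    moreover have "W \<in> summands {X}"
      by (rule direct_sum2_summands[OF w(1) Z summands_refl]) (auto simp: O)
    ultimately show ?case using w(2) by blast
  qed
  then obtain Z \<sigma> where Z: "Z \<in> summands {X}" and \<sigma>: "\<guillemotleft>\<sigma> : Z \<rightarrow> B\<guillemotright>"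
    and kG: "\<And>b. b \<in> G \<Longrightarrow> \<exists>k. \<guillemotleft>k : X \<rightarrow> Z\<guillemotright> \<and> b = \<sigma> \<cdot> k" by blast
  have ZO: "Z \<in> Obj D" by (rule summandsD(1)[OF Z])
  have kX: "\<exists>k. \<guillemotleft>k : X \<rightarrow> Z\<guillemotright> \<and> g = \<sigma> \<cdot> k" if g: "\<guillemotleft>g : X \<rightarrow> B\<guillemotright>" for g
  proof -
    obtain r where r: "r \<in> G \<rightarrow> carrier K" and gr: "g = (\<Oplus>\<^bsub>Hom D X B\<^esub> b \<in> G. r b \<odot>\<^bsub>Hom D X B\<^esub> b)"
      using span arrowD(3)[OF g] by blast
    show ?thesis unfolding gr
    proof (rule combination_induct[OF O G r])
    show "\<exists>k. \<guillemotleft>k : X \<rightarrow> Z\<guillemotright> \<and> \<zero>\<^bsub>Hom D X B\<^esub> = \<sigma> \<cdot> k"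
      using comp_zero[OF \<sigma> O(1), symmetric] arrow_zero[OF O(1) ZO] by blast
    show "\<exists>k. \<guillemotleft>k : X \<rightarrow> Z\<guillemotright> \<and> f \<oplus>\<^bsub>Hom D X B\<^esub> f' = \<sigma> \<cdot> k"
      if "\<exists>k. \<guillemotleft>k : X \<rightarrow> Z\<guillemotright> \<and> f = \<sigma> \<cdot> k" "\<exists>k. \<guillemotleft>k : X \<rightarrow> Z\<guillemotright> \<and> f' = \<sigma> \<cdot> k" for f f'
      using that comp_add[OF _ _ \<sigma>, symmetric] by blast
    show "\<exists>k. \<guillemotleft>k : X \<rightarrow> Z\<guillemotright> \<and> a \<odot>\<^bsub>Hom D X B\<^esub> f = \<sigma> \<cdot> k"
      if a: "a \<in> carrier K" and f: "\<exists>k. \<guillemotleft>k : X \<rightarrow> Z\<guillemotright> \<and> f = \<sigma> \<cdot> k" for a f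
    proof -
      obtain k where k: "\<guillemotleft>k : X \<rightarrow> Z\<guillemotright>" "f = \<sigma> \<cdot> k" using f by blast
      then show ?thesis using smult_right[OF k(1) \<sigma> a] arrow_smult[OF a k(1)] by auto
    qed
    qed (rule kG)
  qed
  show thesis
  proof (rule that[OF Z \<sigma>])
    fix Y g assume Y: "Y \<in> summands {X}" and g: "\<guillemotleft>g : Y \<rightarrow> B\<guillemotright>"
    note YO = arrowD(1)[OF g]
    have "g \<in> through {X} Y B" using through_comp[OF summandsD(2)[OF Y] YO g] comp_id[OF g] by simp
    then show "\<exists>k. \<guillemotleft>k : Y \<rightarrow> Z\<guillemotright> \<and> g = \<sigma> \<cdot> k"
    proof (rule through_closed_under[OF _ YO O(2)])
      show "\<exists>k. \<guillemotleft>k : Y \<rightarrow> Z\<guillemotright> \<and> \<zero>\<^bsub>Hom D Y B\<^esub> = \<sigma> \<cdot> k" using comp_zero[OF \<sigma> YO, symmetric] arrow_zero[OF YO ZO] by blast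
      show "\<exists>k. \<guillemotleft>k : Y \<rightarrow> Z\<guillemotright> \<and> f \<oplus>\<^bsub>Hom D Y B\<^esub> f' = \<sigma> \<cdot> k"
        if "\<exists>k. \<guillemotleft>k : Y \<rightarrow> Z\<guillemotright> \<and> f = \<sigma> \<cdot> k" "\<exists>k. \<guillemotleft>k : Y \<rightarrow> Z\<guillemotright> \<and> f' = \<sigma> \<cdot> k" for f f'
        using that comp_add[OF _ _ \<sigma>, symmetric] by blast
      fix X' a b assume X': "X' \<in> {X}" and a: "\<guillemotleft>a : Y \<rightarrow> X'\<guillemotright>" and b: "\<guillemotleft>b : X' \<rightarrow> B\<guillemotright>"
      obtain k where k: "\<guillemotleft>k : X' \<rightarrow> Z\<guillemotright>" "b = \<sigma> \<cdot> k" using kX b X' by auto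
      then show "\<exists>k. \<guillemotleft>k : Y \<rightarrow> Z\<guillemotright> \<and> b \<cdot> a = \<sigma> \<cdot> k" using assoc[OF a k(1) \<sigma>] a by (intro exI[of _ "k \<cdot> a"]) auto
    qed
  qed
qed

text \<open>A morphism into \<open>add(U)\<close> is a sum of morphisms that pass through \<open>U\<close> itself.\<close>

lemma left_factor_summands:
  assumes f: "\<guillemotleft>f : V \<rightarrow> Z\<guillemotright>" and U: "\<And>g. \<guillemotleft>g : V \<rightarrow> U\<guillemotright> \<Longrightarrow> \<exists>k. \<guillemotleft>k : Z \<rightarrow> U\<guillemotright> \<and> g = k \<cdot> f"
    and Y: "Y \<in> summands {U}" and g: "\<guillemotleft>g : V \<rightarrow> Y\<guillemotright>"
  shows "\<exists>k. \<guillemotleft>k : Z \<rightarrow> Y\<guillemotright> \<and> g = k \<cdot> f"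
proof -
  note O = arrowD(1,2)[OF g] and ZO = arrowD(2)[OF f]
  have "g \<in> through {U} V Y" using comp_through[OF summandsD(2)[OF Y] O(2) g] id_comp[OF g] by simp
  then show ?thesis
  proof (rule through_closed_under[OF _ O])
    show "\<exists>k. \<guillemotleft>k : Z \<rightarrow> Y\<guillemotright> \<and> \<zero>\<^bsub>Hom D V Y\<^esub> = k \<cdot> f" using zero_comp[OF f O(2), symmetric] arrow_zero[OF ZO O(2)] by blast
    show "\<exists>k. \<guillemotleft>k : Z \<rightarrow> Y\<guillemotright> \<and> h \<oplus>\<^bsub>Hom D V Y\<^esub> h' = k \<cdot> f"
      if "\<exists>k. \<guillemotleft>k : Z \<rightarrow> Y\<guillemotright> \<and> h = k \<cdot> f" "\<exists>k. \<guillemotleft>k : Z \<rightarrow> Y\<guillemotright> \<and> h' = k \<cdot> f" for h h'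
      using that add_comp[OF f, symmetric] by blast
    fix X a b assume X: "X \<in> {U}" and a: "\<guillemotleft>a : V \<rightarrow> X\<guillemotright>" and b: "\<guillemotleft>b : X \<rightarrow> Y\<guillemotright>"
    obtain k where k: "\<guillemotleft>k : Z \<rightarrow> X\<guillemotright>" "a = k \<cdot> f" using U a X by auto
    then show "\<exists>k. \<guillemotleft>k : Z \<rightarrow> Y\<guillemotright> \<and> b \<cdot> a = k \<cdot> f" using assoc[OF f k(1) b] b by (intro exI[of _ "b \<cdot> k"]) auto
  qed
qed

lemma ex_left_approximation:
  assumes hf: "hom_finite K D" and O: "V \<in> Obj D" "U \<in> Obj D"
  obtains Z f where "Z \<in> summands {U}" "\<guillemotleft>f : V \<rightarrow> Z\<guillemotright>"
    "\<And>g. \<guillemotleft>g : V \<rightarrow> U\<guillemotright> \<Longrightarrow> \<exists>k. \<guillemotleft>k : Z \<rightarrow> U\<guillemotright> \<and> g = k \<cdot> f"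
proof -
  obtain G where G: "finite G" "G \<subseteq> Mor D V U" and span: "\<forall>f \<in> Mor D V U.
      \<exists>a \<in> G \<rightarrow> carrier K. f = (\<Oplus>\<^bsub>Hom D V U\<^esub> b \<in> G. a b \<odot>\<^bsub>Hom D V U\<^esub> b)"
    by (rule hom_finiteE[OF hf O])
  have "\<exists>Z f. Z \<in> summands {U} \<and> \<guillemotleft>f : V \<rightarrow> Z\<guillemotright> \<and> (\<forall>b \<in> G. \<exists>k. \<guillemotleft>k : Z \<rightarrow> U\<guillemotright> \<and> b = k \<cdot> f)"
    using G
  proof (induction G rule: finite_induct)
    case empty
    obtain Z where Z: "zero_obj D Z" using ex_zero_obj by blast
    then have "\<guillemotleft>\<zero>\<^bsub>Hom D V Z\<^esub> : V \<rightarrow> Z\<guillemotright>" using O by (auto simp: zero_obj_iff)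
    then show ?case using zero_obj_summands[OF Z] by blast
  next
    case (insert b G)
    then obtain Z f where Z: "Z \<in> summands {U}" and f: "\<guillemotleft>f : V \<rightarrow> Z\<guillemotright>"
      and k: "\<And>b. b \<in> G \<Longrightarrow> \<exists>k. \<guillemotleft>k : Z \<rightarrow> U\<guillemotright> \<and> b = k \<cdot> f" by auto
    have b: "\<guillemotleft>b : V \<rightarrow> U\<guillemotright>" using insert.prems O by (simp add: arrow_def)
    obtain W s p p' where w: "direct_sum D W [Z, U]" "\<guillemotleft>s : V \<rightarrow> W\<guillemotright>" "\<guillemotleft>p : W \<rightarrow> Z\<guillemotright>" "\<guillemotleft>p' : W \<rightarrow> U\<guillemotright>"
      "p \<cdot> s = f" "p' \<cdot> s = b" by (rule pair[OF f b])
    have "\<exists>k. \<guillemotleft>k : W \<rightarrow> U\<guillemotright> \<and> b' = k \<cdot> s" if "b' \<in> insert b G" for b'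
    proof (cases "b' = b")
      case True
      then show ?thesis using w(4,6) by auto
    next
      case False
      then obtain k where "\<guillemotleft>k : Z \<rightarrow> U\<guillemotright>" "b' = k \<cdot> f" using k \<open>b' \<in> insert b G\<close> by auto
      then show ?thesis using assoc[of s V W p Z k U] w(2,3,5) by (intro exI[of _ "k \<cdot> p"]) auto
    qed
    moreover have "W \<in> summands {U}"
      by (rule direct_sum2_summands[OF w(1) Z summands_refl]) (auto simp: O)
    ultimately show ?case using w(2) by blast
  qed
  then obtain Z f where Z: "Z \<in> summands {U}" and f: "\<guillemotleft>f : V \<rightarrow> Z\<guillemotright>"
    and kG: "\<And>b. b \<in> G \<Longrightarrow> \<exists>k. \<guillemotleft>k : Z \<rightarrow> U\<guillemotright> \<and> b = k \<cdot> f" by blast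
  have ZO: "Z \<in> Obj D" by (rule summandsD(1)[OF Z])
  have "\<exists>k. \<guillemotleft>k : Z \<rightarrow> U\<guillemotright> \<and> g = k \<cdot> f" if g: "\<guillemotleft>g : V \<rightarrow> U\<guillemotright>" for g
  proof -
    obtain r where r: "r \<in> G \<rightarrow> carrier K" and gr: "g = (\<Oplus>\<^bsub>Hom D V U\<^esub> b \<in> G. r b \<odot>\<^bsub>Hom D V U\<^esub> b)"
      using span arrowD(3)[OF g] by blast
    show ?thesis unfolding gr
    proof (rule combination_induct[OF O G r])
    show "\<exists>k. \<guillemotleft>k : Z \<rightarrow> U\<guillemotright> \<and> \<zero>\<^bsub>Hom D V U\<^esub> = k \<cdot> f"
      using zero_comp[OF f O(2), symmetric] arrow_zero[OF ZO O(2)] by blast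
    show "\<exists>k. \<guillemotleft>k : Z \<rightarrow> U\<guillemotright> \<and> h \<oplus>\<^bsub>Hom D V U\<^esub> h' = k \<cdot> f"
      if "\<exists>k. \<guillemotleft>k : Z \<rightarrow> U\<guillemotright> \<and> h = k \<cdot> f" "\<exists>k. \<guillemotleft>k : Z \<rightarrow> U\<guillemotright> \<and> h' = k \<cdot> f" for h h'
      using that add_comp[OF f, symmetric] by blast
    show "\<exists>k. \<guillemotleft>k : Z \<rightarrow> U\<guillemotright> \<and> a \<odot>\<^bsub>Hom D V U\<^esub> h = k \<cdot> f"
      if a: "a \<in> carrier K" and h: "\<exists>k. \<guillemotleft>k : Z \<rightarrow> U\<guillemotright> \<and> h = k \<cdot> f" for a h
    proof -
      obtain k where k: "\<guillemotleft>k : Z \<rightarrow> U\<guillemotright>" "h = k \<cdot> f" using h by blast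
      then show ?thesis using smult_left[OF f k(1) a] arrow_smult[OF a k(1)] by auto
    qed
    qed (rule kG)
  qed
  with Z f show thesis by (rule that)
qed

end

section \<open>The two-term objects\<close>

context triangulated_category
begin

text \<open>The objects of \<open>add(S[1])\<close> are the shifts of those of \<open>add(S)\<close>, because \<open>[-1]\<close> undoes \<open>[1]\<close>.\<close>

lemma star_iff:
  assumes S: "S \<in> Obj D"
  shows "T \<in> star D S (shift D 1 S) \<longleftrightarrow>
    (\<exists>X \<in> summands {S}. \<exists>Y \<in> summands {S}. \<exists>f g h. dist_tri D X T (shift D 1 Y) f g h)"
proof -
  have "Y \<in> summands {shift D 1 S} \<longleftrightarrow> (\<exists>Y' \<in> summands {S}. Y = shift D 1 Y')" for Y
  proof
    assume Y: "Y \<in> summands {shift D 1 S}"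
    have "shift D (-1) Y \<in> summands {S}"
      using summands_shift[OF Y, of "-1"] shift_shift_0[OF S, of "-1" 1] by simp
    moreover have "Y = shift D 1 (shift D (-1) Y)" using shift_shift_0[OF summandsD(1)[OF Y], of 1 "-1"] by simp
    ultimately show "\<exists>Y' \<in> summands {S}. Y = shift D 1 Y'" by blast
  qed (use summands_shift in blast)
  then have "T \<in> star D S (shift D 1 S) \<longleftrightarrow>
    (\<exists>X \<in> summands {S}. \<exists>Y. (\<exists>Y' \<in> summands {S}. Y = shift D 1 Y') \<and> (\<exists>f g h. dist_tri D X T Y f g h))"
    unfolding star_def add_of_eq_summands[OF S] add_of_eq_summands[OF shift_Obj[OF S]] Bex_def by simp
  then show ?thesis by blast
qed

lemma star_Obj: "star D X Y \<subseteq> Obj D"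
  unfolding star_def by (auto dest: triD(1) arrowD(2))

lemma summands_star:
  assumes X: "X \<in> summands {S}" and S: "S \<in> Obj D" shows "X \<in> star D S (shift D 1 S)"
proof -
  obtain N where N: "zero_obj D N" using ex_zero_obj by blast
  have "N \<in> summands {shift D 1 S}" by (rule zero_obj_summands[OF N])
  then show ?thesis
    using tri_ident[OF summandsD(1)[OF X] N] X
    unfolding star_def add_of_eq_summands[OF S] add_of_eq_summands[OF shift_Obj[OF S]] by blast
qed

lemma vanish_to_star:
  assumes S: "presilting D S" and X: "X \<in> summands {S}" and T: "T \<in> star D S (shift D 1 S)" and i: "i > 0"
  shows "vanish X (shift D i T)"
proof -
  have SO: "S \<in> Obj D" using S by (simp add: presilting_iff)
  obtain S0 S1 f g h where s: "S0 \<in> summands {S}" "S1 \<in> summands {S}" and t: "dist_tri D S0 T (shift D 1 S1) f g h"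
    using T star_iff[OF SO] by blast
  have "vanish X (shift D i (shift D 1 S1))"
    using presilting_summands[OF S X s(2), of "i + 1"] shift_shift[OF summandsD(1)[OF s(2)], of i 1] i by simp
  then show ?thesis
    using vanish_tri_right_shift[OF t summandsD(1)[OF X] presilting_summands[OF S X s(1) i]] by blast
qed

text \<open>Degree \<open>1\<close> is excluded: for the summand \<open>S[1]\<close> of the triangle it would ask for \<open>Hom(S, X) = 0\<close>.\<close>

lemma vanish_from_star:
  assumes S: "presilting D S" and X: "X \<in> summands {S}" and T: "T \<in> star D S (shift D 1 S)" and i: "i > 1"
  shows "vanish T (shift D i X)"
proof -
  have SO: "S \<in> Obj D" using S by (simp add: presilting_iff)
  obtain S0 S1 f g h where s: "S0 \<in> summands {S}" "S1 \<in> summands {S}" and t: "dist_tri D S0 T (shift D 1 S1) f g h"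
    using T star_iff[OF SO] by blast
  have "vanish (shift D 1 S1) (shift D i X)"
    using presilting_summands[OF S s(2) X, of "i - 1"] vanish_shift_iff[OF summandsD(1)[OF s(2)] summandsD(1)[OF X], of 1 i] i
    by simp
  then show ?thesis
    using vanish_tri_left[OF t] presilting_summands[OF S s(1) X, of i] i by simp
qed

text \<open>\<open>add(S) \<ast> (S \<ast> S[1]) = (add(S) \<ast> add(S)) \<ast> S[1]\<close> by the octahedral axiom, and extensions within
  \<open>add(S)\<close> split.\<close>

lemma star_extension:
  assumes S: "presilting D S" and U: "U \<in> summands {S}" and T: "T \<in> star D S (shift D 1 S)"
    and t: "dist_tri D U X T a b c"
  shows "X \<in> star D S (shift D 1 S)"
proof -
  have SO: "S \<in> Obj D" using S by (simp add: presilting_iff)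
  obtain S0 S1 f g h where s: "S0 \<in> summands {S}" "S1 \<in> summands {S}" and t': "dist_tri D S0 T (shift D 1 S1) f g h"
    using T star_iff[OF SO] by blast
  have gb: "\<guillemotleft>g \<cdot> b : X \<rightarrow> shift D 1 S1\<guillemotright>" by (rule arrow_comp[OF triD(2)[OF t] triD(2)[OF t']])
  obtain C p q where C: "dist_tri D X (shift D 1 S1) C (g \<cdot> b) p q" using tri_cone arrowD[OF gb] by blast
  obtain u v w where o: "dist_tri D (shift D 1 U) C (shift D 1 S0) u v w"
    using octahedral[OF rotate[OF t] rotate[OF t'] C] by blast
  have "vanish (shift D 1 S0) (shift D 1 (shift D 1 U))"
    using presilting_summands[OF S s(1) U, of 1] vanish_shift_both summandsD(1)[OF s(1)] shift_Obj[OF summandsD(1)[OF U]]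
    by simp
  from tri_zero_summands[OF o vanishD[OF this triD(3)[OF o]]]
  have "C \<in> summands {shift D 1 U, shift D 1 S0}" .
  then have "C \<in> summands {shift D 1 S}"
    by (rule summands_trans) (use summands_shift U s(1) in auto)
  from summands_shift[OF this, of "-1"]
  have "shift D (-1) C \<in> summands {S}" using shift_shift_0[OF SO, of "-1" 1] by simp
  moreover obtain h' where "dist_tri D (shift D (-1) C) X (shift D 1 S1) h' (g \<cdot> b) p"
    by (rule rotate_back[OF C])
  ultimately show ?thesis using star_iff[OF SO] s(2) by blast
qed

text \<open>Let \<open>C\<close> be the cone of an approximation \<open>\<sigma> : Z \<rightarrow> B\<close> from \<open>add(S)\<close>. An endomorphism of \<open>B\<close> that factors through some
  \<open>Q \<in> S \<ast> S[1]\<close>, with triangle \<open>S\<^sub>0 \<rightarrow> Q \<rightarrow> S\<^sub>1[1]\<close>, lifts to maps of triangles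
  \<open>(Z, B, C) \<rightarrow> (S\<^sub>0, Q, S\<^sub>1[1]) \<rightarrow> (Z, B, C)\<close> and so induces an endomorphism of \<open>C\<close> through \<open>S\<^sub>1[1]\<close>.
  The identity of \<open>B\<close> is a sum of such endomorphisms, so it is compatible with some \<open>\<psi>\<close> in the ideal of
  \<open>S[1]\<close>. Then \<open>1 - \<psi>\<close> annihilates \<open>B \<rightarrow> C\<close> and thus factors through \<open>Z[1]\<close>, so that the identity of
  \<open>C\<close> lies in the ideal of \<open>S[1]\<close> and \<open>C\<close> in \<open>add(S[1])\<close>.\<close>

lemma star_summands:
  assumes hf: "hom_finite K D" and S: "presilting D S" and B: "B \<in> summands (star D S (shift D 1 S))"
  shows "B \<in> star D S (shift D 1 S)"
proof -
  let ?S = "shift D 1 S"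
  have SO: "S \<in> Obj D" using S by (simp add: presilting_iff)
  note BO = summandsD(1)[OF B]
  obtain Z \<sigma> where Z: "Z \<in> summands {S}" and \<sigma>: "\<guillemotleft>\<sigma> : Z \<rightarrow> B\<guillemotright>"
    and lift: "\<And>Y g. \<lbrakk>Y \<in> summands {S}; \<guillemotleft>g : Y \<rightarrow> B\<guillemotright>\<rbrakk> \<Longrightarrow> \<exists>k. \<guillemotleft>k : Y \<rightarrow> Z\<guillemotright> \<and> g = \<sigma> \<cdot> k"
    using ex_right_approximation[OF hf SO BO] by blast
  obtain C b c where t: "dist_tri D Z B C \<sigma> b c" using tri_cone arrowD[OF \<sigma>] by blast
  note a = triD[OF t]
  have CO: "C \<in> Obj D" and ZO: "Z \<in> Obj D" using a by (auto dest: arrowD)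
  \<comment> \<open>Compatibility with an endomorphism of the cone from the ideal of \<open>S[1]\<close> is additive in \<open>\<phi>\<close>.\<close>
  define P where "P \<phi> \<longleftrightarrow> (\<exists>\<psi> \<in> through {?S} C C. \<psi> \<cdot> b = b \<cdot> \<phi>)" for \<phi>
  have "P (ident D B)"
  proof (rule through_closed_under[OF summandsD(2)[OF B] BO BO])
    show "P \<zero>\<^bsub>Hom D B B\<^esub>"
      unfolding P_def using zero_comp[OF a(2) CO] comp_zero[OF a(2) BO] through.zero by metis
  next
    fix \<phi> \<phi>' assume \<phi>: "\<guillemotleft>\<phi> : B \<rightarrow> B\<guillemotright>" "\<guillemotleft>\<phi>' : B \<rightarrow> B\<guillemotright>" and "P \<phi>" "P \<phi>'"
    then obtain \<psi> \<psi>' where \<psi>: "\<psi> \<in> through {?S} C C" "\<psi>' \<in> through {?S} C C"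
      and eq: "\<psi> \<cdot> b = b \<cdot> \<phi>" "\<psi>' \<cdot> b = b \<cdot> \<phi>'" unfolding P_def by blast
    have "(\<psi> \<oplus>\<^bsub>Hom D C C\<^esub> \<psi>') \<cdot> b = b \<cdot> (\<phi> \<oplus>\<^bsub>Hom D B B\<^esub> \<phi>')"
      using add_comp[OF a(2) through_arrow[OF \<psi>(1) CO CO] through_arrow[OF \<psi>(2) CO CO]] comp_add[OF \<phi> a(2)] eq
      by simp
    then show "P (\<phi> \<oplus>\<^bsub>Hom D B B\<^esub> \<phi>')" unfolding P_def using through_add[OF \<psi> CO CO] by blast
  next
    fix Q \<alpha> \<beta> assume Q: "Q \<in> star D S ?S" and \<alpha>: "\<guillemotleft>\<alpha> : B \<rightarrow> Q\<guillemotright>" and \<beta>: "\<guillemotleft>\<beta> : Q \<rightarrow> B\<guillemotright>"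
    obtain S0 S1 f g h where s: "S0 \<in> summands {S}" "S1 \<in> summands {S}" and t': "dist_tri D S0 Q (shift D 1 S1) f g h"
      using Q star_iff[OF SO] by blast
    note a' = triD[OF t']
    have "g \<cdot> (\<alpha> \<cdot> \<sigma>) = \<zero>\<^bsub>Hom D Z (shift D 1 S1)\<^esub>"
      by (rule vanishD[OF presilting_summands[OF S Z s(2)] arrow_comp[OF arrow_comp[OF \<sigma> \<alpha>] a'(2)]]) simp
    then obtain k where k: "\<guillemotleft>k : Z \<rightarrow> S0\<guillemotright>" "\<alpha> \<cdot> \<sigma> = f \<cdot> k"
      by (rule tri_factor_left[OF t' arrow_comp[OF \<sigma> \<alpha>]])
    obtain \<gamma> where \<gamma>: "\<gamma> \<in> Mor D C (shift D 1 S1)" "\<gamma> \<cdot> b = g \<cdot> \<alpha>"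
      using tri_complete[OF t t' arrowD(3)[OF k(1)] arrowD(3)[OF \<alpha>] k(2)] by blast
    obtain l where l: "\<guillemotleft>l : S0 \<rightarrow> Z\<guillemotright>" "\<beta> \<cdot> f = \<sigma> \<cdot> l" using lift[OF s(1) arrow_comp[OF a'(1) \<beta>]] by blast
    obtain \<delta> where \<delta>: "\<delta> \<in> Mor D (shift D 1 S1) C" "\<delta> \<cdot> g = b \<cdot> \<beta>"
      using tri_complete[OF t' t arrowD(3)[OF l(1)] arrowD(3)[OF \<beta>] l(2)] by blast
    have ar: "\<guillemotleft>\<gamma> : C \<rightarrow> shift D 1 S1\<guillemotright>" "\<guillemotleft>\<delta> : shift D 1 S1 \<rightarrow> C\<guillemotright>"
      using \<gamma>(1) \<delta>(1) CO shift_Obj[OF summandsD(1)[OF s(2)]] by (simp_all add: arrow_def)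
    have "\<delta> \<cdot> \<gamma> \<in> through {shift D 1 S1} C C" by (rule through_single[OF _ ar]) simp
    then have "\<delta> \<cdot> \<gamma> \<in> through {?S} C C"
      by (rule through_trans[OF _ CO CO]) (use summands_shift[OF s(2)] in blast)
    moreover have "\<delta> \<cdot> \<gamma> \<cdot> b = b \<cdot> (\<beta> \<cdot> \<alpha>)"
      using assoc[OF a(2) ar] \<gamma>(2) assoc[OF \<alpha> a'(2) ar(2)] \<delta>(2) assoc[OF \<alpha> \<beta> a(2)] by simp
    ultimately show "P (\<beta> \<cdot> \<alpha>)" unfolding P_def by blast
  qed
  then obtain \<psi> where \<psi>: "\<psi> \<in> through {?S} C C" "\<psi> \<cdot> b = b" unfolding P_def using comp_id[OF a(2)] by auto
  note \<psi>a = through_arrow[OF \<psi>(1) CO CO] and idC = arrow_ident[OF CO]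
  have "(ident D C \<ominus>\<^bsub>Hom D C C\<^esub> \<psi>) \<cdot> b = \<zero>\<^bsub>Hom D B C\<^esub>"
    using minus_comp[OF a(2) idC \<psi>a] id_comp[OF a(2)] \<psi>(2) minus_self[OF a(2)] by simp
  then obtain \<epsilon> where \<epsilon>: "\<guillemotleft>\<epsilon> : shift D 1 Z \<rightarrow> C\<guillemotright>" "ident D C \<ominus>\<^bsub>Hom D C C\<^esub> \<psi> = \<epsilon> \<cdot> c"
    by (rule tri_factor_right[OF rotate[OF t] arrow_minus[OF idC \<psi>a]])
  have "\<epsilon> \<cdot> c \<in> through {shift D 1 Z} C C" by (rule through_single[OF _ a(3) \<epsilon>(1)]) simp
  then have "\<epsilon> \<cdot> c \<in> through {?S} C C"
    by (rule through_trans[OF _ CO CO]) (use summands_shift[OF Z] in blast)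
  from through_add[OF \<psi>(1) this CO CO] have "ident D C \<in> through {?S} C C"
    using add_minus[OF \<psi>a idC] \<epsilon>(2) by simp
  then have "C \<in> summands {?S}" using CO by (simp add: summands_def)
  then show ?thesis
    using t Z unfolding star_def add_of_eq_summands[OF SO] add_of_eq_summands[OF shift_Obj[OF SO]] by blast
qed

section \<open>Thick subcategories\<close>

lemma thick_middle:
  assumes C: "thick_subcategory D C" and t: "dist_tri D X Y Z f g h" and "X \<in> C" "Z \<in> C"
  shows "Y \<in> C"
proof -
  obtain h' where "dist_tri D (shift D (-1) Z) X Y h' f g" by (rule rotate_back[OF t])
  then show ?thesis using C assms(3,4) unfolding thick_subcategory_def by blast
qed

lemma thick_zero_obj:
  assumes C: "thick_subcategory D C" and Z: "zero_obj D Z" shows "Z \<in> C"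
proof -
  obtain X where X: "X \<in> C" "X \<in> Obj D" using C unfolding thick_subcategory_def by blast
  show ?thesis using tri_ident[OF X(2) Z] X(1) C unfolding thick_subcategory_def by blast
qed

text \<open>The inclusion of \<open>X\<close> into \<open>X \<oplus> Y\<close> has cone \<open>Y\<close>.\<close>

lemma thick_direct_sum:
  assumes C: "thick_subcategory D C" and Z: "direct_sum D Z [X, Y]" and "X \<in> C" "Y \<in> C"
  shows "Z \<in> C"
proof -
  obtain i i' p p' where w: "\<guillemotleft>i : X \<rightarrow> Z\<guillemotright>" "\<guillemotleft>i' : Y \<rightarrow> Z\<guillemotright>" "\<guillemotleft>p : Z \<rightarrow> X\<guillemotright>" "\<guillemotleft>p' : Z \<rightarrow> Y\<guillemotright>"
    "p \<cdot> i = ident D X" "p' \<cdot> i' = ident D Y" "i \<cdot> p \<oplus>\<^bsub>Hom D Z Z\<^esub> i' \<cdot> p' = ident D Z"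
    by (rule direct_sum2E[OF Z])
  have O: "X \<in> Obj D" "Y \<in> Obj D" "Z \<in> Obj D" using w(1,2) by (auto dest: arrowD)
  obtain Y' g h where t: "dist_tri D X Z Y' i g h" using tri_cone arrowD[OF w(1)] by blast
  obtain s where s: "\<guillemotleft>s : Y' \<rightarrow> Z\<guillemotright>" "g \<cdot> s = ident D Y'" "i \<cdot> p \<oplus>\<^bsub>Hom D Z Z\<^esub> s \<cdot> g = ident D Z"
    by (rule tri_split[OF t w(3,5)])
  note g = triD(2)[OF t]
  have YO: "Y' \<in> Obj D" by (rule arrowD(2)[OF g])
  interpret H: abelian_group "Hom D Z Z" by (rule Hom_group[OF O(3,3)])
  have sg: "s \<cdot> g = i' \<cdot> p'"
    using H.add.right_cancel[of "i \<cdot> p" "s \<cdot> g" "i' \<cdot> p'"] w(7) s(3)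
      arrowD(3)[OF arrow_comp[OF w(3,1)]] arrowD(3)[OF arrow_comp[OF w(4,2)]] arrowD(3)[OF arrow_comp[OF g s(1)]]
    by (simp add: H.a_comm)
  have "g \<cdot> i' \<cdot> (p' \<cdot> s) = ident D Y'"
    using comp4[OF s(1) w(4,2) g] sg[symmetric] comp4[OF s(1) g s(1) g] assoc[OF g s(1) g] s(2) id_comp[OF g]
    by simp
  moreover have "p' \<cdot> s \<cdot> (g \<cdot> i') = ident D Y"
    using comp4[OF w(2) g s(1) w(4)] sg assoc[OF w(4,2,4)] w(6) id_comp[OF w(4)] by simp
  ultimately have "isomorphic D Y Y'"
    unfolding isomorphic_def iso_mor_def
    using arrowD[OF arrow_comp[OF w(2) g]] arrowD(3)[OF arrow_comp[OF s(1) w(4)]] by blast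
  then have "Y' \<in> C" using C assms(4) unfolding thick_subcategory_def by blast
  then show ?thesis using thick_middle[OF C t] assms(3) by blast
qed

lemma thick_summands:
  assumes C: "thick_subcategory D C" and \<X>: "\<X> \<subseteq> C" and Y: "Y \<in> summands \<X>"
  shows "Y \<in> C"
proof (rule through_factor[OF summandsD(2)[OF Y] summandsD(1)[OF Y] summandsD(1)[OF Y], of "\<lambda>_ Z. Z \<in> C"])
  fix Z d c assume Z: "Z \<in> C" and d: "\<guillemotleft>d : Y \<rightarrow> Z\<guillemotright>" and c: "\<guillemotleft>c : Z \<rightarrow> Y\<guillemotright>" and dc: "ident D Y = c \<cdot> d"
  obtain Y' where "direct_sum D Z [Y, Y']" using retract_direct_sum[OF d c dc[symmetric]] by blast
  then show "Y \<in> C" using C Z unfolding thick_subcategory_def by blast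
qed (use thick_zero_obj[OF C] thick_direct_sum[OF C] \<X> in blast)+

lemma thick_Obj: "thick_subcategory D (Obj D)"
  unfolding thick_subcategory_def
proof (intro conjI allI impI ballI)
  show "Obj D \<noteq> {}" using ex_zero_obj zero_obj_iff by blast
next
  fix X A B assume "direct_sum D X [A, B] \<and> X \<in> Obj D"
  then show "A \<in> Obj D" "B \<in> Obj D" by (meson direct_sum2E arrowD(1))+
qed (auto simp: isomorphic_def shift_Obj dest: triD(2) arrowD(2))

lemma thick_eq_Obj:
  assumes "X \<in> Obj D" and "thick D T = Obj D"
    and "\<And>C. \<lbrakk>thick_subcategory D C; X \<in> C\<rbrakk> \<Longrightarrow> T \<in> C"
  shows "thick D X = Obj D"
proof
  show "thick D X \<subseteq> Obj D" using thick_Obj assms(1) unfolding thick_def by blast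
  show "Obj D \<subseteq> thick D X" using assms(2,3) unfolding thick_def by blast
qed

end

section \<open>Local objects and minimal approximations\<close>

context linear_category
begin

definition local_obj :: "'o \<Rightarrow> bool" where
  "local_obj Y \<longleftrightarrow> Y \<in> Obj D \<and> local_ring (End_ring D Y)"

lemma End_ring_sel:
  "carrier (End_ring D Y) = Mor D Y Y" "f \<otimes>\<^bsub>End_ring D Y\<^esub> g = f \<cdot> g" "\<one>\<^bsub>End_ring D Y\<^esub> = ident D Y"
  "\<zero>\<^bsub>End_ring D Y\<^esub> = \<zero>\<^bsub>Hom D Y Y\<^esub>" "f \<oplus>\<^bsub>End_ring D Y\<^esub> g = f \<oplus>\<^bsub>Hom D Y Y\<^esub> g"
  by (simp_all add: End_ring_def)

definition unit_mor :: "'o \<Rightarrow> 'm \<Rightarrow> bool" where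
  "unit_mor Y f \<longleftrightarrow> (\<exists>g. \<guillemotleft>g : Y \<rightarrow> Y\<guillemotright> \<and> g \<cdot> f = ident D Y \<and> f \<cdot> g = ident D Y)"

lemma Units_End_ring:
  "\<lbrakk>Y \<in> Obj D; f \<in> Mor D Y Y\<rbrakk> \<Longrightarrow> f \<in> Units (End_ring D Y) \<longleftrightarrow> unit_mor Y f"
  by (auto simp: Units_def End_ring_sel unit_mor_def arrow_def)

lemma local_obj_add:
  assumes Y: "local_obj Y" and f: "\<guillemotleft>f : Y \<rightarrow> Y\<guillemotright>" "\<guillemotleft>g : Y \<rightarrow> Y\<guillemotright>" and u: "unit_mor Y (f \<oplus>\<^bsub>Hom D Y Y\<^esub> g)"
  shows "unit_mor Y f \<or> unit_mor Y g"
proof (rule ccontr)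
  assume n: "\<not> (unit_mor Y f \<or> unit_mor Y g)"
  have O: "Y \<in> Obj D" using Y by (simp add: local_obj_def)
  note m = arrowD(3)[OF f(1)] arrowD(3)[OF f(2)]
  have "f \<in> carrier (End_ring D Y) - Units (End_ring D Y)" "g \<in> carrier (End_ring D Y) - Units (End_ring D Y)"
    using n m Units_End_ring[OF O] by (auto simp: End_ring_sel)
  then have "f \<oplus>\<^bsub>End_ring D Y\<^esub> g \<notin> Units (End_ring D Y)"
    using Y unfolding local_obj_def local_ring_def by blast
  then show False using u Units_End_ring[OF O] arrowD(3)[OF arrow_add[OF f]] by (simp add: End_ring_sel)
qed

lemma local_obj_nonzero: "local_obj Y \<Longrightarrow> ident D Y \<noteq> \<zero>\<^bsub>Hom D Y Y\<^esub>"
  unfolding local_obj_def local_ring_def by (simp add: End_ring_sel)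

lemma unit_ident: "Y \<in> Obj D \<Longrightarrow> unit_mor Y (ident D Y)"
  unfolding unit_mor_def using comp_id[OF arrow_ident] arrow_ident by blast

lemma unit_idempotent:
  assumes e: "\<guillemotleft>e : Y \<rightarrow> Y\<guillemotright>" "e \<cdot> e = e" and u: "unit_mor Y e"
  shows "e = ident D Y"
proof -
  obtain g where g: "\<guillemotleft>g : Y \<rightarrow> Y\<guillemotright>" "g \<cdot> e = ident D Y" using u unfolding unit_mor_def by blast
  have "g \<cdot> (e \<cdot> e) = e" using assoc[OF e(1) e(1) g(1)] g(2) id_comp[OF e(1)] by simp
  then show ?thesis using e(2) g(2) by simp
qed

lemma local_obj_idempotent:
  assumes Y: "local_obj Y" and e: "\<guillemotleft>e : Y \<rightarrow> Y\<guillemotright>" "e \<cdot> e = e"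
  shows "e = \<zero>\<^bsub>Hom D Y Y\<^esub> \<or> e = ident D Y"
proof -
  have O: "Y \<in> Obj D" using Y by (simp add: local_obj_def)
  note id = arrow_ident[OF O] and e' = arrow_minus[OF arrow_ident[OF O] e(1)]
  have "(ident D Y \<ominus>\<^bsub>Hom D Y Y\<^esub> e) \<cdot> e = \<zero>\<^bsub>Hom D Y Y\<^esub>"
    using minus_comp[OF e(1) id e(1)] id_comp[OF e(1)] e(2) minus_self[OF e(1)] by simp
  moreover have "unit_mor Y e \<or> unit_mor Y (ident D Y \<ominus>\<^bsub>Hom D Y Y\<^esub> e)"
    using local_obj_add[OF Y e(1) e'] add_minus[OF e(1) id] unit_ident[OF O] by simp
  ultimately show ?thesis
  proof (elim disjE)
    assume 0: "(ident D Y \<ominus>\<^bsub>Hom D Y Y\<^esub> e) \<cdot> e = \<zero>\<^bsub>Hom D Y Y\<^esub>" and "unit_mor Y (ident D Y \<ominus>\<^bsub>Hom D Y Y\<^esub> e)"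
    then obtain g where g: "\<guillemotleft>g : Y \<rightarrow> Y\<guillemotright>" "g \<cdot> (ident D Y \<ominus>\<^bsub>Hom D Y Y\<^esub> e) = ident D Y"
      unfolding unit_mor_def by blast
    have "e = g \<cdot> \<zero>\<^bsub>Hom D Y Y\<^esub>" using assoc[OF e(1) e' g(1)] g(2) 0 id_comp[OF e(1)] by simp
    then show ?thesis using comp_zero[OF g(1) O] by simp
  qed (use unit_idempotent[OF e] in blast)
qed

text \<open>A decomposition \<open>Y = A \<oplus> B\<close> makes the projection to \<open>A\<close> an idempotent of a local ring, hence \<open>0\<close>
  or \<open>1\<close>.\<close>

lemma local_obj_indecomposable:
  assumes Y: "local_obj Y" shows "indecomposable D Y"
  unfolding indecomposable_def
proof (intro conjI allI impI)
  show O: "Y \<in> Obj D" using Y by (simp add: local_obj_def)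
  show "\<not> zero_obj D Y" using local_obj_nonzero[OF Y] zero_obj_iff by blast
  fix A B assume "direct_sum D Y [A, B]"
  then obtain i i' p p' where w: "\<guillemotleft>i : A \<rightarrow> Y\<guillemotright>" "\<guillemotleft>i' : B \<rightarrow> Y\<guillemotright>" "\<guillemotleft>p : Y \<rightarrow> A\<guillemotright>" "\<guillemotleft>p' : Y \<rightarrow> B\<guillemotright>"
    "p \<cdot> i = ident D A" "p' \<cdot> i' = ident D B" "p' \<cdot> i = \<zero>\<^bsub>Hom D A B\<^esub>" "p \<cdot> i' = \<zero>\<^bsub>Hom D B A\<^esub>"
    by (rule direct_sum2E)
  note AB = arrowD(1)[OF w(1)] arrowD(1)[OF w(2)] and ip = arrow_comp[OF w(3,1)]
  have "i \<cdot> p \<cdot> (i \<cdot> p) = i \<cdot> p"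
    using comp4[OF w(3,1,3,1)] w(5) comp_id[OF w(1)] by simp
  from local_obj_idempotent[OF Y ip this]
  show "zero_obj D A \<or> zero_obj D B"
  proof
    assume "i \<cdot> p = \<zero>\<^bsub>Hom D Y Y\<^esub>"
    then have "p \<cdot> (i \<cdot> p) \<cdot> i = \<zero>\<^bsub>Hom D A A\<^esub>"
      using comp_zero[OF w(3) O] zero_comp[OF w(1) AB(1)] by simp
    moreover have "p \<cdot> (i \<cdot> p) \<cdot> i = ident D A"
      using comp4[OF w(1,3,1,3)] w(5) comp_id[OF arrow_ident[OF AB(1)]] by simp
    ultimately show ?thesis using AB by (simp add: zero_obj_iff)
  next
    assume "i \<cdot> p = ident D Y"
    then have "p' \<cdot> (i \<cdot> p) \<cdot> i' = ident D B"
      using comp_id[OF w(4)] w(6) by simp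
    moreover have "p' \<cdot> (i \<cdot> p) \<cdot> i' = \<zero>\<^bsub>Hom D B B\<^esub>"
      using comp4[OF w(2,3,1,4)] w(7,8) comp_zero[OF arrow_zero[OF AB] AB(2)] by simp
    ultimately show ?thesis using AB by (simp add: zero_obj_iff)
  qed
qed

text \<open>The exchange property. The identity of \<open>Y\<close> is the sum of the morphisms \<open>p\<iota>\<^sub>j\<pi>\<^sub>ji\<close>, one of which
  is invertible as \<open>Y\<close> is local; then \<open>p\<iota>\<^sub>j\<close> is a split epimorphism from the local object \<open>Y\<^sub>j\<close>
  onto \<open>Y \<noteq> 0\<close>, hence an isomorphism.\<close>

lemma local_exchange:
  assumes Y: "local_obj Y" and bp: "biproduct D Z Ys \<iota> \<pi>" and Ys: "\<And>X. X \<in> set Ys \<Longrightarrow> local_obj X"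
    and i: "\<guillemotleft>i : Y \<rightarrow> Z\<guillemotright>" and p: "\<guillemotleft>p : Z \<rightarrow> Y\<guillemotright>" and pi: "p \<cdot> i = ident D Y"
  obtains j t where "j < length Ys" "\<guillemotleft>t : Y \<rightarrow> Ys ! j\<guillemotright>" "t \<cdot> (p \<cdot> \<iota> j) = ident D (Ys ! j)"
proof -
  note b = biproductD[OF bp]
  have O: "Y \<in> Obj D" using Y by (simp add: local_obj_def)
  have ar: "\<guillemotleft>\<iota> j \<cdot> \<pi> j : Z \<rightarrow> Z\<guillemotright>" "\<guillemotleft>\<iota> j \<cdot> \<pi> j \<cdot> i : Y \<rightarrow> Z\<guillemotright>" "\<guillemotleft>p \<cdot> (\<iota> j \<cdot> \<pi> j \<cdot> i) : Y \<rightarrow> Y\<guillemotright>"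
    if "j \<in> {..<length Ys}" for j
    using that b(3,4) i p by blast+
  have sum: "(\<Oplus>\<^bsub>Hom D Y Y\<^esub> j \<in> {..<length Ys}. p \<cdot> (\<iota> j \<cdot> \<pi> j \<cdot> i)) = ident D Y"
  proof -
    have "ident D Y = p \<cdot> (ident D Z \<cdot> i)" using id_comp[OF i] pi by simp
    then show ?thesis
      by (simp only: b(7)[symmetric] finsum_comp[OF finite_lessThan b(1) ar(1) i]
          comp_finsum[OF finite_lessThan O ar(2) p])
  qed
  have "\<exists>j < length Ys. unit_mor Y (p \<cdot> (\<iota> j \<cdot> \<pi> j \<cdot> i))"
  proof (rule ccontr)
    assume n: "\<not> (\<exists>j < length Ys. unit_mor Y (p \<cdot> (\<iota> j \<cdot> \<pi> j \<cdot> i)))"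
    have "\<not> unit_mor Y (\<Oplus>\<^bsub>Hom D Y Y\<^esub> j \<in> {..<length Ys}. p \<cdot> (\<iota> j \<cdot> \<pi> j \<cdot> i))"
    proof (rule finsum_induct[OF O O finite_lessThan, where P = "\<lambda>f. \<not> unit_mor Y f"])
      show "\<not> unit_mor Y \<zero>\<^bsub>Hom D Y Y\<^esub>"
        using comp_zero[OF _ O] local_obj_nonzero[OF Y] unfolding unit_mor_def by metis
    qed (use local_obj_add[OF Y] ar(3) n in blast)+
    then show False using sum unit_ident[OF O] by simp
  qed
  then obtain j v where j: "j < length Ys" and v: "\<guillemotleft>v : Y \<rightarrow> Y\<guillemotright>" "p \<cdot> (\<iota> j \<cdot> \<pi> j \<cdot> i) \<cdot> v = ident D Y"
    unfolding unit_mor_def by blast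
  have J: "local_obj (Ys ! j)" using Ys j by simp
  let ?t = "\<pi> j \<cdot> i \<cdot> v" and ?q = "p \<cdot> \<iota> j"
  note bi = b(3)[OF j] and bpj = b(4)[OF j]
  have t: "\<guillemotleft>?t : Y \<rightarrow> Ys ! j\<guillemotright>" and q: "\<guillemotleft>?q : Ys ! j \<rightarrow> Y\<guillemotright>" using bi bpj i p v(1) by blast+
  have "p \<cdot> (\<iota> j \<cdot> \<pi> j \<cdot> i) \<cdot> v = ?q \<cdot> ?t"
    using assoc[OF i bpj bi] assoc[OF arrow_comp[OF i bpj] bi p] assoc[OF v(1) arrow_comp[OF i bpj] q] by simp
  then have qt: "?q \<cdot> ?t = ident D Y" using v(2) by simp
  let ?e = "?t \<cdot> ?q"
  have e: "\<guillemotleft>?e : Ys ! j \<rightarrow> Ys ! j\<guillemotright>" using t q by blast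
  have "?e \<cdot> ?e = ?e" using comp4[OF q t q t] qt comp_id[OF t] by simp
  from local_obj_idempotent[OF J e this] have "?e = ident D (Ys ! j)"
  proof
    assume 0: "?e = \<zero>\<^bsub>Hom D (Ys ! j) (Ys ! j)\<^esub>"
    have "ident D Y = ?q \<cdot> ?e \<cdot> ?t"
      using comp4[OF t q t q] qt comp_id[OF arrow_ident[OF O]] by simp
    then have "ident D Y = \<zero>\<^bsub>Hom D Y Y\<^esub>"
      using 0 comp_zero[OF q arrowD(1)[OF q]] zero_comp[OF t O] by simp
    then show ?thesis using local_obj_nonzero[OF Y] by simp
  qed
  then show thesis using that j t by blast
qed

lemma krull_schmidtE:
  assumes "krull_schmidt D" "X \<in> Obj D"
  obtains Ys where "direct_sum D X Ys" "\<And>Y. Y \<in> set Ys \<Longrightarrow> local_obj Y"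
proof -
  obtain Ys where Ys: "direct_sum D X Ys" "\<And>Y. Y \<in> set Ys \<Longrightarrow> local_ring (End_ring D Y)"
    using assms unfolding krull_schmidt_def by blast
  have "Y \<in> Obj D" if "Y \<in> set Ys" for Y using direct_sum_summands(2)[OF Ys(1)] that summandsD(1) by blast
  then show thesis using that Ys unfolding local_obj_def by blast
qed

lemma isomorphicE:
  assumes "isomorphic D X Y"
  obtains f g where "\<guillemotleft>f : X \<rightarrow> Y\<guillemotright>" "\<guillemotleft>g : Y \<rightarrow> X\<guillemotright>" "g \<cdot> f = ident D X" "f \<cdot> g = ident D Y"
  using assms unfolding isomorphic_def iso_mor_def arrow_def by blast

lemma isomorphicI:
  "\<lbrakk>\<guillemotleft>f : X \<rightarrow> Y\<guillemotright>; \<guillemotleft>g : Y \<rightarrow> X\<guillemotright>; g \<cdot> f = ident D X; f \<cdot> g = ident D Y\<rbrakk> \<Longrightarrow> isomorphic D X Y"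
  unfolding isomorphic_def iso_mor_def arrow_def by blast

lemma isomorphic_sym: "isomorphic D X Y \<Longrightarrow> isomorphic D Y X"
  by (erule isomorphicE) (rule isomorphicI)

lemma isomorphic_refl: "X \<in> Obj D \<Longrightarrow> isomorphic D X X"
  using isomorphicI[OF arrow_ident arrow_ident] comp_id[OF arrow_ident] by blast

lemma isomorphic_summands: "isomorphic D X Y \<Longrightarrow> X \<in> summands {Y}"
proof -
  assume "isomorphic D X Y"
  then obtain f g where fg: "\<guillemotleft>f : X \<rightarrow> Y\<guillemotright>" "\<guillemotleft>g : Y \<rightarrow> X\<guillemotright>" "g \<cdot> f = ident D X"
    by (rule isomorphicE)
  show ?thesis using through_single[OF _ fg(1,2), of "{Y}"] fg(3) arrowD(1)[OF fg(1)] by (simp add: summands_def)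
qed

end

lemma ex_representatives:
  assumes refl: "\<And>x. x \<in> set xs \<Longrightarrow> R x x" and sym: "\<And>x y. R x y \<Longrightarrow> R y x"
  shows "\<exists>ys. set ys \<subseteq> set xs \<and> (\<forall>x \<in> set xs. \<exists>y \<in> set ys. R x y) \<and>
    (\<forall>i < length ys. \<forall>j < length ys. i \<noteq> j \<longrightarrow> \<not> R (ys ! i) (ys ! j))"
  using refl
proof (induction xs)
  case Nil
  then show ?case by auto
next
  case (Cons x xs)
  then obtain ys where ys: "set ys \<subseteq> set xs" "\<And>x. x \<in> set xs \<Longrightarrow> \<exists>y \<in> set ys. R x y"
    "\<forall>i < length ys. \<forall>j < length ys. i \<noteq> j \<longrightarrow> \<not> R (ys ! i) (ys ! j)" by auto
  show ?case
  proof (cases "\<exists>y \<in> set ys. R x y")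
    case True
    then show ?thesis using ys by (intro exI[of _ ys]) auto
  next
    case False
    then have "\<not> R x (ys ! i)" "\<not> R (ys ! i) x" if "i < length ys" for i using that sym nth_mem by blast+
    then have "\<forall>i < length (x # ys). \<forall>j < length (x # ys). i \<noteq> j \<longrightarrow> \<not> R ((x # ys) ! i) ((x # ys) ! j)"
      using ys(3) by (auto simp: nth_Cons split: nat.splits)
    moreover have "\<forall>z \<in> set (x # xs). \<exists>y \<in> set (x # ys). R z y" using ys(2) Cons.prems by auto
    ultimately show ?thesis using ys(1) by (intro exI[of _ "x # ys"]) auto
  qed
qed

context triangulated_category
begin

text \<open>A decomposition of \<open>P\<close> into local objects is thinned out to one representative of each
  isomorphism class.\<close>

lemma ex_flat:
  assumes ks: "krull_schmidt D" and P: "P \<in> Obj D"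
  shows "\<exists>B. is_flat D P B"
proof -
  obtain Ys where Ys: "direct_sum D P Ys" "\<And>Y. Y \<in> set Ys \<Longrightarrow> local_obj Y" using krull_schmidtE[OF ks P] by blast
  have O: "set Ys \<subseteq> Obj D" using Ys(2) by (auto simp: local_obj_def)
  obtain Zs where Zs: "set Zs \<subseteq> set Ys" "\<And>Y. Y \<in> set Ys \<Longrightarrow> \<exists>Z \<in> set Zs. isomorphic D Y Z"
    "\<forall>i < length Zs. \<forall>j < length Zs. i \<noteq> j \<longrightarrow> \<not> isomorphic D (Zs ! i) (Zs ! j)"
    using ex_representatives[of Ys "isomorphic D"] isomorphic_refl isomorphic_sym O by blast
  obtain B where B: "direct_sum D B Zs" using ex_direct_sum_list[of Zs] Zs(1) O by blast
  note dB = direct_sum_summands[OF B] and dP = direct_sum_summands[OF Ys(1)]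
  have BO: "B \<in> Obj D" by (rule summandsD(1)[OF dB(1)])
  have "basic_decomposition D B Zs"
    unfolding basic_decomposition_def using B Zs(1,3) Ys(2) local_obj_indecomposable by blast
  then have "basic D B" unfolding basic_def by blast
  moreover have "B \<in> summands {P}" using summands_trans[OF dB(1)] dP(2) Zs(1) by blast
  moreover have "P \<in> summands {B}"
  proof (rule summands_trans[OF dP(1)], rule subsetI)
    fix Y assume "Y \<in> set Ys"
    then obtain Z where Z: "Z \<in> set Zs" "isomorphic D Y Z" using Zs(2) by blast
    show "Y \<in> summands {B}" by (rule summands_trans[OF isomorphic_summands[OF Z(2)]]) (use Z(1) dB(2) in blast)
  qed
  ultimately show ?thesis
    unfolding is_flat_def using add_of_eq_summands[OF BO] add_of_eq_summands[OF P] summands_eq by metis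
qed

text \<open>A minimal approximation is one whose target has a decomposition into as few local objects as
  possible: were \<open>0 \<rightarrow> U\<^sub>1\<close> a nonzero direct summand of \<open>f\<close>, a local summand \<open>Y\<close> of \<open>U\<^sub>1\<close> could be
  exchanged for some \<open>Y\<^sub>j\<close> of the decomposition, and the component of \<open>f\<close> at \<open>Y\<^sub>j\<close> would factor through
  the other components. So \<open>Y\<^sub>j\<close> could be dropped.\<close>

lemma ex_minimal_left_approximation:
  assumes ks: "krull_schmidt D" and hf: "hom_finite K D" and O: "V \<in> Obj D" "U \<in> Obj D"
  obtains Z f where "left_approximation D U V Z f" "left_minimal D V Z f"
proof -
  define Q where "Q n \<longleftrightarrow> (\<exists>Ys Z f. direct_sum D Z Ys \<and> length Ys = n \<and> (\<forall>Y \<in> set Ys. local_obj Y) \<and>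
    Z \<in> summands {U} \<and> \<guillemotleft>f : V \<rightarrow> Z\<guillemotright> \<and> (\<forall>g. \<guillemotleft>g : V \<rightarrow> U\<guillemotright> \<longrightarrow> (\<exists>k. \<guillemotleft>k : Z \<rightarrow> U\<guillemotright> \<and> g = k \<cdot> f)))" for n
  have "\<exists>n. Q n"
  proof (rule ex_left_approximation[OF hf O])
    fix Z f assume Z: "Z \<in> summands {U}" "\<guillemotleft>f : V \<rightarrow> Z\<guillemotright>"
      "\<And>g. \<guillemotleft>g : V \<rightarrow> U\<guillemotright> \<Longrightarrow> \<exists>k. \<guillemotleft>k : Z \<rightarrow> U\<guillemotright> \<and> g = k \<cdot> f"
    obtain Ys where "direct_sum D Z Ys" "\<And>Y. Y \<in> set Ys \<Longrightarrow> local_obj Y"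
      using krull_schmidtE[OF ks summandsD(1)[OF Z(1)]] by blast
    then have "Q (length Ys)" unfolding Q_def
      using Z by (intro exI[of _ Ys] exI[of _ Z] exI[of _ f]) simp
    then show ?thesis ..
  qed
  then obtain n where Qn: "Q n" and least: "\<And>m. m < n \<Longrightarrow> \<not> Q m" using exists_least_iff[of Q] by blast
  from Qn obtain Ys Z f where ds: "direct_sum D Z Ys" and len: "length Ys = n" and loc': "\<forall>Y \<in> set Ys. local_obj Y"
    and Z: "Z \<in> summands {U}" and f: "\<guillemotleft>f : V \<rightarrow> Z\<guillemotright>"
    and fac': "\<forall>g. \<guillemotleft>g : V \<rightarrow> U\<guillemotright> \<longrightarrow> (\<exists>k. \<guillemotleft>k : Z \<rightarrow> U\<guillemotright> \<and> g = k \<cdot> f)"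
    unfolding Q_def by (elim exE conjE) (rule that)
  note loc = bspec[OF loc'] and fac = mp[OF spec[OF fac']]
  have ZO: "Z \<in> Obj D" by (rule summandsD(1)[OF Z])
  have "left_approximation D U V Z f"
    unfolding left_approximation_def add_of_eq_summands[OF O(2)]
  proof (intro conjI ballI Z arrowD(3)[OF f])
    fix Y g assume Y: "Y \<in> summands {U}" and "g \<in> Mor D V Y"
    then have g: "\<guillemotleft>g : V \<rightarrow> Y\<guillemotright>" using O summandsD(1)[OF Y] by (simp add: arrow_def)
    show "\<exists>k \<in> Mor D Z Y. g = k \<cdot> f" using left_factor_summands[OF f fac Y g] arrowD(3) by blast
  qed
  moreover have "left_minimal D V Z f"
    unfolding left_minimal_def
  proof (rule notI, elim exE conjE)
    fix N U1
    assume N: "zero_obj D N" and U1: "U1 \<in> Obj D" "\<not> zero_obj D U1"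
      and sm: "mor_summand D V Z f N U1 \<zero>\<^bsub>Hom D N U1\<^esub>"
    have NO: "N \<in> Obj D" using N by (simp add: zero_obj_iff)
    obtain V2 Z2 \<alpha> \<alpha>' \<beta> \<beta>' f2 where f2: "f2 \<in> Mor D V2 Z2" and bV: "biproduct D V [N, V2] \<alpha> \<alpha>'"
      and bZ: "biproduct D Z [U1, Z2] \<beta> \<beta>'" and eq: "f \<cdot> \<alpha> 0 = \<beta> 0 \<cdot> \<zero>\<^bsub>Hom D N U1\<^esub>" "f \<cdot> \<alpha> 1 = \<beta> 1 \<cdot> f2"
      using sm unfolding mor_summand_def by blast
    note V = biproduct2D[OF bV] and W = biproduct2D[OF bZ]
    have f2: "\<guillemotleft>f2 : V2 \<rightarrow> Z2\<guillemotright>" using f2 V(3) W(3) by (simp add: arrow_def)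
    \<comment> \<open>The projection to \<open>U\<^sub>1\<close> annihilates \<open>f\<close>.\<close>
    note qf = arrow_comp[OF f W(6)]
    have q0: "\<beta>' 0 \<cdot> f \<cdot> \<alpha> 0 = \<zero>\<^bsub>Hom D N U1\<^esub>" by (rule zero_obj_arrow(2)[OF N arrow_comp[OF V(4) qf]])
    have q1: "\<beta>' 0 \<cdot> f \<cdot> \<alpha> 1 = \<zero>\<^bsub>Hom D V2 U1\<^esub>"
      using assoc[OF V(5) f W(6)] eq(2) assoc[OF f2 W(5,6)] W(11) zero_comp[OF f2 U1(1)] by simp
    have "\<beta>' 0 \<cdot> f = \<beta>' 0 \<cdot> f \<cdot> (\<alpha> 0 \<cdot> \<alpha>' 0 \<oplus>\<^bsub>Hom D V V\<^esub> \<alpha> 1 \<cdot> \<alpha>' 1)"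
      by (simp only: V(12) comp_id[OF qf])
    also have "\<dots> = \<zero>\<^bsub>Hom D V U1\<^esub>"
      by (simp only: comp_add[OF arrow_comp[OF V(6,4)] arrow_comp[OF V(7,5)] qf] assoc[OF V(6,4) qf] assoc[OF V(7,5) qf]
          q0 q1 zero_comp[OF V(6) U1(1)] zero_comp[OF V(7) U1(1)] add_zero(1)[OF arrow_zero[OF O(1) U1(1)]])
    finally have q: "\<beta>' 0 \<cdot> f = \<zero>\<^bsub>Hom D V U1\<^esub>" .
    obtain Xs where Xs: "direct_sum D U1 Xs" "\<And>Y. Y \<in> set Xs \<Longrightarrow> local_obj Y" using krull_schmidtE[OF ks U1(1)] by blast
    obtain \<gamma> \<gamma>' where bU: "biproduct D U1 Xs \<gamma> \<gamma>'" using Xs(1) unfolding direct_sum_def by blast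
    have "Xs \<noteq> []"
    proof
      interpret H: abelian_group "Hom D U1 U1" by (rule Hom_group[OF U1(1) U1(1)])
      assume "Xs = []"
      then have "ident D U1 = \<zero>\<^bsub>Hom D U1 U1\<^esub>" using biproductD(7)[OF bU] by simp
      then show False using U1 by (simp add: zero_obj_iff)
    qed
    then have l: "0 < length Xs" and Y: "local_obj (Xs ! 0)" using Xs(2) by auto
    let ?Y = "Xs ! 0" and ?i = "\<beta> 0 \<cdot> \<gamma> 0" and ?p = "\<gamma>' 0 \<cdot> \<beta>' 0"
    note c = biproductD(3-5)[OF bU l]
    have i: "\<guillemotleft>?i : ?Y \<rightarrow> Z\<guillemotright>" by (rule arrow_comp[OF c(1) W(4)])
    have p: "\<guillemotleft>?p : Z \<rightarrow> ?Y\<guillemotright>" by (rule arrow_comp[OF W(6) c(2)])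
    have pi: "?p \<cdot> ?i = ident D ?Y" using comp4[OF c(1) W(4,6) c(2)] W(8) comp_id[OF c(2)] c(3) by simp
    have pf: "?p \<cdot> f = \<zero>\<^bsub>Hom D V ?Y\<^esub>" using assoc[OF f W(6) c(2)] q comp_zero[OF c(2) O(1)] by simp
    obtain \<iota> \<pi> where bp: "biproduct D Z Ys \<iota> \<pi>" using ds unfolding direct_sum_def by blast
    note b = biproductD[OF bp]
    obtain j t where j: "j < length Ys" and t: "\<guillemotleft>t : ?Y \<rightarrow> Ys ! j\<guillemotright>" and tp: "t \<cdot> (?p \<cdot> \<iota> j) = ident D (Ys ! j)"
      by (rule local_exchange[OF Y bp loc i p pi])
    note bi = b(3)[OF j] and bpj = b(4)[OF j]
    let ?J = "{..<length Ys} - {j}"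
    obtain Zs Z' d c where Z': "direct_sum D Z' Zs" "length Zs = card ?J" "set Zs \<subseteq> (!) Ys ` ?J"
      and d: "\<guillemotleft>d : Z \<rightarrow> Z'\<guillemotright>" and c: "\<guillemotleft>c : Z' \<rightarrow> Z\<guillemotright>"
      and cd: "(\<Oplus>\<^bsub>Hom D Z Z\<^esub> k \<in> ?J. \<iota> k \<cdot> \<pi> k) = c \<cdot> d"
      by (rule finsum_factor[of ?J Z Z \<pi> "(!) Ys" \<iota>]) (use ZO b(3,4) in auto)
    interpret H: abelian_group "Hom D Z Z" by (rule Hom_group[OF ZO ZO])
    have ip: "\<guillemotleft>\<iota> k \<cdot> \<pi> k : Z \<rightarrow> Z\<guillemotright>" if "k < length Ys" for k by (rule arrow_comp[OF b(4)[OF that] b(3)[OF that]])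
    have "{..<length Ys} = insert j ?J" using j by blast
    then have "ident D Z = (\<Oplus>\<^bsub>Hom D Z Z\<^esub> k \<in> insert j ?J. \<iota> k \<cdot> \<pi> k)" using b(7) by simp
    also have "\<dots> = \<iota> j \<cdot> \<pi> j \<oplus>\<^bsub>Hom D Z Z\<^esub> c \<cdot> d"
      unfolding cd[symmetric] by (rule H.finsum_insert) (use ip[THEN arrowD(3)] j in auto)
    finally have sum: "ident D Z = \<iota> j \<cdot> \<pi> j \<oplus>\<^bsub>Hom D Z Z\<^esub> c \<cdot> d" .
    \<comment> \<open>The endomorphism \<open>e\<close> fixes \<open>f\<close> and annihilates \<open>\<iota>\<^sub>j\<close>.\<close>
    let ?e = "ident D Z \<ominus>\<^bsub>Hom D Z Z\<^esub> \<iota> j \<cdot> (t \<cdot> ?p)"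
    note idZ = arrow_ident[OF ZO]
    have tpa: "\<guillemotleft>t \<cdot> ?p : Z \<rightarrow> Ys ! j\<guillemotright>" using t p by blast
    have e: "\<guillemotleft>?e : Z \<rightarrow> Z\<guillemotright>" using tpa bi idZ by blast
    have "\<iota> j \<cdot> (t \<cdot> ?p) \<cdot> f = \<zero>\<^bsub>Hom D V Z\<^esub>"
      using assoc[OF f tpa bi] assoc[OF f p t] pf comp_zero[OF t O(1)] comp_zero[OF bi O(1)] by simp
    then have ef: "?e \<cdot> f = f"
      using minus_comp[OF f idZ arrow_comp[OF tpa bi]] id_comp[OF f] minus_zero[OF f] by simp
    have "\<iota> j \<cdot> (t \<cdot> ?p) \<cdot> \<iota> j = \<iota> j"
      using assoc[OF bi tpa bi] assoc[OF bi p t] tp comp_id[OF bi] by simp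
    then have ei: "?e \<cdot> \<iota> j = \<zero>\<^bsub>Hom D (Ys ! j) Z\<^esub>"
      using minus_comp[OF bi idZ arrow_comp[OF tpa bi]] id_comp[OF bi] minus_self[OF bi] by simp
    have "?e = ?e \<cdot> ident D Z" using comp_id[OF e] by simp
    also have "\<dots> = ?e \<cdot> (\<iota> j \<cdot> \<pi> j \<oplus>\<^bsub>Hom D Z Z\<^esub> c \<cdot> d)" using sum by (rule arg_cong)
    also have "\<dots> = ?e \<cdot> (c \<cdot> d)"
      using comp_add[OF ip[OF j] arrow_comp[OF d c] e] assoc[OF bpj bi e] ei zero_comp[OF bpj ZO]
        add_zero(2)[OF arrow_comp[OF arrow_comp[OF d c] e]] by simp
    finally have ecd: "?e \<cdot> (c \<cdot> d) = ?e" by simp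
    have "f = ?e \<cdot> c \<cdot> (d \<cdot> f)"
      using comp4[OF f d c e] assoc[OF d c e] assoc[OF f arrow_comp[OF d c] e] assoc[OF f d arrow_comp[OF c e]] ecd ef by simp
    then have "\<exists>k. \<guillemotleft>k : Z' \<rightarrow> U\<guillemotright> \<and> g = k \<cdot> (d \<cdot> f)" if g: "\<guillemotleft>g : V \<rightarrow> U\<guillemotright>" for g
    proof -
      obtain k where k: "\<guillemotleft>k : Z \<rightarrow> U\<guillemotright>" "g = k \<cdot> f" using fac[OF g] by blast
      have ec: "\<guillemotleft>?e \<cdot> c : Z' \<rightarrow> Z\<guillemotright>" using c e by blast
      have "k \<cdot> f = k \<cdot> (?e \<cdot> c \<cdot> (d \<cdot> f))" using \<open>f = ?e \<cdot> c \<cdot> (d \<cdot> f)\<close> by (rule arg_cong)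
      also have "\<dots> = k \<cdot> (?e \<cdot> c) \<cdot> (d \<cdot> f)" by (rule assoc[OF arrow_comp[OF f d] ec k(1)])
      finally show ?thesis using k arrow_comp[OF ec k(1)] by blast
    qed
    moreover have Zs: "set Zs \<subseteq> set Ys" using Z'(3) by auto
    moreover have "Z' \<in> summands {U}"
    proof (rule summands_trans[OF direct_sum_summands(1)[OF Z'(1)]], rule subsetI)
      fix Y assume "Y \<in> set Zs"
      then have "Y \<in> summands {Z}" using Zs direct_sum_summands(2)[OF ds] by blast
      then show "Y \<in> summands {U}" by (rule summands_trans) (use Z in blast)
    qed
    moreover have "\<guillemotleft>d \<cdot> f : V \<rightarrow> Z'\<guillemotright>" using f d by blast
    ultimately have "Q (length Zs)" unfolding Q_def
      using Z'(1) loc by (intro exI[of _ Zs] exI[of _ Z'] exI[of _ "d \<cdot> f"]) auto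
    moreover have "length Zs < n" using Z'(2) j len by (simp add: card_Diff_singleton)
    ultimately show False using least by blast
  qed
  ultimately show thesis by (rule that)
qed

section \<open>The co-Bongartz completion\<close>

text \<open>The composite of \<open>U' \<rightarrow> X\<close> with a morphism \<open>X \<rightarrow> U[1]\<close> is zero, so the latter factors as \<open>X \<rightarrow> T \<rightarrow> U[1]\<close>. The second factor is the
  shift of a morphism \<open>T[-1] \<rightarrow> U\<close> and thus passes through \<open>f[1] : T \<rightarrow> U'[1]\<close>, whose composite with
  \<open>X \<rightarrow> T\<close> is zero.\<close>

lemma approximation_vanish:
  assumes T: "T \<in> Obj D" and U: "U \<in> Obj D" and U'S: "vanish U' (shift D 1 U)"
    and la: "left_approximation D U (shift D (-1) T) U' f"
    and t: "dist_tri D (shift D (-1) T) U' X f g h"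
  shows "vanish X (shift D 1 U)"
  unfolding vanish_def
proof (intro allI impI)
  fix k assume k: "\<guillemotleft>k : X \<rightarrow> shift D 1 U\<guillemotright>"
  note a = triD[OF t]
  let ?V = "shift D (-1) T"
  have VO: "?V \<in> Obj D" and U'O: "U' \<in> Obj D" using a(1) by (auto dest: arrowD)
  have "k \<cdot> g = \<zero>\<^bsub>Hom D U' (shift D 1 U)\<^esub>" by (rule vanishD[OF U'S arrow_comp[OF a(2) k]])
  then obtain l where l: "\<guillemotleft>l : shift D 1 ?V \<rightarrow> shift D 1 U\<guillemotright>" "k = l \<cdot> h" by (rule tri_factor_right[OF rotate[OF t] k])
  have l': "\<guillemotleft>shift_mor D (-1) l : ?V \<rightarrow> U\<guillemotright>"
    using shift_arrow[OF l(1), of "-1"] shift_shift_0[OF VO, of "-1" 1] shift_shift_0[OF U, of "-1" 1] by simp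
  have "U \<in> add_of D U" using add_of_eq_summands[OF U] summands_refl[of U "{U}"] U by simp
  then obtain m where m: "m \<in> Mor D U' U" "shift_mor D (-1) l = m \<cdot> f"
    using la arrowD(3)[OF l'] unfolding left_approximation_def by blast
  have ma: "\<guillemotleft>m : U' \<rightarrow> U\<guillemotright>" using m(1) U'O U by (simp add: arrow_def)
  note f1 = shift_arrow[OF a(1), of 1] and m1 = shift_arrow[OF ma, of 1]
  have "l = shift_mor D 1 (shift_mor D (-1) l)" using shift_back[OF l(1), of 1 "-1"] by simp
  also have "\<dots> = shift_mor D 1 m \<cdot> shift_mor D 1 f" using m(2) shift_comp[OF a(1) ma] by simp
  finally have lm: "l = shift_mor D 1 m \<cdot> shift_mor D 1 f" .
  have "(\<ominus>\<^bsub>Hom D (shift D 1 ?V) (shift D 1 U')\<^esub> shift_mor D 1 f) \<cdot> h = \<zero>\<^bsub>Hom D X (shift D 1 U')\<^esub>"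
    by (rule tri_comp_zero[OF rotate[OF rotate[OF t]]])
  then have "shift_mor D 1 f \<cdot> h = \<zero>\<^bsub>Hom D X (shift D 1 U')\<^esub>"
    using neg_comp[OF a(3) f1] neg_neg[OF arrow_comp[OF a(3) f1]] neg_zero arrowD[OF k] shift_Obj[OF U'O] by metis
  then show "k = \<zero>\<^bsub>Hom D X (shift D 1 U)\<^esub>"
    using l(2) lm assoc[OF a(3) f1 m1] comp_zero[OF m1 arrowD(1)[OF k]] by simp
qed

lemma ex_co_bongartz:
  assumes ks: "krull_schmidt D" and hf: "hom_finite K D" and O: "U \<in> Obj D" "T \<in> Obj D"
  shows "\<exists>B. is_co_bongartz D U T B"
proof -
  have VO: "shift D (-1) T \<in> Obj D" by (rule shift_Obj[OF O(2)])
  obtain U' f where f: "left_approximation D U (shift D (-1) T) U' f" "left_minimal D (shift D (-1) T) U' f"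
    by (rule ex_minimal_left_approximation[OF ks hf VO O(1)])
  have "U' \<in> Obj D" using f(1) add_of_eq_summands[OF O(1)] summandsD(1) unfolding left_approximation_def by blast
  moreover have "f \<in> Mor D (shift D (-1) T) U'" using f(1) unfolding left_approximation_def by blast
  ultimately obtain X g h where t: "dist_tri D (shift D (-1) T) U' X f g h" using tri_cone[OF VO] by blast
  obtain P where P: "direct_sum D P [U, X]" using ex_direct_sum[OF O(1) arrowD(2)[OF triD(2)[OF t]]] by blast
  then have "P \<in> Obj D" using direct_sum_summands(1) summandsD(1) by blast
  then obtain B where "is_flat D P B" using ex_flat[OF ks] by blast
  then show ?thesis unfolding is_co_bongartz_def using O f t P by blast
qed

text \<open>Everything is read off from the triangle \<open>U' \<rightarrow> X \<rightarrow> T\<close>. The vanishing of \<open>Hom(A, A'[i])\<close> for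
  \<open>A, A' \<in> {U, X}\<close> comes from the outer terms; the approximation property is what handles
  \<open>Hom(X, U[1])\<close>, where \<open>Hom(T, U[1])\<close> need not vanish.\<close>

lemma co_bongartz_silting:
  assumes hf: "hom_finite K D" and S: "presilting D S" and U: "U \<in> summands {S}"
    and T: "T \<in> star D S (shift D 1 S)" "silting D T" and B: "is_co_bongartz D U T B"
  shows "basic D B \<and> silting D B \<and> B \<in> star D S (shift D 1 S)"
proof -
  have SO: "S \<in> Obj D" using S by (simp add: presilting_iff)
  have TO: "T \<in> Obj D" using T(1) star_Obj by blast
  note UO = summandsD(1)[OF U]
  obtain U' X f g h P where la: "left_approximation D U (shift D (-1) T) U' f"
    and t: "dist_tri D (shift D (-1) T) U' X f g h" and P: "direct_sum D P [U, X]" and fl: "is_flat D P B"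
    using B unfolding is_co_bongartz_def by blast
  have XO: "X \<in> Obj D" using triD(2)[OF t] by (rule arrowD)
  have U'U: "U' \<in> summands {U}" using la add_of_eq_summands[OF UO] unfolding left_approximation_def by blast
  have U'S: "U' \<in> summands {S}" by (rule summands_trans[OF U'U]) (use U in blast)
  have t': "dist_tri D U' X T g h (\<ominus>\<^bsub>Hom D T (shift D 1 U')\<^esub> shift_mor D 1 f)"
    using rotate[OF t] shift_shift_0[OF TO, of 1 "-1"] by simp
  have PO: "P \<in> Obj D" using direct_sum_summands(1)[OF P] by (rule summandsD)
  have BO: "B \<in> Obj D"
    using fl direct_sum_summands(1) summandsD(1) unfolding is_flat_def basic_def basic_decomposition_def by blast
  have "summands {B} = summands {P}" using fl add_of_eq_summands BO PO unfolding is_flat_def by blast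
  then have BP: "B \<in> summands {P}" and PB: "P \<in> summands {B}"
    using summands_refl[of B "{B}"] summands_refl[of P "{P}"] BO PO by auto

  \<comment> \<open>\<open>U \<oplus> X\<close> is presilting.\<close>
  have Tp: "vanish T (shift D i T)" if "i > 0" for i using T(2) that by (simp add: silting_def presilting_iff)
  have UU': "vanish U (shift D i U')" and U'U0: "vanish U' (shift D i U)"
    if "i > 0" for i using presilting_summands[OF S] U U'S that by blast+
  have UT: "vanish U (shift D i T)" and U'T: "vanish U' (shift D i T)" if "i > 0" for i
    using vanish_to_star[OF S _ T(1) that] U U'S by blast+
  have UX: "vanish U (shift D i X)" if "i > 0" for i
    by (rule vanish_tri_right_shift[OF t' UO UU'[OF that] UT[OF that]])
  have XU: "vanish X (shift D i U)" if "i > 0" for i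
  proof (cases "i = 1")
    case True
    then show ?thesis using approximation_vanish[OF TO UO U'U0 la t] by simp
  next
    case False
    then show ?thesis using vanish_tri_left[OF t' U'U0[OF that]] vanish_from_star[OF S U T(1), of i] that by simp
  qed
  have XU': "vanish X (shift D i U')" if "i > 0" for i
    by (rule vanish_summands_right[OF summands_shift[OF U'U]]) (use XU[OF that] in simp)
  have XT: "vanish X (shift D i T)" if "i > 0" for i by (rule vanish_tri_left[OF t' U'T[OF that] Tp[OF that]])
  have XX: "vanish X (shift D i X)" if "i > 0" for i
    by (rule vanish_tri_right_shift[OF t' XO XU'[OF that] XT[OF that]])
  have UX2: "vanish A (shift D i A')" if "A \<in> {U, X}" "A' \<in> {U, X}" "i > 0" for A A' i
    using that presilting_summands[OF S U U] UX XU XX by auto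
  have B2: "B \<in> summands {U, X}" by (rule summands_trans[OF BP]) (use direct_sum_summands(1)[OF P] in simp)
  have "presilting D B"
    unfolding presilting_iff
  proof (intro conjI allI impI BO)
    fix i :: int assume i: "i > 0"
    have "vanish A (shift D i B)" if A: "A \<in> {U, X}" for A
    proof -
      have AO: "A \<in> Obj D" using A UO XO by blast
      have eq: "vanish A (shift D i C) \<longleftrightarrow> vanish (shift D (-i) A) C" if "C \<in> Obj D" for C
        using vanish_shift_iff[OF AO that, of "-i" 0] shift_0[OF that] by simp
      have "vanish (shift D (-i) A) B"
        by (rule vanish_summands_right[OF B2]) (use UX2[OF A _ i] eq UO XO in blast)
      then show ?thesis using eq[OF BO] by simp
    qed
    then show "vanish B (shift D i B)" by (rule vanish_summands_left[OF B2])
  qed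

  \<comment> \<open>A thick subcategory containing \<open>U \<oplus> X\<close> contains the third term \<open>T\<close> of the triangle.\<close>
  moreover have "thick D B = Obj D"
  proof (rule thick_eq_Obj[OF BO])
    show "thick D T = Obj D" using T(2) by (simp add: silting_def)
    fix C assume C: "thick_subcategory D C" and BC: "B \<in> C"
    have "P \<in> C" by (rule thick_summands[OF C _ PB]) (use BC in blast)
    then have UXC: "U \<in> C" "X \<in> C" using thick_summands[OF C, of "{P}"] direct_sum_summands(2)[OF P] by auto
    then have "U' \<in> C" using thick_summands[OF C _ U'U] by blast
    then show "T \<in> C" using t' UXC(2) C unfolding thick_subcategory_def by blast
  qed
  moreover have "B \<in> star D S (shift D 1 S)"
  proof (rule star_summands[OF hf S], rule summands_trans[OF B2])
    have "{U, X} \<subseteq> star D S (shift D 1 S)"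
      using summands_star[OF U SO] star_extension[OF S U'S T(1) t'] by blast
    then show "{U, X} \<subseteq> summands (star D S (shift D 1 S))" using summands_refl UO XO by blast
  qed
  ultimately show ?thesis using fl by (simp add: silting_def is_flat_def)
qed

end

theorem theorem6p2p2:
  fixes K :: "('k, 'e) ring_scheme"
    and D :: "('k, 'o, 'm) tri_cat"
    and S U T :: 'o
    and Ss :: "'o list"
  assumes "triangulated_category K D"
    and "krull_schmidt D"
    and "hom_finite K D"
    and "basic_decomposition D S Ss"
    and "silting D S"
    and "U \<in> add_of D S"
    and "T \<in> star D S (shift D 1 S)"
    and "basic D T"
    and "silting D T"
  shows "(\<exists>B. is_co_bongartz D U T B) \<and>
    (\<forall>B. is_co_bongartz D U T B \<longrightarrow>
      basic D B \<and> silting D B \<and> B \<in> star D S (shift D 1 S))"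
proof -
  interpret triangulated_category K D by (rule assms(1))
  have S: "presilting D S" using assms(5) by (simp add: silting_def)
  have U: "U \<in> summands {S}" using assms(6) S add_of_eq_summands by (simp add: presilting_def)
  have T: "T \<in> Obj D" using assms(7) star_Obj by blast
  show ?thesis
    using ex_co_bongartz[OF assms(2,3) summandsD(1)[OF U] T] co_bongartz_silting[OF assms(3) S U assms(7,9)] by blast
qed

end
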